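(* The space of initial conditions $S=\tilde S-(-K_{\tilde S})_{red}$ of the system $\frac{dq}{dt}=\frac{\partial I}{\partial p}$, $\frac{dp}{dt}=-\frac{\partial I}{\partial q}$ (with $I$, $\tilde S$ and $(-K_{\tilde S})_{red}$ as in the context) is obtained by gluing nine copies of $\mathbb{C}^2$, $$S=\mathbb{C}^2\cup\bigcup_{j=0}^{7}U_j,\qquad \mathbb{C}^2\ni(q,p),\quad U_j\cong\mathbb{C}^2\ni(x_j,y_j)\quad(j=0,1,\dots,7),$$ via the birational and symplectic transformations $$\begin{aligned} r_0&: x_0=1/q,\ y_0=-(qp+\alpha_0)q,\\ r_1&: x_1=-(pq-\alpha_1)p,\ y_1=1/p,\\ r_2&: x_2=-(pq-(\alpha_1+\alpha_2))p,\ y_2=1/p,\\ r_3&: x_3=-(pq-(\alpha_1+\alpha_2+\alpha_3))p,\ y_3=1/p,\\ r_4&: x_4=-(p(q-1)-\alpha_4)p,\ y_4=1/p,\\ r_5&: x_5=-(p(q-1)-(\alpha_4+\alpha_5))p,\ y_5=1/p,\\ r_6&: x_6=-(p(q-1)-(\alpha_4+\alpha_5+\alpha_6))p,\ y_6=1/p,\\ r_7&: x_7=-(x_0y_0-\alpha_7)y_0,\ y_7=1/y_0. \end{aligned}$$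
   Context: The parameters $\alpha_0,\dots,\alpha_7\in\mathbb{C}$ satisfy $4\alpha_0+3\alpha_1+2\alpha_2+\alpha_3+3\alpha_4+2\alpha_5+\alpha_6+2\alpha_7=0$ and are such that the ten points below are distinct (i.e. $\alpha_2,\alpha_3,\alpha_2+\alpha_3,\alpha_5,\alpha_6,\alpha_5+\alpha_6\ne0$). The Hamiltonian is $$\begin{aligned} I={}&q^3(q-1)^3p^4+q^2(q-1)^2(2\kappa q+\beta_1)p^3+q(q-1)\{\delta q^2+(\gamma_2-\beta_2-\delta)q+\beta_2\}p^2\\ &+\{2\kappa\varepsilon q^3+f_2q^2-(2\kappa\varepsilon+f_2+\beta_3+\gamma_3)q+\beta_3\}p+\varepsilon^2q^2+\varepsilon b\,q, \end{aligned}$$ where $\kappa=2\alpha_0+\alpha_7$, $\varepsilon=\alpha_0(\alpha_0+\alpha_7)$, $\delta=\kappa^2+2\varepsilon$; $\beta_1,\beta_2,\beta_3$ are the elementary symmetric functions (of degree 1, 2, 3) of $\alpha_1,\ \alpha_1+\alpha_2,\ \alpha_1+\alpha_2+\alpha_3$; $\gamma_1,\gamma_2,\gamma_3$ are the elementary symmetric functions of $\alpha_4,\ \alpha_4+\alpha_5,\ \alpha_4+\alpha_5+\alpha_6$; $f_2=\kappa(\gamma_2-\beta_2)-\kappa^3-2\kappa\varepsilon-\kappa^2\beta_1+\varepsilon\beta_1$, and $b=\gamma_2-\beta_2-\kappa^2-\varepsilon-\kappa\beta_1$. Construction of $\tilde S$. The compact surface $\Sigma_2$ is obtained by gluing four copies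 of $\mathbb{C}^2$ with coordinates $(z_j,w_j)$, $j=0,1,2,3$, via $z_0=q$, $w_0=p$; $z_1=1/q$, $w_1=-(qp+\alpha_0)q$; $z_2=z_0$, $w_2=1/w_0$; $z_3=z_1$, $w_3=1/w_1$. Let $D^{(0)}=\{w_2=0\}\cup\{w_3=0\}\subset\Sigma_2$. Blow up $\Sigma_2$ at $a_\nu^{(0)}=\{(z_2,w_2)=(\nu,0)\}$ ($\nu=0,1$) and $a_\infty^{(0)}=\{(z_3,w_3)=(0,0)\}$, with exceptional curves $D_\nu^{(1)}$; near them use $(u_\nu,v_\nu)=\left(\frac{z_2-\nu}{w_2},w_2\right)$ ($\nu=0,1$), $(u_\infty,v_\infty)=\left(\frac{z_3}{w_3},w_3\right)$. Next blow up the seven points: on $D_0^{(1)}$, $v_0=0$ and $u_0=\alpha_1,\ \alpha_1+\alpha_2,\ \alpha_1+\alpha_2+\alpha_3$; on $D_1^{(1)}$, $v_1=0$ and $u_1=\alpha_4,\ \alpha_4+\alpha_5,\ \alpha_4+\alpha_5+\alpha_6$; on $D_\infty^{(1)}$, $(u_\infty,v_\infty)=(\alpha_7,0)$. Finally contract the strict transform of $D^{(0)}$ and then the image of $D_\infty^{(1)}$ (each a $(-1)$-curve when contracted) to smooth points. The result is $\tilde S$; its anticanonical divisor is $-K_{\tilde S}=D_0^{(1)}+D_1^{(1)}$ (images of strict transforms), which is the pole divisor of $dp\wedge dq$, and $(-K_{\tilde S})_{red}=D_0^{(1)}\cup D_1^{(1)}$. "Obtained by gluing via the $r_j$" means that the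 affine planes with coordinates $(q,p)$ and $(x_j,y_j)$ embed as open subsets covering $S$, identified with each other by the birational maps $r_j$ ($r_7$ being taken relative to $(x_0,y_0)$). *)

theory Defs
  imports "HOL-Analysis.Analysis" "HOL-Computational_Algebra.Polynomial"
begin

type_synonym c2 = "complex \<times> complex"

section \<open>Complex surfaces as spaces with holomorphic functions\<close>

text \<open>Holomorphy in two variables: the real derivative exists and is complex linear.\<close>

definition holomorphic2_on :: "(c2 \<Rightarrow> complex) \<Rightarrow> c2 set \<Rightarrow> bool" where
  "holomorphic2_on f W \<longleftrightarrow>
     (\<forall>z\<in>W. \<exists>a b. (f has_derivative (\<lambda>(h, k). a * h + b * k)) (at z))"

text \<open>A topological space together with its sheaf of holomorphic functions:
  \<open>hol X U f\<close> says that \<open>f\<close> restricted to the open set \<open>U\<close> is a section (values of \<open>f\<close>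
  outside \<open>U\<close> are irrelevant).\<close>

record 'a cspace =
  tp :: "'a topology"
  hol :: "'a set \<Rightarrow> ('a \<Rightarrow> complex) \<Rightarrow> bool"

definition open_subspace :: "'a cspace \<Rightarrow> 'a set \<Rightarrow> 'a cspace" where
  "open_subspace X A = \<lparr>tp = subtopology (tp X) A, hol = hol X\<rparr>"

text \<open>An isomorphism of the affine plane onto an open subspace of \<open>X\<close>.\<close>

definition open_embedding :: "'a cspace \<Rightarrow> (c2 \<Rightarrow> 'a) \<Rightarrow> bool" where
  "open_embedding X \<phi> \<longleftrightarrow> inj \<phi> \<and> range \<phi> \<subseteq> topspace (tp X) \<and>
     (\<forall>V. openin (tp X) (\<phi> ` V) \<longleftrightarrow> open V) \<and>
     (\<forall>V f. open V \<longrightarrow> (hol X (\<phi> ` V) f \<longleftrightarrow> holomorphic2_on (f \<circ> \<phi>) V))"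

text \<open>Surfaces before contraction are given by local parametrizations (inverses of charts)
  \<open>(W, \<phi>)\<close> with \<open>W\<close> open in the plane; they carry the final topology and sheaf.\<close>

type_synonym 'a atlas = "(c2 set \<times> (c2 \<Rightarrow> 'a)) set"

definition atlas_points :: "'a atlas \<Rightarrow> 'a set" where
  "atlas_points A = (\<Union>(W, \<phi>)\<in>A. \<phi> ` W)"

definition atlas_space :: "'a atlas \<Rightarrow> 'a cspace" where
  "atlas_space A =
     \<lparr>tp = topology (\<lambda>U. U \<subseteq> atlas_points A \<and>
              (\<forall>(W, \<phi>)\<in>A. openin (top_of_set W) {z \<in> W. \<phi> z \<in> U})),
      hol = (\<lambda>U f. \<forall>(W, \<phi>)\<in>A. holomorphic2_on (f \<circ> \<phi>) {z \<in> W. \<phi> z \<in> U})\<rparr>"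

lemma openin_atlas_space:
  "openin (tp (atlas_space A)) U \<longleftrightarrow> U \<subseteq> atlas_points A \<and>
     (\<forall>(W, \<phi>)\<in>A. openin (top_of_set W) {z \<in> W. \<phi> z \<in> U})"
proof -
  have int: "{z \<in> W. \<phi> z \<in> S \<inter> T} = {z \<in> W. \<phi> z \<in> S} \<inter> {z \<in> W. \<phi> z \<in> T}"
    for W :: "c2 set" and \<phi> :: "c2 \<Rightarrow> 'a" and S T by auto
  have un: "{z \<in> W. \<phi> z \<in> \<Union>\<K>} = (\<Union>K\<in>\<K>. {z \<in> W. \<phi> z \<in> K})"
    for W :: "c2 set" and \<phi> :: "c2 \<Rightarrow> 'a" and \<K> by auto
  have "istopology (\<lambda>U. U \<subseteq> atlas_points A \<and>
          (\<forall>(W, \<phi>)\<in>A. openin (top_of_set W) {z \<in> W. \<phi> z \<in> U}))"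
    unfolding istopology_def int un
    by (fast intro: openin_Int openin_Union)
  then show ?thesis
    by (simp add: atlas_space_def topology_inverse')
qed


section \<open>Gluing copies of the affine plane\<close>

definition ident :: "('i \<times> c2) rel \<Rightarrow> ('i \<times> c2) rel" where
  "ident R = (R \<union> R\<inverse>)\<^sup>*"

definition glue_pt :: "('i \<times> c2) rel \<Rightarrow> 'i \<Rightarrow> c2 \<Rightarrow> ('i \<times> c2) set" where
  "glue_pt R i z = ident R `` {(i, z)}"

definition glue :: "'i set \<Rightarrow> ('i \<times> c2) rel \<Rightarrow> ('i \<times> c2) set atlas" where
  "glue I R = (\<lambda>i. (UNIV, glue_pt R i)) ` I"


section \<open>Blowing up\<close>

text \<open>Points of a blow-up: the points away from the centres, and over each centre \<open>p\<close> an
  exceptional projective line \<open>Exc p d\<close>. In the coordinates \<open>(x, y)\<close> used at \<open>p = (a, b)\<close>,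
  \<open>d = Some u\<close> is the direction \<open>(x - a) / (y - b) = u\<close> and \<open>d = None\<close> is \<open>y = b\<close>.\<close>

datatype 'a blpt = Old 'a | Exc 'a "complex option"

text \<open>A centre is given by affine coordinates \<open>\<psi>\<close> on the surface and the coordinates
  \<open>(a, b)\<close> of the point to be blown up.\<close>

type_synonym 'a center = "(c2 \<Rightarrow> 'a) \<times> c2"

definition cpoint :: "'a center \<Rightarrow> 'a" where
  "cpoint = (\<lambda>(\<psi>, c). \<psi> c)"

text \<open>The coordinates \<open>(u, v) = ((x - a) / (y - b), y - b)\<close> on the blow-up, and the
  complementary ones \<open>(s, t) = (x - a, (y - b) / (x - a))\<close>.\<close>

definition bl_uv :: "'a center \<Rightarrow> c2 \<Rightarrow> 'a blpt" where
  "bl_uv = (\<lambda>(\<psi>, (a, b)) (u, v).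
     if v = 0 then Exc (\<psi> (a, b)) (Some u) else Old (\<psi> (a + u * v, b + v)))"

definition bl_st :: "'a center \<Rightarrow> c2 \<Rightarrow> 'a blpt" where
  "bl_st = (\<lambda>(\<psi>, (a, b)) (s, t).
     if s = 0 then Exc (\<psi> (a, b)) (if t = 0 then None else Some (1 / t))
     else Old (\<psi> (a + s, b + s * t)))"

text \<open>Simultaneous blow-up; the domains leave out the points that the affine coordinates of one
  centre assign to another centre.\<close>

definition blowup :: "'a atlas \<Rightarrow> 'a center set \<Rightarrow> 'a blpt atlas" where
  "blowup A C =
     (\<lambda>(W, \<phi>). ({z \<in> W. \<phi> z \<notin> cpoint ` C}, Old \<circ> \<phi>)) ` A \<union>
     (\<lambda>c. ({z. bl_uv c z \<notin> Old ` cpoint ` C}, bl_uv c)) ` C \<union>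
     (\<lambda>c. ({z. bl_st c z \<notin> Old ` cpoint ` C}, bl_st c)) ` C"

definition exc_curve :: "'a center \<Rightarrow> 'a blpt set" where
  "exc_curve c = range (Exc (cpoint c))"

definition strict_transform :: "'a atlas \<Rightarrow> 'a center set \<Rightarrow> 'a set \<Rightarrow> 'a blpt set" where
  "strict_transform A C D =
     tp (atlas_space (blowup A C)) closure_of (Old ` (D - cpoint ` C))"


section \<open>Contracting a curve\<close>

text \<open>The quotient collapsing \<open>C\<close> to the point \<open>None\<close>, with the direct image of the sheaf; for a
  \<open>(-1)\<close>-curve this is the smooth surface given by Castelnuovo's contraction.\<close>

definition contract_pt :: "'a set \<Rightarrow> 'a \<Rightarrow> 'a option" where
  "contract_pt C x = (if x \<in> C then None else Some x)"

definition contract :: "'a cspace \<Rightarrow> 'a set \<Rightarrow> 'a option cspace" where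
  "contract X C =
     \<lparr>tp = topology (\<lambda>V. V \<subseteq> contract_pt C ` topspace (tp X) \<and>
              openin (tp X) {x \<in> topspace (tp X). contract_pt C x \<in> V}),
      hol = (\<lambda>V f. hol X {x \<in> topspace (tp X). contract_pt C x \<in> V} (f \<circ> contract_pt C))\<rparr>"

lemma openin_contract:
  "openin (tp (contract X C)) V \<longleftrightarrow> V \<subseteq> contract_pt C ` topspace (tp X) \<and>
     openin (tp X) {x \<in> topspace (tp X). contract_pt C x \<in> V}"
proof -
  have int: "{x \<in> topspace (tp X). contract_pt C x \<in> S \<inter> T} =
      {x \<in> topspace (tp X). contract_pt C x \<in> S} \<inter> {x \<in> topspace (tp X). contract_pt C x \<in> T}"
    for S T by auto
  have un: "{x \<in> topspace (tp X). contract_pt C x \<in> \<Union>\<K>} =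
      (\<Union>K\<in>\<K>. {x \<in> topspace (tp X). contract_pt C x \<in> K})" for \<K> by auto
  have "istopology (\<lambda>V. V \<subseteq> contract_pt C ` topspace (tp X) \<and>
          openin (tp X) {x \<in> topspace (tp X). contract_pt C x \<in> V})"
    unfolding istopology_def int un
    by (fast intro: openin_Int openin_Union)
  then show ?thesis
    by (simp add: contract_def topology_inverse')
qed


section \<open>The surface\<close>

text \<open>The identification of planes 2 and 3 is the composite of the others where these are
  defined, extended over \<open>w = 0\<close>: \<open>1 / w\<^sub>1 = - w\<^sub>2 / (z\<^sub>2 (z\<^sub>2 + \<alpha>\<^sub>0 w\<^sub>2))\<close>.\<close>

definition Sigma2_rel :: "(nat \<Rightarrow> complex) \<Rightarrow> (nat \<times> c2) rel" where
  "Sigma2_rel \<alpha> =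
     {((0, (q, p)), (1, (1 / q, - (q * p + \<alpha> 0) * q))) | q p. q \<noteq> 0} \<union>
     {((0, (z, w)), (2, (z, 1 / w))) | z w. w \<noteq> 0} \<union>
     {((1, (z, w)), (3, (z, 1 / w))) | z w. w \<noteq> 0} \<union>
     {((2, (z, w)), (3, (1 / z, - w / (z * (z + \<alpha> 0 * w))))) | z w.
        z \<noteq> 0 \<and> z + \<alpha> 0 * w \<noteq> 0}"

definition Sigma2 :: "(nat \<Rightarrow> complex) \<Rightarrow> (nat \<times> c2) set atlas" where
  "Sigma2 \<alpha> = glue {0, 1, 2, 3} (Sigma2_rel \<alpha>)"

definition zw :: "(nat \<Rightarrow> complex) \<Rightarrow> nat \<Rightarrow> c2 \<Rightarrow> (nat \<times> c2) set" where
  "zw \<alpha> = glue_pt (Sigma2_rel \<alpha>)"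

definition D_zero :: "(nat \<Rightarrow> complex) \<Rightarrow> (nat \<times> c2) set set" where
  "D_zero \<alpha> = range (\<lambda>z. zw \<alpha> 2 (z, 0)) \<union> range (\<lambda>z. zw \<alpha> 3 (z, 0))"

datatype place = P0 | P1 | Pinf

fun a_center :: "(nat \<Rightarrow> complex) \<Rightarrow> place \<Rightarrow> (nat \<times> c2) set center" where
  "a_center \<alpha> P0 = (zw \<alpha> 2, (0, 0))"
| "a_center \<alpha> P1 = (zw \<alpha> 2, (1, 0))"
| "a_center \<alpha> Pinf = (zw \<alpha> 3, (0, 0))"

definition Bl1 :: "(nat \<Rightarrow> complex) \<Rightarrow> (nat \<times> c2) set blpt atlas" where
  "Bl1 \<alpha> = blowup (Sigma2 \<alpha>) (range (a_center \<alpha>))"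

definition D_one :: "(nat \<Rightarrow> complex) \<Rightarrow> place \<Rightarrow> (nat \<times> c2) set blpt set" where
  "D_one \<alpha> \<nu> = exc_curve (a_center \<alpha> \<nu>)"

fun second_coords :: "(nat \<Rightarrow> complex) \<Rightarrow> place \<Rightarrow> complex set" where
  "second_coords \<alpha> P0 = {\<alpha> 1, \<alpha> 1 + \<alpha> 2, \<alpha> 1 + \<alpha> 2 + \<alpha> 3}"
| "second_coords \<alpha> P1 = {\<alpha> 4, \<alpha> 4 + \<alpha> 5, \<alpha> 4 + \<alpha> 5 + \<alpha> 6}"
| "second_coords \<alpha> Pinf = {\<alpha> 7}"

definition second_centers :: "(nat \<Rightarrow> complex) \<Rightarrow> (nat \<times> c2) set blpt center set" where
  "second_centers \<alpha> = {(bl_uv (a_center \<alpha> \<nu>), (u, 0)) | \<nu> u. u \<in> second_coords \<alpha> \<nu>}"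

definition Bl2 :: "(nat \<Rightarrow> complex) \<Rightarrow> (nat \<times> c2) set blpt blpt atlas" where
  "Bl2 \<alpha> = blowup (Bl1 \<alpha>) (second_centers \<alpha>)"

definition D_zero_strict :: "(nat \<Rightarrow> complex) \<Rightarrow> (nat \<times> c2) set blpt blpt set" where
  "D_zero_strict \<alpha> = strict_transform (Bl1 \<alpha>) (second_centers \<alpha>)
     (strict_transform (Sigma2 \<alpha>) (range (a_center \<alpha>)) (D_zero \<alpha>))"

definition D_one_strict :: "(nat \<Rightarrow> complex) \<Rightarrow> place \<Rightarrow> (nat \<times> c2) set blpt blpt set" where
  "D_one_strict \<alpha> \<nu> = strict_transform (Bl1 \<alpha>) (second_centers \<alpha>) (D_one \<alpha> \<nu>)"

definition D_one_inf_image ::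
    "(nat \<Rightarrow> complex) \<Rightarrow> (nat \<times> c2) set blpt blpt option set" where
  "D_one_inf_image \<alpha> = contract_pt (D_zero_strict \<alpha>) ` D_one_strict \<alpha> Pinf"

definition S_tilde ::
    "(nat \<Rightarrow> complex) \<Rightarrow> (nat \<times> c2) set blpt blpt option option cspace" where
  "S_tilde \<alpha> = contract (contract (atlas_space (Bl2 \<alpha>)) (D_zero_strict \<alpha>)) (D_one_inf_image \<alpha>)"

definition S_tilde_pt :: "(nat \<Rightarrow> complex) \<Rightarrow> (nat \<times> c2) set blpt blpt
    \<Rightarrow> (nat \<times> c2) set blpt blpt option option" where
  "S_tilde_pt \<alpha> = contract_pt (D_one_inf_image \<alpha>) \<circ> contract_pt (D_zero_strict \<alpha>)"

definition anticanonical_red ::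
    "(nat \<Rightarrow> complex) \<Rightarrow> (nat \<times> c2) set blpt blpt option option set" where
  "anticanonical_red \<alpha> = S_tilde_pt \<alpha> ` (D_one_strict \<alpha> P0 \<union> D_one_strict \<alpha> P1)"

definition init_space ::
    "(nat \<Rightarrow> complex) \<Rightarrow> (nat \<times> c2) set blpt blpt option option cspace" where
  "init_space \<alpha> =
     open_subspace (S_tilde \<alpha>) (topspace (tp (S_tilde \<alpha>)) - anticanonical_red \<alpha>)"

text \<open>The point of the surface with coordinates \<open>(z\<^sub>0, w\<^sub>0) = (q, p)\<close>.\<close>

definition qp_point :: "(nat \<Rightarrow> complex) \<Rightarrow> c2 \<Rightarrow> (nat \<times> c2) set blpt blpt option option" where
  "qp_point \<alpha> z = S_tilde_pt \<alpha> (Old (Old (zw \<alpha> 0 z)))"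


section \<open>The transformations\<close>

text \<open>\<open>rmap \<alpha> j\<close> acts on \<open>(q, p)\<close> for \<open>j \<le> 6\<close>, but on \<open>(x\<^sub>0, y\<^sub>0)\<close> for \<open>j = 7\<close>.\<close>

definition rmap :: "(nat \<Rightarrow> complex) \<Rightarrow> nat \<Rightarrow> c2 \<Rightarrow> c2" where
  "rmap \<alpha> j = (\<lambda>(q, p).
     if j = 0 then (1 / q, - (q * p + \<alpha> 0) * q)
     else if j = 1 then (- (p * q - \<alpha> 1) * p, 1 / p)
     else if j = 2 then (- (p * q - (\<alpha> 1 + \<alpha> 2)) * p, 1 / p)
     else if j = 3 then (- (p * q - (\<alpha> 1 + \<alpha> 2 + \<alpha> 3)) * p, 1 / p)
     else if j = 4 then (- (p * (q - 1) - \<alpha> 4) * p, 1 / p)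
     else if j = 5 then (- (p * (q - 1) - (\<alpha> 4 + \<alpha> 5)) * p, 1 / p)
     else if j = 6 then (- (p * (q - 1) - (\<alpha> 4 + \<alpha> 5 + \<alpha> 6)) * p, 1 / p)
     else (- (q * p - \<alpha> 7) * p, 1 / p))"

definition r_dom :: "nat \<Rightarrow> c2 set" where
  "r_dom j = (if j = 0 then {(q, p). q \<noteq> 0} else {(q, p). p \<noteq> 0})"

datatype plane = QP | XY nat

definition planes :: "plane set" where
  "planes = insert QP (XY ` {..7})"

definition r_rel :: "(nat \<Rightarrow> complex) \<Rightarrow> (plane \<times> c2) rel" where
  "r_rel \<alpha> = {((QP, z), (XY j, rmap \<alpha> j z)) | j z. j \<le> 6 \<and> z \<in> r_dom j} \<union>
     {((XY 0, z), (XY 7, rmap \<alpha> 7 z)) | z. z \<in> r_dom 7}"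

text \<open>Polynomials in two variables are polynomials in \<open>y\<close> over polynomials in \<open>x\<close>.\<close>

definition poly2 :: "complex poly poly \<Rightarrow> c2 \<Rightarrow> complex" where
  "poly2 P = (\<lambda>(x, y). poly (poly P [:y:]) x)"

definition generically :: "(c2 \<Rightarrow> bool) \<Rightarrow> bool" where
  "generically Q \<longleftrightarrow> (\<exists>P. P \<noteq> 0 \<and> (\<forall>z. poly2 P z \<noteq> 0 \<longrightarrow> Q z))"

definition rational_fun :: "(c2 \<Rightarrow> complex) \<Rightarrow> bool" where
  "rational_fun f \<longleftrightarrow>
     (\<exists>P Q. Q \<noteq> 0 \<and> (\<forall>z. poly2 Q z \<noteq> 0 \<longrightarrow> f z = poly2 P z / poly2 Q z))"

definition rational_map :: "(c2 \<Rightarrow> c2) \<Rightarrow> bool" where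
  "rational_map F \<longleftrightarrow> rational_fun (fst \<circ> F) \<and> rational_fun (snd \<circ> F)"

definition birational :: "(c2 \<Rightarrow> c2) \<Rightarrow> bool" where
  "birational F \<longleftrightarrow> rational_map F \<and>
     (\<exists>G. rational_map G \<and> generically (\<lambda>z. G (F z) = z) \<and> generically (\<lambda>z. F (G z) = z))"

text \<open>\<open>F\<close> preserves the area form: its holomorphic Jacobian determinant is 1.\<close>

definition symplectic_on :: "c2 set \<Rightarrow> (c2 \<Rightarrow> c2) \<Rightarrow> bool" where
  "symplectic_on D F \<longleftrightarrow> (\<forall>z\<in>D. \<exists>a b c d.
     (F has_derivative (\<lambda>(h, k). (a * h + b * k, c * h + d * k))) (at z) \<and> a * d - b * c = 1)"


section \<open>The Hamiltonian system\<close>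

definition elem1 :: "complex \<Rightarrow> complex \<Rightarrow> complex \<Rightarrow> complex" where
  "elem1 a b c = a + b + c"
definition elem2 :: "complex \<Rightarrow> complex \<Rightarrow> complex \<Rightarrow> complex" where
  "elem2 a b c = a * b + a * c + b * c"
definition elem3 :: "complex \<Rightarrow> complex \<Rightarrow> complex \<Rightarrow> complex" where
  "elem3 a b c = a * b * c"

definition hamiltonian :: "(nat \<Rightarrow> complex) \<Rightarrow> c2 \<Rightarrow> complex" where
  "hamiltonian \<alpha> = (\<lambda>(q, p).
     let \<kappa> = 2 * \<alpha> 0 + \<alpha> 7;
         \<epsilon> = \<alpha> 0 * (\<alpha> 0 + \<alpha> 7);
         \<delta> = \<kappa>^2 + 2 * \<epsilon>;
         \<beta>1 = elem1 (\<alpha> 1) (\<alpha> 1 + \<alpha> 2) (\<alpha> 1 + \<alpha> 2 + \<alpha> 3);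
         \<beta>2 = elem2 (\<alpha> 1) (\<alpha> 1 + \<alpha> 2) (\<alpha> 1 + \<alpha> 2 + \<alpha> 3);
         \<beta>3 = elem3 (\<alpha> 1) (\<alpha> 1 + \<alpha> 2) (\<alpha> 1 + \<alpha> 2 + \<alpha> 3);
         \<gamma>2 = elem2 (\<alpha> 4) (\<alpha> 4 + \<alpha> 5) (\<alpha> 4 + \<alpha> 5 + \<alpha> 6);
         \<gamma>3 = elem3 (\<alpha> 4) (\<alpha> 4 + \<alpha> 5) (\<alpha> 4 + \<alpha> 5 + \<alpha> 6);
         f2 = \<kappa> * (\<gamma>2 - \<beta>2) - \<kappa>^3 - 2 * \<kappa> * \<epsilon> - \<kappa>^2 * \<beta>1 + \<epsilon> * \<beta>1;
         b = \<gamma>2 - \<beta>2 - \<kappa>^2 - \<epsilon> - \<kappa> * \<beta>1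
     in q^3 * (q - 1)^3 * p^4
        + q^2 * (q - 1)^2 * (2 * \<kappa> * q + \<beta>1) * p^3
        + q * (q - 1) * (\<delta> * q^2 + (\<gamma>2 - \<beta>2 - \<delta>) * q + \<beta>2) * p^2
        + (2 * \<kappa> * \<epsilon> * q^3 + f2 * q^2 - (2 * \<kappa> * \<epsilon> + f2 + \<beta>3 + \<gamma>3) * q + \<beta>3) * p
        + \<epsilon>^2 * q^2 + \<epsilon> * b * q)"

text \<open>On the set \<open>T\<close> of complex times, \<open>\<gamma>\<close> solves the system
  \<open>dx/dt = \<partial>H/\<partial>y, dy/dt = - \<partial>H/\<partial>x\<close>.\<close>

definition solves_on :: "(c2 \<Rightarrow> complex) \<Rightarrow> complex set \<Rightarrow> (complex \<Rightarrow> c2) \<Rightarrow> bool" where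
  "solves_on H T \<gamma> \<longleftrightarrow> (\<forall>t\<in>T.
     ((\<lambda>s. fst (\<gamma> s)) has_field_derivative deriv (\<lambda>y. H (fst (\<gamma> t), y)) (snd (\<gamma> t))) (at t) \<and>
     ((\<lambda>s. snd (\<gamma> s)) has_field_derivative - deriv (\<lambda>x. H (x, snd (\<gamma> t))) (fst (\<gamma> t))) (at t))"

end

theory Submission
  imports Defs
begin

text \<open>
  The nine planes are charts of the second blow-up that are defined on all of the plane. An injective
  chart of this kind is an open embedding as soon as every other chart of the atlas has a holomorphic transition into it over an open set. This property is
  inherited by a blow-up, both for the old charts that miss the centres and for the charts \<open>(u, v)\<close>
  at the centres, so no transition between two charts of the second blow-up has to be computed.

  Away from the strict transforms of \<open>D\<^sup>(\<^sup>0\<^sup>)\<close> and of the three curves \<open>D\<^sub>\<nu>\<^sup>(\<^sup>1\<^sup>)\<close> the second blow-up is the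
  union of the nine planes, and the contractions do not affect this open set. On it the Hamiltonian is
  polynomial in each plane: with \<open>e = q p\<close> (or \<open>e = (q - 1) p\<close>) its polar part is a product of linear
  factors in \<open>e\<close>, one of which is the equation of the blown-up point.
\<close>

section \<open>Holomorphic functions of two variables\<close>

text \<open>The two contractions are never studied near the point that they create. The strict
  transform of \<open>D_zero\<close> meets all three first exceptional curves: its intersection with
  the curve over infinity makes both contracted curves end in one point, and its intersection with
  the curve over 0 puts that point on the removed divisor. Away from it the quotient topology and
  the sheaf are those of the second blow-up.

  The statement about solutions shapes the last part. Two planes overlap through a chain of maps
  \<open>r_j\<close> and their inverses, but the gluing relation speaks about single points, while a
  differential equation needs germs. Each link is therefore remembered as a symplectic map on a
  neighbourhood, and a solution is carried along the chain, with a curve constructed in every plane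
  passed on the way.

  The inequalities on the parameters keep the seven second centres apart. The linear relation makes
  one coefficient of the polar part at \<open>q = 1\<close> match the roots prescribed
  there.\<close>

definition holo_at :: "(c2 \<Rightarrow> complex) \<Rightarrow> c2 \<Rightarrow> bool" where
  "holo_at f z \<longleftrightarrow> (\<exists>a b. (f has_derivative (\<lambda>v. a * fst v + b * snd v)) (at z))"

definition holo_map_at :: "(c2 \<Rightarrow> c2) \<Rightarrow> c2 \<Rightarrow> bool" where
  "holo_map_at F z \<longleftrightarrow> holo_at (\<lambda>w. fst (F w)) z \<and> holo_at (\<lambda>w. snd (F w)) z"

lemma holomorphic2_on_iff: "holomorphic2_on f W \<longleftrightarrow> (\<forall>z\<in>W. holo_at f z)"
  by (simp add: holomorphic2_on_def holo_at_def case_prod_unfold)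

lemma holo_at_const: "holo_at (\<lambda>_. c) z"
  unfolding holo_at_def by (rule exI[of _ 0], rule exI[of _ 0]) simp

lemma holo_at_fst: "holo_at fst z"
  unfolding holo_at_def
  by (rule exI[of _ 1], rule exI[of _ 0]) (auto intro!: derivative_eq_intros)

lemma holo_at_snd: "holo_at snd z"
  unfolding holo_at_def
  by (rule exI[of _ 0], rule exI[of _ 1]) (auto intro!: derivative_eq_intros)

lemma holo_at_add:
  assumes "holo_at f z" "holo_at g z" shows "holo_at (\<lambda>w. f w + g w) z"
proof -
  obtain a b c d where "(f has_derivative (\<lambda>v. a * fst v + b * snd v)) (at z)"
    "(g has_derivative (\<lambda>v. c * fst v + d * snd v)) (at z)"
    using assms unfolding holo_at_def by blast
  from has_derivative_add[OF this]
  have "((\<lambda>w. f w + g w) has_derivative (\<lambda>v. (a + c) * fst v + (b + d) * snd v)) (at z)"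
    by (simp add: algebra_simps)
  then show ?thesis unfolding holo_at_def by blast
qed

lemma holo_at_mult:
  assumes "holo_at f z" "holo_at g z" shows "holo_at (\<lambda>w. f w * g w) z"
proof -
  obtain a b c d where "(f has_derivative (\<lambda>v. a * fst v + b * snd v)) (at z)"
    "(g has_derivative (\<lambda>v. c * fst v + d * snd v)) (at z)"
    using assms unfolding holo_at_def by blast
  from has_derivative_mult[OF this]
  have "((\<lambda>w. f w * g w) has_derivative
      (\<lambda>v. (f z * c + a * g z) * fst v + (f z * d + b * g z) * snd v)) (at z)"
    by (simp add: algebra_simps)
  then show ?thesis unfolding holo_at_def by blast
qed

lemma holo_at_minus: "holo_at f z \<Longrightarrow> holo_at (\<lambda>w. - f w) z"
  using holo_at_mult[OF holo_at_const[of "-1"], of f z] by simp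

lemma holo_at_diff: "holo_at f z \<Longrightarrow> holo_at g z \<Longrightarrow> holo_at (\<lambda>w. f w - g w) z"
  using holo_at_add[of f z "\<lambda>w. - g w"] by (simp add: holo_at_minus)

lemma holo_at_power: "holo_at f z \<Longrightarrow> holo_at (\<lambda>w. f w ^ n) z"
  by (induction n) (auto intro: holo_at_mult holo_at_const)

lemma holo_at_inverse:
  assumes "holo_at f z" "f z \<noteq> 0" shows "holo_at (\<lambda>w. inverse (f w)) z"
proof -
  obtain a b where "(f has_derivative (\<lambda>v. a * fst v + b * snd v)) (at z)"
    using assms unfolding holo_at_def by blast
  from Deriv.has_derivative_inverse[OF assms(2) this]
  have "((\<lambda>w. inverse (f w)) has_derivative
      (\<lambda>v. (- inverse (f z) * a * inverse (f z)) * fst v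
         + (- inverse (f z) * b * inverse (f z)) * snd v)) (at z)"
    by (simp add: algebra_simps)
  then show ?thesis unfolding holo_at_def by blast
qed

lemma holo_at_divide:
  "holo_at f z \<Longrightarrow> holo_at g z \<Longrightarrow> g z \<noteq> 0 \<Longrightarrow> holo_at (\<lambda>w. f w / g w) z"
  using holo_at_mult[of f z "\<lambda>w. inverse (g w)"] by (simp add: divide_inverse holo_at_inverse)

lemmas holo_intros = holo_at_const holo_at_fst holo_at_snd holo_at_add holo_at_mult holo_at_minus
  holo_at_diff holo_at_power holo_at_divide

lemma holo_map_at_derivative:
  assumes "holo_map_at F z"
  obtains a b c d where
    "(F has_derivative (\<lambda>v. (a * fst v + b * snd v, c * fst v + d * snd v))) (at z)"
proof -
  obtain a b c d where
    "((\<lambda>w. fst (F w)) has_derivative (\<lambda>v. a * fst v + b * snd v)) (at z)"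
    "((\<lambda>w. snd (F w)) has_derivative (\<lambda>v. c * fst v + d * snd v)) (at z)"
    using assms unfolding holo_at_def holo_map_at_def by blast
  from has_derivative_Pair[OF this] show ?thesis
    using that by simp
qed

lemma holo_at_compose:
  assumes "holo_at f (F z)" "holo_map_at F z" shows "holo_at (\<lambda>w. f (F w)) z"
proof -
  obtain a b c d where F:
    "(F has_derivative (\<lambda>v. (a * fst v + b * snd v, c * fst v + d * snd v))) (at z)"
    using assms(2) by (rule holo_map_at_derivative)
  obtain p q where f: "(f has_derivative (\<lambda>v. p * fst v + q * snd v)) (at (F z))"
    using assms unfolding holo_at_def by blast
  have "((\<lambda>w. f (F w)) has_derivative
      (\<lambda>v. (p * a + q * c) * fst v + (p * b + q * d) * snd v)) (at z)"
    using has_derivative_compose[OF F f] by (simp add: algebra_simps)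
  then show ?thesis unfolding holo_at_def by blast
qed

lemma holo_map_at_compose:
  "holo_map_at G (F z) \<Longrightarrow> holo_map_at F z \<Longrightarrow> holo_map_at (\<lambda>w. G (F w)) z"
  unfolding holo_map_at_def
  using holo_at_compose[of "\<lambda>w. fst (G w)" F z] holo_at_compose[of "\<lambda>w. snd (G w)" F z]
  by (simp add: holo_map_at_def)

lemma holo_at_cong:
  assumes "holo_at f z" "open U" "z \<in> U" "\<And>w. w \<in> U \<Longrightarrow> f w = g w" shows "holo_at g z"
proof -
  obtain a b where "(f has_derivative (\<lambda>v. a * fst v + b * snd v)) (at z)"
    using assms(1) unfolding holo_at_def by blast
  from has_derivative_transform_within_open[OF this assms(2-4)] show ?thesis
    unfolding holo_at_def by blast
qed

lemma holo_map_at_isCont: "holo_map_at F z \<Longrightarrow> isCont F z"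
  by (erule holo_map_at_derivative) (rule has_derivative_continuous)

lemma holo_map_at_id: "holo_map_at (\<lambda>w. w) z"
  unfolding holo_map_at_def by (auto intro: holo_intros)

lemma open_holo_preimage:
  assumes "open U" "\<And>z. z \<in> U \<Longrightarrow> holo_map_at F z" "open V"
  shows "open {z \<in> U. F z \<in> V}"
proof -
  have "continuous_on U F"
    using assms(2) by (intro continuous_at_imp_continuous_on ballI holo_map_at_isCont)
  then have "open (F -` V \<inter> U)"
    using assms(1,3) continuous_on_open_vimage by blast
  moreover have "{z \<in> U. F z \<in> V} = F -` V \<inter> U" by auto
  ultimately show ?thesis by simp
qed


section \<open>Global charts of an atlas\<close>

text \<open>\<open>U\<close> is the whole overlap rather than some open part of it, so that
  preimages of subsets of the image of \<open>\<phi>\<close> can be computed exactly as preimages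
  under \<open>\<tau>\<close>.\<close>

definition transition :: "c2 set \<Rightarrow> (c2 \<Rightarrow> 'a) \<Rightarrow> (c2 \<Rightarrow> 'a) \<Rightarrow> c2 set \<Rightarrow> (c2 \<Rightarrow> c2) \<Rightarrow> bool" where
  "transition W \<xi> \<phi> U \<tau> \<longleftrightarrow> open U \<and> U = {z \<in> W. \<xi> z \<in> range \<phi>} \<and>
     (\<forall>z\<in>U. \<xi> z = \<phi> (\<tau> z) \<and> holo_map_at \<tau> z)"

text \<open>Only transitions into \<open>\<phi>\<close> are recorded: \<open>atlas_space\<close>
  tests openness and holomorphy by pulling back along every chart, and these maps express such a
  pullback through \<open>\<phi>\<close>.\<close>

definition global_chart :: "'a atlas \<Rightarrow> (c2 \<Rightarrow> 'a) \<Rightarrow> bool" where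
  "global_chart A \<phi> \<longleftrightarrow> inj \<phi> \<and> (UNIV, \<phi>) \<in> A \<and>
     (\<forall>W \<xi>. (W, \<xi>) \<in> A \<longrightarrow> (\<exists>U \<tau>. transition W \<xi> \<phi> U \<tau>))"

text \<open>Injectivity makes the preimage of finitely many centres finite, so that removing it
  keeps a domain open; open domains turn relatively open preimages into open ones.\<close>

definition regular_atlas :: "'a atlas \<Rightarrow> bool" where
  "regular_atlas A \<longleftrightarrow> (\<forall>W \<xi>. (W, \<xi>) \<in> A \<longrightarrow> open W \<and> inj \<xi>)"

lemma transitionI:
  assumes "open U" "\<And>z. z \<in> U \<Longrightarrow> z \<in> W" "\<And>z. z \<in> U \<Longrightarrow> \<xi> z = \<phi> (\<tau> z)"
    "\<And>z. z \<in> U \<Longrightarrow> holo_map_at \<tau> z" "\<And>z w. z \<in> W \<Longrightarrow> \<xi> z = \<phi> w \<Longrightarrow> z \<in> U"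
  shows "transition W \<xi> \<phi> U \<tau>"
  using assms unfolding transition_def by blast

lemma transitionD:
  assumes "transition W \<xi> \<phi> U \<tau>"
  shows "open U" "\<And>z. z \<in> U \<Longrightarrow> z \<in> W" "\<And>z. z \<in> U \<Longrightarrow> \<xi> z = \<phi> (\<tau> z)"
    "\<And>z. z \<in> U \<Longrightarrow> holo_map_at \<tau> z" "\<And>z w. z \<in> W \<Longrightarrow> \<xi> z = \<phi> w \<Longrightarrow> z \<in> U"
  using assms unfolding transition_def by blast+

lemma openin_atlas_space_iff:
  "openin (tp (atlas_space A)) U \<longleftrightarrow> U \<subseteq> atlas_points A \<and>
     (\<forall>W \<xi>. (W, \<xi>) \<in> A \<longrightarrow> openin (top_of_set W) {z \<in> W. \<xi> z \<in> U})"
  unfolding openin_atlas_space by auto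

lemma openin_atlas_spaceD:
  "openin (tp (atlas_space A)) U \<Longrightarrow> (W, \<xi>) \<in> A \<Longrightarrow> openin (top_of_set W) {z \<in> W. \<xi> z \<in> U}"
  unfolding openin_atlas_space_iff by simp

lemma hol_atlas_space_iff:
  "hol (atlas_space A) U f \<longleftrightarrow>
     (\<forall>W \<xi>. (W, \<xi>) \<in> A \<longrightarrow> holomorphic2_on (f \<circ> \<xi>) {z \<in> W. \<xi> z \<in> U})"
  unfolding atlas_space_def by auto

lemma hol_atlas_spaceD:
  "hol (atlas_space A) U f \<Longrightarrow> (W, \<xi>) \<in> A \<Longrightarrow>
    holomorphic2_on (f \<circ> \<xi>) {z \<in> W. \<xi> z \<in> U}"
  unfolding hol_atlas_space_iff by simp

lemma topspace_atlas_space: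
  "topspace (tp (atlas_space A)) = atlas_points A"
proof -
  have *: "{z \<in> W. \<phi> z \<in> atlas_points A} = W" if "(W, \<phi>) \<in> A" for W \<phi>
    using that unfolding atlas_points_def by blast
  have "openin (tp (atlas_space A)) (atlas_points A)"
    unfolding openin_atlas_space_iff using * by auto
  then show ?thesis
    using openin_atlas_space[of A "topspace (tp (atlas_space A))"] openin_subset by fastforce
qed

text \<open>Testing on the chart \<open>\<phi>\<close> itself gives one direction of both
  equivalences. For the other, along a chart \<open>\<xi>\<close> the image of \<open>V\<close>
  pulls back to the points of \<open>U\<close> that \<open>\<tau>\<close> sends into
  \<open>V\<close>, and there \<open>f \<circ> \<xi>\<close> is
  \<open>(f \<circ> \<phi>) \<circ> \<tau>\<close>; both are settled by holomorphy of
  \<open>\<tau>\<close>.\<close>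

lemma open_embedding_global_chart:
  assumes reg: "regular_atlas A" and \<phi>: "global_chart A \<phi>"
  shows "open_embedding (atlas_space A) \<phi>"
  unfolding open_embedding_def
proof (intro conjI allI impI)
  have inj: "inj \<phi>" and UA: "(UNIV, \<phi>) \<in> A"
    using \<phi> unfolding global_chart_def by blast+
  have pre: "{z \<in> UNIV. \<phi> z \<in> \<phi> ` V} = V" for V
    using inj by (auto dest: injD)
  show "inj \<phi>" by fact
  show sub: "range \<phi> \<subseteq> topspace (tp (atlas_space A))"
    unfolding topspace_atlas_space atlas_points_def using UA by force
  fix V
  have tr: "\<exists>U \<tau>. transition W \<xi> \<phi> U \<tau> \<and> {z \<in> W. \<xi> z \<in> \<phi> ` V} = {z \<in> U. \<tau> z \<in> V}"
    if W: "(W, \<xi>) \<in> A" for W \<xi> V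
  proof -
    obtain U \<tau> where U: "transition W \<xi> \<phi> U \<tau>"
      using W \<phi> unfolding global_chart_def by blast
    have "{z \<in> W. \<xi> z \<in> \<phi> ` V} = {z \<in> U. \<tau> z \<in> V}"
    proof (intro set_eqI iffI)
      fix z assume "z \<in> {z \<in> W. \<xi> z \<in> \<phi> ` V}"
      then obtain w where w: "z \<in> W" "\<xi> z = \<phi> w" "w \<in> V" by blast
      then have "z \<in> U" using transitionD(5)[OF U] by blast
      then show "z \<in> {z \<in> U. \<tau> z \<in> V}"
        using transitionD(3)[OF U] w inj by (metis (no_types, lifting) injD mem_Collect_eq)
    next
      fix z assume "z \<in> {z \<in> U. \<tau> z \<in> V}"
      then show "z \<in> {z \<in> W. \<xi> z \<in> \<phi> ` V}"
        using transitionD(2,3)[OF U] by auto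
    qed
    then show ?thesis using U by blast
  qed
  show "openin (tp (atlas_space A)) (\<phi> ` V) = open V"
  proof
    assume "openin (tp (atlas_space A)) (\<phi> ` V)"
    then have "openin (top_of_set UNIV) {z \<in> UNIV. \<phi> z \<in> \<phi> ` V}"
      using UA by (rule openin_atlas_spaceD)
    then show "open V" unfolding pre by simp
  next
    assume V: "open V"
    have "openin (top_of_set W) {z \<in> W. \<xi> z \<in> \<phi> ` V}" if W: "(W, \<xi>) \<in> A" for W \<xi>
    proof -
      obtain U \<tau> where U: "transition W \<xi> \<phi> U \<tau>"
        and eq: "{z \<in> W. \<xi> z \<in> \<phi> ` V} = {z \<in> U. \<tau> z \<in> V}" using tr[OF W] by blast
      have "open {z \<in> U. \<tau> z \<in> V}"
        using open_holo_preimage[OF transitionD(1,4)[OF U] V] by blast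
      then have "open {z \<in> W. \<xi> z \<in> \<phi> ` V}" unfolding eq .
      then show ?thesis by (intro open_subset) auto
    qed
    moreover have "\<phi> ` V \<subseteq> atlas_points A" using sub unfolding topspace_atlas_space by blast
    ultimately show "openin (tp (atlas_space A)) (\<phi> ` V)"
      unfolding openin_atlas_space_iff by blast
  qed
  fix f assume V: "open V"
  show "hol (atlas_space A) (\<phi> ` V) f = holomorphic2_on (f \<circ> \<phi>) V"
  proof
    assume "hol (atlas_space A) (\<phi> ` V) f"
    then have "holomorphic2_on (f \<circ> \<phi>) {z \<in> UNIV. \<phi> z \<in> \<phi> ` V}"
      using UA by (rule hol_atlas_spaceD)
    then show "holomorphic2_on (f \<circ> \<phi>) V" unfolding pre .
  next
    assume hol: "holomorphic2_on (f \<circ> \<phi>) V"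
    have "holomorphic2_on (f \<circ> \<xi>) {z \<in> W. \<xi> z \<in> \<phi> ` V}" if W: "(W, \<xi>) \<in> A" for W \<xi>
    proof -
      obtain U \<tau> where U: "transition W \<xi> \<phi> U \<tau>"
        and eq: "{z \<in> W. \<xi> z \<in> \<phi> ` V} = {z \<in> U. \<tau> z \<in> V}" using tr[OF W] by blast
      show ?thesis unfolding eq holomorphic2_on_iff
      proof
        fix z assume z: "z \<in> {z \<in> U. \<tau> z \<in> V}"
        have "holo_at (\<lambda>w. (f \<circ> \<phi>) (\<tau> w)) z"
          using hol z transitionD(4)[OF U] unfolding holomorphic2_on_iff
          by (intro holo_at_compose[of "f \<circ> \<phi>" \<tau>]) auto
        then show "holo_at (f \<circ> \<xi>) z"
          by (rule holo_at_cong[OF _ transitionD(1)[OF U]])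
            (use z transitionD(3)[OF U] in auto)
      qed
    qed
    then show "hol (atlas_space A) (\<phi> ` V) f"
      unfolding hol_atlas_space_iff by blast
  qed
qed

section \<open>Global charts of a blow-up\<close>

lemma bl_uv_simp: "bl_uv (\<psi>, (a, b)) (u, v) =
    (if v = 0 then Exc (\<psi> (a, b)) (Some u) else Old (\<psi> (a + u * v, b + v)))"
  by (simp add: bl_uv_def)

lemma bl_st_simp: "bl_st (\<psi>, (a, b)) (s, t) =
    (if s = 0 then Exc (\<psi> (a, b)) (if t = 0 then None else Some (1 / t))
     else Old (\<psi> (a + s, b + s * t)))"
  by (simp add: bl_st_def)

lemma inj_bl_uv: "inj \<psi> \<Longrightarrow> inj (bl_uv (\<psi>, c))"
  by (cases c) (auto intro!: injI simp: bl_uv_simp inj_eq split: if_splits)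

lemma inj_bl_st: "inj \<psi> \<Longrightarrow> inj (bl_st (\<psi>, c))"
  by (cases c) (auto intro!: injI simp: bl_st_simp inj_eq split: if_splits)

lemma open_coord_neq: "open {z :: c2. fst z \<noteq> c}" "open {z :: c2. snd z \<noteq> c}"
  by (intro open_Collect_neq continuous_intros)+

lemma blowup_cases:
  assumes "(W, \<xi>) \<in> blowup A C"
  obtains (old) W' \<xi>' where "(W', \<xi>') \<in> A" "W = {z \<in> W'. \<xi>' z \<notin> cpoint ` C}" "\<xi> = Old \<circ> \<xi>'"
  | (uv) c where "c \<in> C" "W = {z. bl_uv c z \<notin> Old ` cpoint ` C}" "\<xi> = bl_uv c"
  | (st) c where "c \<in> C" "W = {z. bl_st c z \<notin> Old ` cpoint ` C}" "\<xi> = bl_st c"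
  using assms unfolding blowup_def by auto

lemma blowup_memI:
  "(W, \<xi>) \<in> A \<Longrightarrow> ({z \<in> W. \<xi> z \<notin> cpoint ` C}, Old \<circ> \<xi>) \<in> blowup A C"
  "c \<in> C \<Longrightarrow> ({z. bl_uv c z \<notin> Old ` cpoint ` C}, bl_uv c) \<in> blowup A C"
  "c \<in> C \<Longrightarrow> ({z. bl_st c z \<notin> Old ` cpoint ` C}, bl_st c) \<in> blowup A C"
  unfolding blowup_def by (rule UnI1, rule UnI1, rule image_eqI[rotated], assumption, simp)
    (rule UnI1, rule UnI2, rule image_eqI[rotated], assumption, simp,
     rule UnI2, rule image_eqI[rotated], assumption, simp)

lemma open_Compl_finite: "finite (- S) \<Longrightarrow> open (S :: c2 set)"
  by (metis double_complement finite_imp_closed open_Compl)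

lemma regular_blowup:
  assumes reg: "regular_atlas A" and fin: "finite C" and inj: "\<And>c. c \<in> C \<Longrightarrow> inj (fst c)"
  shows "regular_atlas (blowup A C)"
  unfolding regular_atlas_def
proof (intro allI impI)
  fix W \<xi> assume "(W, \<xi>) \<in> blowup A C"
  then show "open W \<and> inj \<xi>"
  proof (cases rule: blowup_cases)
    case (old W' \<xi>')
    then have W': "open W'" "inj \<xi>'" using reg unfolding regular_atlas_def by blast+
    have "finite (\<xi>' -` (cpoint ` C))" using fin W'(2) by (simp add: finite_vimageI)
    then have "open (- (\<xi>' -` (cpoint ` C)))" by (simp add: open_Compl_finite)
    moreover have "W = W' \<inter> (- (\<xi>' -` (cpoint ` C)))" using old(2) by auto
    ultimately show ?thesis using W' old(3) by (auto intro: inj_compose simp: inj_def)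
  next
    case (uv c)
    have i: "inj (bl_uv c)" using inj[OF uv(1)] inj_bl_uv[of "fst c" "snd c"] by simp
    have "finite (bl_uv c -` (Old ` cpoint ` C))" using fin i by (simp add: finite_vimageI)
    then show ?thesis using uv i open_Compl_finite[of W] by (simp add: vimage_def Collect_neg_eq[symmetric] Compl_eq)
  next
    case (st c)
    have i: "inj (bl_st c)" using inj[OF st(1)] inj_bl_st[of "fst c" "snd c"] by simp
    have "finite (bl_st c -` (Old ` cpoint ` C))" using fin i by (simp add: finite_vimageI)
    then show ?thesis using st i open_Compl_finite[of W] by (simp add: vimage_def Compl_eq)
  qed
qed

lemma holo_map_blow_down:
  "holo_map_at (\<lambda>z. (a + fst z * snd z, b + snd z)) z"
  "holo_map_at (\<lambda>z. (a + fst z, b + fst z * snd z)) z"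
  unfolding holo_map_at_def by (auto intro!: holo_intros)

text \<open>Outside the exceptional line both kinds of new coordinates are \<open>\<psi>\<close>
  after a polynomial map, and points on that line are never of the form \<open>Old\<close>. Hence a
  transition from \<open>\<psi>\<close> composes with the polynomial map.\<close>

lemma blow_down_transition:
  assumes U: "transition UNIV \<psi> \<phi> U \<tau>" and \<xi>: "\<xi> = bl_uv (\<psi>, c) \<or> \<xi> = bl_st (\<psi>, c)"
  shows "\<exists>U \<tau>. transition UNIV \<xi> (Old \<circ> \<phi>) U \<tau>"
proof -
  obtain a b where c: "c = (a, b)" by (cases c)
  let ?d = "\<lambda>z. (a + fst z * snd z, b + snd z)"
  let ?e = "\<lambda>z. (a + fst z, b + fst z * snd z)"
  have op1: "open {z \<in> {z. snd z \<noteq> 0}. ?d z \<in> U}"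
    using holo_map_blow_down(1) transitionD(1)[OF U]
    by (intro open_holo_preimage[of "{z. snd z \<noteq> 0}" "?d" U] open_coord_neq)
  have op2: "open {z \<in> {z. fst z \<noteq> 0}. ?e z \<in> U}"
    using holo_map_blow_down(2) transitionD(1)[OF U]
    by (intro open_holo_preimage[of "{z. fst z \<noteq> 0}" "?e" U] open_coord_neq)
  have "transition UNIV (bl_uv (\<psi>, c)) (Old \<circ> \<phi>)
      {z \<in> {z. snd z \<noteq> 0}. ?d z \<in> U} (\<lambda>z. \<tau> (?d z))"
  proof (rule transitionI[OF op1])
    fix z assume z: "z \<in> {z \<in> {z. snd z \<noteq> 0}. ?d z \<in> U}"
    then show "bl_uv (\<psi>, c) z = (Old \<circ> \<phi>) (\<tau> (?d z))"
      using transitionD(3)[OF U, of "?d z"] by (cases z) (simp add: c bl_uv_simp)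
    show "holo_map_at (\<lambda>z. \<tau> (?d z)) z"
      using transitionD(4)[OF U, of "?d z"] z holo_map_blow_down(1)
      by (intro holo_map_at_compose[of \<tau> "?d"]) auto
  next
    fix z w assume "bl_uv (\<psi>, c) z = (Old \<circ> \<phi>) w"
    then show "z \<in> {z \<in> {z. snd z \<noteq> 0}. ?d z \<in> U}"
      using transitionD(5)[OF U, of "?d z" w] by (cases z) (simp add: c bl_uv_simp split: if_splits)
  qed simp
  moreover have "transition UNIV (bl_st (\<psi>, c)) (Old \<circ> \<phi>)
      {z \<in> {z. fst z \<noteq> 0}. ?e z \<in> U} (\<lambda>z. \<tau> (?e z))"
  proof (rule transitionI[OF op2])
    fix z assume z: "z \<in> {z \<in> {z. fst z \<noteq> 0}. ?e z \<in> U}"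
    then show "bl_st (\<psi>, c) z = (Old \<circ> \<phi>) (\<tau> (?e z))"
      using transitionD(3)[OF U, of "?e z"] by (cases z) (simp add: c bl_st_simp)
    show "holo_map_at (\<lambda>z. \<tau> (?e z)) z"
      using transitionD(4)[OF U, of "?e z"] z holo_map_blow_down(2)
      by (intro holo_map_at_compose[of \<tau> "?e"]) auto
  next
    fix z w assume "bl_st (\<psi>, c) z = (Old \<circ> \<phi>) w"
    then show "z \<in> {z \<in> {z. fst z \<noteq> 0}. ?e z \<in> U}"
      using transitionD(5)[OF U, of "?e z" w] by (cases z) (simp add: c bl_st_simp split: if_splits)
  qed simp
  ultimately show ?thesis using \<xi> by blast
qed

lemma transition_restrict:
  assumes "transition W \<xi> \<phi> U \<tau>" "W' \<subseteq> W" "\<And>z w. \<xi> z = \<phi> w \<Longrightarrow> z \<in> W \<Longrightarrow> z \<in> W'"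
  shows "transition W' \<xi> \<phi> U \<tau>"
  using assms unfolding transition_def by blast

text \<open>In the coordinates \<open>(x, y)\<close> of \<open>\<psi>\<close> the map
  \<open>bl_uv\<close> is inverted by \<open>((x - a) / (y - b), y - b)\<close>, which is
  holomorphic for \<open>y \<noteq> b\<close>. The assumption \<open>exc\<close> keeps
  \<open>\<xi>\<close> off the finite directions at the centre, so the overlap is exactly
  \<open>y \<noteq> b\<close>. \<open>W\<close> is the domain before the centres are removed,
  \<open>W'\<close> the one after.\<close>

lemma transition_to_bl_uv:
  assumes U: "transition W \<xi> (Old \<circ> \<psi>) U \<tau>" and inj: "inj \<psi>" and sub: "W' \<subseteq> W"
    and W': "\<And>z w. z \<in> W \<Longrightarrow> \<xi> z = bl_uv (\<psi>, (a, b)) w \<Longrightarrow> z \<in> W'"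
    and exc: "\<And>z u. z \<in> W' \<Longrightarrow> \<xi> z \<noteq> Exc (\<psi> (a, b)) (Some u)"
  shows "\<exists>U \<tau>. transition W' \<xi> (bl_uv (\<psi>, (a, b))) U \<tau>"
proof -
  note T = transitionD[OF U]
  let ?U = "{z \<in> U. \<tau> z \<in> {w. snd w \<noteq> b}}"
  let ?\<tau> = "\<lambda>z. ((fst (\<tau> z) - a) / (snd (\<tau> z) - b), snd (\<tau> z) - b)"
  have op: "open ?U"
    by (intro open_holo_preimage[OF T(1,4)] open_coord_neq)
  have "transition W' \<xi> (bl_uv (\<psi>, (a, b))) ?U ?\<tau>"
  proof (rule transitionI[OF op])
    fix z assume z: "z \<in> ?U"
    show eq: "\<xi> z = bl_uv (\<psi>, (a, b)) (?\<tau> z)"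
      using T(3)[of z] z by (simp add: bl_uv_simp)
    show "z \<in> W'" using W'[OF _ eq] T(2) z by blast
    have "holo_map_at (\<lambda>w. ((fst w - a) / (snd w - b), snd w - b)) (\<tau> z)"
      using z by (auto simp: holo_map_at_def intro!: holo_intros)
    then show "holo_map_at ?\<tau> z" using z T(4)[of z] holo_map_at_compose by fastforce
  next
    fix z w assume z: "z \<in> W'" "\<xi> z = bl_uv (\<psi>, (a, b)) w"
    obtain u v where w: "w = (u, v)" by (cases w)
    have v: "v \<noteq> 0" and \<xi>: "\<xi> z = Old (\<psi> (a + u * v, b + v))"
      using z exc[OF z(1), of u] by (auto simp: w bl_uv_simp split: if_splits)
    have zU: "z \<in> U" using T(5)[of z] \<xi> z sub by auto
    with T(3)[of z] \<xi> inj have "\<tau> z = (a + u * v, b + v)" by (auto dest: injD)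
    then show "z \<in> ?U" using v zU by simp
  qed
  then show ?thesis by blast
qed

text \<open>A chart that misses the centres does not notice the blow-up: old charts keep their
  transitions into it, and the new ones reach it through the blow-down map.\<close>

lemma global_chart_blowup_old:
  assumes \<phi>: "global_chart A \<phi>" and C: "\<And>c. c \<in> C \<Longrightarrow> (UNIV, fst c) \<in> A"
    and disj: "range \<phi> \<inter> cpoint ` C = {}"
  shows "global_chart (blowup A C) (Old \<circ> \<phi>)"
  unfolding global_chart_def
proof (intro conjI allI impI)
  have old: "\<phi> w \<notin> cpoint ` C" for w using disj by auto
  show "inj (Old \<circ> \<phi>)" using \<phi> unfolding global_chart_def by (auto simp: inj_def)
  have "(UNIV, \<phi>) \<in> A" "{z \<in> UNIV. \<phi> z \<notin> cpoint ` C} = UNIV"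
    using \<phi> old unfolding global_chart_def by auto
  then show "(UNIV, Old \<circ> \<phi>) \<in> blowup A C" using blowup_memI(1)[of UNIV \<phi> A C] by simp
  fix W \<xi> assume "(W, \<xi>) \<in> blowup A C"
  then show "\<exists>U \<tau>. transition W \<xi> (Old \<circ> \<phi>) U \<tau>"
  proof (cases rule: blowup_cases)
    case (old W' \<xi>')
    obtain U \<tau> where U: "transition W' \<xi>' \<phi> U \<tau>"
      using \<phi> old(1) unfolding global_chart_def by blast
    have "transition W \<xi> (Old \<circ> \<phi>) U \<tau>"
      by (rule transitionI) (use transitionD[OF U] old \<open>\<And>w. \<phi> w \<notin> cpoint ` C\<close> in auto)
    then show ?thesis by blast
  next
    case (uv c)
    obtain U \<tau> where U: "transition UNIV (fst c) \<phi> U \<tau>"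
      using \<phi> C[OF uv(1)] unfolding global_chart_def by blast
    obtain U \<tau> where "transition UNIV \<xi> (Old \<circ> \<phi>) U \<tau>"
      using blow_down_transition[OF U, of \<xi> "snd c"] uv by auto
    then have "transition W \<xi> (Old \<circ> \<phi>) U \<tau>"
      by (rule transition_restrict) (use uv old in auto)
    then show ?thesis by blast
  next
    case (st c)
    obtain U \<tau> where U: "transition UNIV (fst c) \<phi> U \<tau>"
      using \<phi> C[OF st(1)] unfolding global_chart_def by blast
    obtain U \<tau> where "transition UNIV \<xi> (Old \<circ> \<phi>) U \<tau>"
      using blow_down_transition[OF U, of \<xi> "snd c"] st by auto
    then have "transition W \<xi> (Old \<circ> \<phi>) U \<tau>"
      by (rule transition_restrict) (use st old in auto)
    then show ?thesis by blast
  qed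
qed

text \<open>Old charts and charts at other centres meet this one off its exceptional line, where the
  problem reduces to a transition into \<open>fst c\<close>. The complementary chart at the same
  centre is handled by \<open>u = 1 / t\<close>, \<open>v = s t\<close>. Distinct centre points keep
  the exceptional lines apart, and \<open>centres\<close> makes the domain the whole plane.\<close>

lemma global_chart_bl_uv:
  assumes c: "c \<in> C" and \<psi>: "global_chart A (fst c)"
    and C: "\<And>c. c \<in> C \<Longrightarrow> (UNIV, fst c) \<in> A" and inj: "inj_on cpoint C"
    and centres: "range (bl_uv c) \<inter> Old ` cpoint ` C = {}"
  shows "global_chart (blowup A C) (bl_uv c)"
  unfolding global_chart_def
proof (intro conjI allI impI)
  obtain \<psi> a b where c_eq: "c = (\<psi>, (a, b))" by (cases c) auto
  have inj_\<psi>: "inj \<psi>" using \<psi> c_eq unfolding global_chart_def by simp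
  have notc: "bl_uv c z \<notin> Old ` cpoint ` C" for z using centres by blast
  show "inj (bl_uv c)" using inj_bl_uv[OF inj_\<psi>] c_eq by simp
  have "{z. bl_uv c z \<notin> Old ` cpoint ` C} = UNIV" using notc by blast
  then show "(UNIV, bl_uv c) \<in> blowup A C" using blowup_memI(2)[OF c, of A] by simp
  fix W \<xi> assume "(W, \<xi>) \<in> blowup A C"
  then show "\<exists>U \<tau>. transition W \<xi> (bl_uv c) U \<tau>"
  proof (cases rule: blowup_cases)
    case (old W' \<xi>')
    obtain U \<tau> where U: "transition W' \<xi>' \<psi> U \<tau>"
      using \<psi> old(1) unfolding global_chart_def c_eq fst_conv by blast
    have U': "transition W' \<xi> (Old \<circ> \<psi>) U \<tau>"
    proof (rule transitionI)
      show "\<xi> z = (Old \<circ> \<psi>) (\<tau> z)" if "z \<in> U" for z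
        using transitionD(3)[OF U that] old(3) by simp
      show "z \<in> U" if "z \<in> W'" "\<xi> z = (Old \<circ> \<psi>) w" for z w
        using transitionD(5)[OF U that(1), of w] that(2) old(3) by simp
    qed (use transitionD(1,2,4)[OF U] in blast)+
    have "\<xi>' z \<notin> cpoint ` C" if "\<xi> z = bl_uv c w" for z w
      using notc[of w] that[symmetric] old(3) by auto
    then show ?thesis unfolding c_eq
      by (intro transition_to_bl_uv[OF U' inj_\<psi>]) (use old(2,3) c_eq in auto)
  next
    case (uv c')
    obtain U \<tau> where U: "transition UNIV (fst c') \<psi> U \<tau>"
      using \<psi> C[OF uv(1)] unfolding global_chart_def c_eq fst_conv by blast
    obtain \<psi>' a' b' where c': "c' = (\<psi>', (a', b'))" by (cases c') auto
    show ?thesis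
    proof (cases "c' = c")
      case True
      have "transition W \<xi> (bl_uv c) UNIV (\<lambda>z. z)"
        by (rule transitionI) (use uv True notc in \<open>auto simp: holo_map_at_id\<close>)
      then show ?thesis by blast
    next
      case False
      then have "cpoint c' \<noteq> cpoint c" using inj uv(1) c by (meson inj_onD)
      then have exc: "\<xi> z \<noteq> Exc (\<psi> (a, b)) (Some u)" for z u
        by (cases z) (simp add: uv c' c_eq cpoint_def bl_uv_simp)
      obtain U \<tau> where "transition UNIV \<xi> (Old \<circ> \<psi>) U \<tau>"
        using blow_down_transition[OF U, of \<xi> "snd c'"] uv by auto
      then show ?thesis unfolding c_eq
        by (rule transition_to_bl_uv[OF _ inj_\<psi>]) (use notc uv c_eq exc in auto)
    qed
  next
    case (st c')
    obtain U \<tau> where U: "transition UNIV (fst c') \<psi> U \<tau>"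
      using \<psi> C[OF st(1)] unfolding global_chart_def c_eq fst_conv by blast
    obtain \<psi>' a' b' where c': "c' = (\<psi>', (a', b'))" by (cases c') auto
    show ?thesis
    proof (cases "c' = c")
      case True
      have eq: "bl_st c z = bl_uv c (1 / snd z, fst z * snd z)" if "snd z \<noteq> 0" for z
        using that by (cases z) (simp add: c_eq bl_st_simp bl_uv_simp)
      \<comment> \<open>On \<open>t = 0\<close> lie only the direction \<open>None\<close> and
        points with \<open>y = b\<close>, \<open>x \<noteq> a\<close>; the chart
        \<open>(u, v)\<close> reaches neither.\<close>
      have ne: "bl_st c z \<noteq> bl_uv c w" if "snd z = 0" for z w
        using that inj_\<psi> by (cases z; cases w) (auto simp: c_eq bl_st_simp bl_uv_simp inj_eq)
      have "transition W \<xi> (bl_uv c) {z. snd z \<noteq> 0} (\<lambda>z. (1 / snd z, fst z * snd z))"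
        by (rule transitionI)
          (use st True notc eq ne in \<open>auto intro!: open_coord_neq
             holo_intros simp: holo_map_at_def\<close>)
      then show ?thesis by blast
    next
      case False
      then have "cpoint c' \<noteq> cpoint c" using inj st(1) c by (meson inj_onD)
      then have exc: "\<xi> z \<noteq> Exc (\<psi> (a, b)) (Some u)" for z u
        by (cases z) (simp add: st c' c_eq cpoint_def bl_st_simp)
      obtain U \<tau> where "transition UNIV \<xi> (Old \<circ> \<psi>) U \<tau>"
        using blow_down_transition[OF U, of \<xi> "snd c'"] st by auto
      then show ?thesis unfolding c_eq
        by (rule transition_to_bl_uv[OF _ inj_\<psi>]) (use notc st c_eq exc in auto)
    qed
  qed
qed

section \<open>The charts of the blown-up surface\<close>

lemma ident_refl: "(a, a) \<in> ident R"
  unfolding ident_def by blast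

lemma ident_sym: "(a, b) \<in> ident R \<Longrightarrow> (b, a) \<in> ident R"
proof -
  have "sym (ident R)" unfolding ident_def by (intro sym_rtrancl) (auto simp: sym_def)
  then show "(a, b) \<in> ident R \<Longrightarrow> (b, a) \<in> ident R" by (rule symD)
qed

lemma ident_trans: "(a, b) \<in> ident R \<Longrightarrow> (b, c) \<in> ident R \<Longrightarrow> (a, c) \<in> ident R"
  unfolding ident_def by (rule rtrancl_trans)

lemma ident_base: "(a, b) \<in> R \<Longrightarrow> (a, b) \<in> ident R"
  unfolding ident_def by blast

lemma ident_induct:
  assumes "(a, b) \<in> ident R" "P a"
    and "\<And>x y. (x, y) \<in> R \<Longrightarrow> P x \<Longrightarrow> P y" "\<And>x y. (x, y) \<in> R \<Longrightarrow> P y \<Longrightarrow> P x"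
  shows "P b"
  using assms(1) unfolding ident_def
  by (induction rule: rtrancl_induct) (use assms(2-) in blast)+

lemma glue_pt_eq_iff: "glue_pt R i z = glue_pt R j w \<longleftrightarrow> ((i, z), (j, w)) \<in> ident R"
  unfolding glue_pt_def by (auto intro: ident_refl dest: ident_sym ident_trans)

text \<open>An invariant of the generators that is also a representative of each class decides the
  generated equivalence, so coincidence of glued points becomes an equation.\<close>

lemma ident_iff_normal_form:
  assumes "\<And>a b. (a, b) \<in> R \<Longrightarrow> N a = N b" "\<And>a. (a, N a) \<in> ident R"
  shows "(a, b) \<in> ident R \<longleftrightarrow> N a = N b"
proof
  assume "(a, b) \<in> ident R"
  then show "N a = N b"
    by (rule ident_induct[where P = "\<lambda>x. N a = N x"]) (auto dest: assms(1))
next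
  assume "N a = N b"
  then show "(a, b) \<in> ident R" by (metis assms(2) ident_sym ident_trans)
qed

text \<open>The representative in the plane that comes first in the order 0, 1, 2, 3.\<close>

fun normal_form :: "(nat \<Rightarrow> complex) \<Rightarrow> nat \<times> c2 \<Rightarrow> nat \<times> c2" where
  "normal_form \<alpha> (i, (z, w)) =
    (if i = 1 then (if z \<noteq> 0 then (0, (1 / z, - (z * w + \<alpha> 0) * z)) else (1, (z, w)))
     else if i = 2 then (if w \<noteq> 0 then (0, (z, 1 / w)) else (2, (z, w)))
     else if i = 3 then
       (if w \<noteq> 0 then (if z \<noteq> 0 then (0, (1 / z, - (z / w + \<alpha> 0) * z)) else (1, (0, 1 / w)))
        else if z \<noteq> 0 then (2, (1 / z, 0)) else (3, (0, 0)))
     else (i, (z, w)))"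

lemma Sigma2_relI:
  "z \<noteq> 0 \<Longrightarrow> ((0, (z, w)), (1, (1 / z, - (z * w + \<alpha> 0) * z))) \<in> Sigma2_rel \<alpha>"
  "w \<noteq> 0 \<Longrightarrow> ((0, (z, w)), (2, (z, 1 / w))) \<in> Sigma2_rel \<alpha>"
  "w \<noteq> 0 \<Longrightarrow> ((1, (z, w)), (3, (z, 1 / w))) \<in> Sigma2_rel \<alpha>"
  "z \<noteq> 0 \<Longrightarrow> z + \<alpha> 0 * w \<noteq> 0 \<Longrightarrow>
    ((2, (z, w)), (3, (1 / z, - w / (z * (z + \<alpha> 0 * w))))) \<in> Sigma2_rel \<alpha>"
  unfolding Sigma2_rel_def by auto

lemma normal_form_Sigma2_rel: "(a, b) \<in> Sigma2_rel \<alpha> \<Longrightarrow> normal_form \<alpha> a = normal_form \<alpha> b"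
proof -
  have "z * z + z * (w * a) = 0 \<longleftrightarrow> z = 0 \<or> z + w * a = 0" for z w a :: complex
    by (simp flip: distrib_left)
  then show "(a, b) \<in> Sigma2_rel \<alpha> \<Longrightarrow> normal_form \<alpha> a = normal_form \<alpha> b"
    unfolding Sigma2_rel_def by (elim UnE) (auto simp: field_simps)
qed

text \<open>The coordinate change between planes 0 and 1 is an involution, so its inverse has the
  same formula.\<close>

lemma ident_chart1: 
  "z \<noteq> 0 \<Longrightarrow> ((1, (z, w)), (0, (1 / z, - (z * w + \<alpha> 0) * z))) \<in> ident (Sigma2_rel \<alpha>)"
proof -
  assume z: "z \<noteq> 0"
  have "- ((1 / z) * (- (z * w + \<alpha> 0) * z) + \<alpha> 0) * (1 / z) = w"
    using z by (simp add: field_simps)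
  then show ?thesis
    using ident_sym[OF ident_base, OF Sigma2_relI(1)[of "1 / z" "- (z * w + \<alpha> 0) * z" \<alpha>]] z
    by simp
qed

lemma ident_normal_form: "(a, normal_form \<alpha> a) \<in> ident (Sigma2_rel \<alpha>)"
proof -
  obtain i z w where a: "a = (i, (z, w))" by (cases a) auto
  have two: "((2, (z, w)), (0, (z, 1 / w))) \<in> ident (Sigma2_rel \<alpha>)" if "w \<noteq> 0"
    using ident_sym[OF ident_base, OF Sigma2_relI(2)[of "1 / w" z \<alpha>]] that by simp
  have three: "((3, (z, w)), (1, (z, 1 / w))) \<in> ident (Sigma2_rel \<alpha>)" if "w \<noteq> 0"
    using ident_sym[OF ident_base, OF Sigma2_relI(3)[of "1 / w" z \<alpha>]] that by simp
  have three_zero: "((3, (z, 0)), (2, (1 / z, 0))) \<in> ident (Sigma2_rel \<alpha>)" if "z \<noteq> 0"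
    using ident_sym[OF ident_base, OF Sigma2_relI(4)[of "1 / z" \<alpha> 0]] that by simp
  have three_one: "((3, (z, w)), (0, (1 / z, - (z / w + \<alpha> 0) * z))) \<in> ident (Sigma2_rel \<alpha>)"
    if "z \<noteq> 0" "w \<noteq> 0"
    using ident_trans[OF three[OF that(2)] ident_chart1[OF that(1)]] by simp
  show ?thesis unfolding a
    using two three three_zero three_one ident_chart1[of z w \<alpha>] by (auto intro: ident_refl)
qed

section \<open>The charts of \<open>Sigma2\<close> and their coordinate changes\<close>

lemma zw_eq_iff: "zw \<alpha> i z = zw \<alpha> j w \<longleftrightarrow> normal_form \<alpha> (i, z) = normal_form \<alpha> (j, w)"
  unfolding zw_def glue_pt_eq_iff
  by (rule ident_iff_normal_form[OF normal_form_Sigma2_rel ident_normal_form])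

lemma inj_zw: "inj (zw \<alpha> i)"
  unfolding inj_def zw_eq_iff by (auto simp: algebra_simps split: if_splits)

lemma Sigma2_eq: "Sigma2 \<alpha> = (\<lambda>i. (UNIV, zw \<alpha> i)) ` {..3}"
proof -
  have "{0, 1, 2, 3 :: nat} = {..3}" by auto
  then show ?thesis by (simp add: Sigma2_def glue_def zw_def)
qed

lemma Sigma2_mem_iff: "(W, \<xi>) \<in> Sigma2 \<alpha> \<longleftrightarrow> W = UNIV \<and> (\<exists>i\<le>3. \<xi> = zw \<alpha> i)"
  unfolding Sigma2_eq by auto

lemma zw_transition:
  assumes "open {z. P (fst z) (snd z)}"
    and "\<And>z w. P z w \<Longrightarrow> normal_form \<alpha> (i, (z, w)) = normal_form \<alpha> (j, (F z w, G z w))"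
    and "\<And>z w z' w'. \<not> P z w \<Longrightarrow> normal_form \<alpha> (i, (z, w)) \<noteq> normal_form \<alpha> (j, (z', w'))"
    and "\<And>z. P (fst z) (snd z) \<Longrightarrow> holo_at (\<lambda>z. F (fst z) (snd z)) z"
    and "\<And>z. P (fst z) (snd z) \<Longrightarrow> holo_at (\<lambda>z. G (fst z) (snd z)) z"
  shows "\<exists>U \<tau>. transition UNIV (zw \<alpha> i) (zw \<alpha> j) U \<tau>"
proof -
  have "transition UNIV (zw \<alpha> i) (zw \<alpha> j) {z. P (fst z) (snd z)}
     (\<lambda>z. (F (fst z) (snd z), G (fst z) (snd z)))"
  proof (rule transitionI)
    fix z assume "z \<in> {z. P (fst z) (snd z)}"
    then show "zw \<alpha> i z = zw \<alpha> j (F (fst z) (snd z), G (fst z) (snd z))"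
      using assms(2)[of "fst z" "snd z"] by (simp add: zw_eq_iff)
    show "holo_map_at (\<lambda>z. (F (fst z) (snd z), G (fst z) (snd z))) z"
      using assms(4,5) \<open>z \<in> _\<close> by (simp add: holo_map_at_def)
  next
    fix z w assume "zw \<alpha> i z = zw \<alpha> j w"
    then show "z \<in> {z. P (fst z) (snd z)}"
      using assms(3)[of "fst z" "snd z" "fst w" "snd w"] by (auto simp: zw_eq_iff)
  qed (use assms(1) in auto)
  then show ?thesis by blast
qed

lemma zw_transition_exists:
  assumes "i \<le> 3" "j \<le> 3"
  shows "\<exists>U \<tau>. transition UNIV (zw \<alpha> i) (zw \<alpha> j) U \<tau>"
proof -
  have refl: "\<exists>U \<tau>. transition UNIV (zw \<alpha> i) (zw \<alpha> i) U \<tau>"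
    by (rule zw_transition[where P = "\<lambda>_ _. True" and F = "\<lambda>z w. z" and G = "\<lambda>z w. w"])
      (auto intro!: holo_intros)
  have op: "open {z :: c2. fst z \<noteq> 0}" "open {z :: c2. snd z \<noteq> 0}"
    "open {z :: c2. fst z \<noteq> 0 \<and> snd z \<noteq> 0}"
    "open {z. fst z \<noteq> 0 \<and> \<alpha> 0 + fst z * snd z \<noteq> 0}"
    "open {z. fst z \<noteq> 0 \<and> fst z + snd z * \<alpha> 0 \<noteq> 0}"
    by (intro open_Collect_conj open_Collect_neq continuous_intros)+
  have base: "\<exists>U \<tau>. transition UNIV (zw \<alpha> i) (zw \<alpha> j) U \<tau>"
    if "(i, j) = (0, 1) \<or> (i, j) = (1, 0)" for i j
    by (rule zw_transition[where P = "\<lambda>z _. z \<noteq> 0" and F = "\<lambda>z w. 1 / z"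
          and G = "\<lambda>z w. - (z * w + \<alpha> 0) * z"])
      (use that in \<open>auto intro!: holo_intros op simp: field_simps split: if_splits\<close>)
  have fibre: "\<exists>U \<tau>. transition UNIV (zw \<alpha> i) (zw \<alpha> j) U \<tau>"
    if "(i, j) = (0, 2) \<or> (i, j) = (2, 0) \<or> (i, j) = (1, 3) \<or> (i, j) = (3, 1)" for i j
    by (rule zw_transition[where P = "\<lambda>_ w. w \<noteq> 0" and F = "\<lambda>z w. z" and G = "\<lambda>z w. 1 / w"])
      (use that in \<open>auto intro!: holo_intros op simp: field_simps split: if_splits\<close>)
  \<comment> \<open>The fibre coordinate of plane 3 is the inverse of
    \<open>- (z * w + \<alpha> 0) * z\<close>, so this product must not vanish; by the involution
    between planes 0 and 1 the same formula leads from plane 1 to plane 2.\<close>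
  have down: "\<exists>U \<tau>. transition UNIV (zw \<alpha> i) (zw \<alpha> j) U \<tau>"
    if "(i, j) = (0, 3) \<or> (i, j) = (1, 2)" for i j
  proof -
    have nz: "- (z * a) = z * (z * w) \<longleftrightarrow> z = 0 \<or> a + z * w = 0" for z w a :: complex
    proof -
      have "- (z * a) = z * (z * w) \<longleftrightarrow> z * (a + z * w) = 0"
        by (auto simp: algebra_simps add_eq_0_iff)
      then show ?thesis by simp
    qed
    \<comment> \<open>\<open>d1\<close> and \<open>d2\<close> concern a coincidence of points
      outside the overlap, with denominators cleared: one side of the equation is a combination of
      vanishing expressions, and what remains is contradictory.\<close>
    have d1: "z' = 0"
      if "w * w' + z' * (w' * a) = - (z' * z')" "z * z' = 1" "a + z * w = 0"
      for z w z' w' a :: complex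
    proof -
      have "w * w' + z' * (w' * a) = (1 - z * z') * (w * w') + (a + z * w) * (z' * w')"
        by (simp add: algebra_simps)
      then show ?thesis using that by simp
    qed
    have d2: False if "- (z * (w' * a)) = 1 + z * (z * (w * w'))" "a + z * w = 0"
      for z w w' a :: complex
    proof -
      have "1 = - (z * w') * (a + z * w)" using that(1) by (simp add: algebra_simps)
      then show ?thesis using that(2) by simp
    qed
    show ?thesis
      by (intro zw_transition[where P = "\<lambda>z w. z \<noteq> 0 \<and> \<alpha> 0 + z * w \<noteq> 0" and F = "\<lambda>z w. 1 / z"
            and G = "\<lambda>z w. 1 / (- (z * w + \<alpha> 0) * z)"])
        (use that in \<open>auto intro!: holo_intros op simp: field_simps nz dest: d1 d2 split: if_splits\<close>)
  qed
  have up: "\<exists>U \<tau>. transition UNIV (zw \<alpha> i) (zw \<alpha> j) U \<tau>"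
    if "(i, j) = (3, 0) \<or> (i, j) = (2, 1)" for i j
    by (rule zw_transition[where P = "\<lambda>z w. z \<noteq> 0 \<and> w \<noteq> 0" and F = "\<lambda>z w. 1 / z"
          and G = "\<lambda>z w. - (z / w + \<alpha> 0) * z"])
      (use that in \<open>auto intro!: holo_intros op simp: field_simps split: if_splits\<close>)
  \<comment> \<open>A point of plane 2 with \<open>z \<noteq> 0\<close> and
    \<open>z + w * \<alpha> 0 = 0\<close> has fibre coordinate 0 in plane 1, hence no counterpart in
    plane 3.\<close>
  have infinity: "\<exists>U \<tau>. transition UNIV (zw \<alpha> i) (zw \<alpha> j) U \<tau>"
    if "(i, j) = (2, 3) \<or> (i, j) = (3, 2)" for i j
  proof -
    have nz: "z * z + z * (w * a) = 0 \<longleftrightarrow> z = 0 \<or> z + w * a = 0" for z w a :: complex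
      by (simp flip: distrib_left)
    have d1: "w = 0 \<or> z' = 0"
      if "w' + w * (z' * (w' * a)) = - (w * (z' * z'))" "z * z' = 1" "z + w * a = 0"
      for z w z' w' a :: complex
    proof -
      have "w' + w * (z' * (w' * a)) = (1 - z * z') * w' + (z + w * a) * (z' * w')"
        by (simp add: algebra_simps)
      then show ?thesis using that by simp
    qed
    have d2: "w = 0" if "- (z * (z * w')) = w + z * (w * (w' * a))" "z + w * a = 0"
      for z w w' a :: complex
    proof -
      have "w = - (z * w') * (z + w * a)" using that(1) by (simp add: algebra_simps)
      then show ?thesis using that(2) by simp
    qed
    show ?thesis
      by (intro zw_transition[where P = "\<lambda>z w. z \<noteq> 0 \<and> z + w * \<alpha> 0 \<noteq> 0" and F = "\<lambda>z w. 1 / z"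
            and G = "\<lambda>z w. - w / (z * (z + w * \<alpha> 0))"])
        (use that in \<open>auto intro!: holo_intros op simp: field_simps nz dest: d1 d2 split: if_splits\<close>)
  qed
  have "i \<in> {0, 1, 2, 3}" "j \<in> {0, 1, 2, 3}" using assms by auto
  then show ?thesis
    using refl base[of i j] fibre[of i j] down[of i j] up[of i j] infinity[of i j] by auto
qed

lemma global_chart_zw: "i \<le> 3 \<Longrightarrow> global_chart (Sigma2 \<alpha>) (zw \<alpha> i)"
  unfolding global_chart_def Sigma2_mem_iff using inj_zw zw_transition_exists by blast

lemma regular_Sigma2: "regular_atlas (Sigma2 \<alpha>)"
  unfolding regular_atlas_def Sigma2_mem_iff using inj_zw by auto

section \<open>The first blow-up, at three points of \<open>D_zero\<close>\<close>

lemma fst_a_center: "(UNIV, fst (a_center \<alpha> \<nu>)) \<in> Sigma2 \<alpha>" "inj (fst (a_center \<alpha> \<nu>))"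
    "global_chart (Sigma2 \<alpha>) (fst (a_center \<alpha> \<nu>))"
proof -
  have "fst (a_center \<alpha> \<nu>) = zw \<alpha> (if \<nu> = Pinf then 3 else 2)" by (cases \<nu>) simp_all
  moreover have "(if \<nu> = Pinf then 3 else 2) \<le> (3 :: nat)" by simp
  ultimately show "(UNIV, fst (a_center \<alpha> \<nu>)) \<in> Sigma2 \<alpha>" "inj (fst (a_center \<alpha> \<nu>))"
    "global_chart (Sigma2 \<alpha>) (fst (a_center \<alpha> \<nu>))"
    using inj_zw global_chart_zw unfolding Sigma2_mem_iff by metis+
qed

lemma cpoint_a_center_eq_iff: "cpoint (a_center \<alpha> \<nu>) = cpoint (a_center \<alpha> \<mu>) \<longleftrightarrow> \<nu> = \<mu>"
  by (cases \<nu>; cases \<mu>) (auto simp: cpoint_def zw_eq_iff)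

lemma UNIV_place: "UNIV = {P0, P1, Pinf}"
  using place.exhaust by blast

lemma range_place: "range f = {f P0, f P1, f Pinf}"
  by (simp add: UNIV_place)

lemma zw_affine_notin_centers: "i \<le> 1 \<Longrightarrow> zw \<alpha> i z \<noteq> cpoint (a_center \<alpha> \<nu>)"
  by (cases \<nu>; cases z) (auto simp: cpoint_def zw_eq_iff le_Suc_eq)

lemma zw_finite:
  assumes "w \<noteq> 0"
  shows "zw \<alpha> 2 (z, w) = zw \<alpha> 0 (z, 1 / w)" "zw \<alpha> 3 (z, w) = zw \<alpha> 1 (z, 1 / w)"
  using assms by (auto simp: zw_eq_iff)

lemma finite_range_a_center: "finite (range (a_center \<alpha>))"
  by (simp add: range_place)

lemma regular_Bl1: "regular_atlas (Bl1 \<alpha>)"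
  unfolding Bl1_def
  by (rule regular_blowup[OF regular_Sigma2 finite_range_a_center]) (auto simp: fst_a_center)

lemma global_chart_Bl1_old: "i \<le> 1 \<Longrightarrow> global_chart (Bl1 \<alpha>) (Old \<circ> zw \<alpha> i)"
  unfolding Bl1_def
proof (rule global_chart_blowup_old)
  assume "i \<le> 1"
  then show "global_chart (Sigma2 \<alpha>) (zw \<alpha> i)" by (simp add: global_chart_zw)
  show "range (zw \<alpha> i) \<inter> cpoint ` range (a_center \<alpha>) = {}"
    using zw_affine_notin_centers[OF \<open>i \<le> 1\<close>] by blast
next
  show "(UNIV, fst c) \<in> Sigma2 \<alpha>" if "c \<in> range (a_center \<alpha>)" for c
    using that fst_a_center(1) by blast
qed

text \<open>Off the exceptional line \<open>v\<close> is the nonzero fibre coordinate of plane 2 or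
  3, and its inverse is the one of plane 0 or 1. The centres have fibre coordinate 0, so no chart
  \<open>(u, v)\<close> runs into another centre.\<close>

lemma bl_uv_a_center_old:
  assumes "v \<noteq> 0"
  shows "\<exists>i\<le>1. \<exists>z. bl_uv (a_center \<alpha> \<nu>) (u, v) = Old (zw \<alpha> i z)"
  using assms by (cases \<nu>) (auto simp: bl_uv_simp zw_finite intro: exI[of _ "0::nat"])

lemma bl_uv_a_center_exc: "bl_uv (a_center \<alpha> \<nu>) (u, 0) = Exc (cpoint (a_center \<alpha> \<nu>)) (Some u)"
  by (cases "a_center \<alpha> \<nu>") (auto simp: bl_uv_def cpoint_def)

lemma global_chart_Bl1_uv: "global_chart (Bl1 \<alpha>) (bl_uv (a_center \<alpha> \<nu>))"
  unfolding Bl1_def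
proof (rule global_chart_bl_uv)
  show "inj_on cpoint (range (a_center \<alpha>))"
    by (auto simp: inj_on_def cpoint_a_center_eq_iff)
  have "bl_uv (a_center \<alpha> \<nu>) (u, v) \<noteq> Old (cpoint (a_center \<alpha> \<mu>))" for u v \<mu>
  proof (cases "v = 0")
    case False
    then obtain i z where "i \<le> 1" "bl_uv (a_center \<alpha> \<nu>) (u, v) = Old (zw \<alpha> i z)"
      using bl_uv_a_center_old by blast
    then show ?thesis using zw_affine_notin_centers[of i \<alpha> z \<mu>] by simp
  qed (simp add: bl_uv_a_center_exc)
  then show "range (bl_uv (a_center \<alpha> \<nu>)) \<inter> Old ` cpoint ` range (a_center \<alpha>) = {}" by auto
qed (auto simp: fst_a_center)

section \<open>The second blow-up, with its seven centres numbered like the maps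
  \<open>r_j\<close>\<close>

definition place_of :: "nat \<Rightarrow> place" where
  "place_of j = (if j \<le> 3 then P0 else if j \<le> 6 then P1 else Pinf)"

definition root_of :: "(nat \<Rightarrow> complex) \<Rightarrow> nat \<Rightarrow> complex" where
  "root_of \<alpha> j = (if j = 1 then \<alpha> 1 else if j = 2 then \<alpha> 1 + \<alpha> 2 else if j = 3 then \<alpha> 1 + \<alpha> 2 + \<alpha> 3
     else if j = 4 then \<alpha> 4 else if j = 5 then \<alpha> 4 + \<alpha> 5 else if j = 6 then \<alpha> 4 + \<alpha> 5 + \<alpha> 6
     else \<alpha> 7)"

definition second_center :: "(nat \<Rightarrow> complex) \<Rightarrow> nat \<Rightarrow> (nat \<times> c2) set blpt center" where
  "second_center \<alpha> j = (bl_uv (a_center \<alpha> (place_of j)), (root_of \<alpha> j, 0))"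

lemma second_centers_eq: "second_centers \<alpha> = second_center \<alpha> ` {1..7}"
proof -
  have "{1..7 :: nat} = {1, 2, 3, 4, 5, 6, 7}" by auto
  moreover have "second_centers \<alpha> =
      (\<Union>\<nu>. (\<lambda>u. (bl_uv (a_center \<alpha> \<nu>), (u, 0))) ` second_coords \<alpha> \<nu>)"
    unfolding second_centers_def by blast
  ultimately show ?thesis by (simp add: UNIV_place second_center_def place_of_def root_of_def) blast
qed

lemma cpoint_second_center: "cpoint (second_center \<alpha> j) = Exc (cpoint (a_center \<alpha> (place_of j))) (Some (root_of \<alpha> j))"
  by (simp add: second_center_def cpoint_def bl_uv_a_center_exc)

lemma regular_Bl2: "regular_atlas (Bl2 \<alpha>)"
  unfolding Bl2_def
  by (rule regular_blowup[OF regular_Bl1])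
    (use global_chart_Bl1_uv in \<open>auto simp: second_centers_eq second_center_def global_chart_def\<close>)

lemma global_chart_Bl2_old: "i \<le> 1 \<Longrightarrow> global_chart (Bl2 \<alpha>) (Old \<circ> (Old \<circ> zw \<alpha> i))"
  unfolding Bl2_def
proof (rule global_chart_blowup_old)
  assume "i \<le> 1"
  then show "global_chart (Bl1 \<alpha>) (Old \<circ> zw \<alpha> i)" by (rule global_chart_Bl1_old)
  show "range (Old \<circ> zw \<alpha> i) \<inter> cpoint ` second_centers \<alpha> = {}"
    by (auto simp: second_centers_eq cpoint_second_center)
next
  show "(UNIV, fst c) \<in> Bl1 \<alpha>" if "c \<in> second_centers \<alpha>" for c
    using that global_chart_Bl1_uv by (auto simp: second_centers_eq second_center_def global_chart_def)
qed

text \<open>The six inequalities are those between the roots over \<open>P0\<close> and between the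
  roots over \<open>P1\<close>; centres over different places are already apart.\<close>

lemma root_of_eq_iff:
  assumes "\<alpha> 2 \<noteq> 0" "\<alpha> 3 \<noteq> 0" "\<alpha> 2 + \<alpha> 3 \<noteq> 0" "\<alpha> 5 \<noteq> 0" "\<alpha> 6 \<noteq> 0" "\<alpha> 5 + \<alpha> 6 \<noteq> 0"
    and "j \<in> {1..7}" "k \<in> {1..7}"
  shows "place_of j = place_of k \<and> root_of \<alpha> j = root_of \<alpha> k \<longleftrightarrow> j = k"
proof -
  have "{1..7 :: nat} = {1, 2, 3, 4, 5, 6, 7}" by auto
  then have "j = 1 \<or> j = 2 \<or> j = 3 \<or> j = 4 \<or> j = 5 \<or> j = 6 \<or> j = 7"
    "k = 1 \<or> k = 2 \<or> k = 3 \<or> k = 4 \<or> k = 5 \<or> k = 6 \<or> k = 7"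
    using assms(7,8) by auto
  then show ?thesis
    using assms(1-6) by (elim disjE) (simp_all add: place_of_def root_of_def add.assoc)
qed

text \<open>The second blow-up leaves \<open>v\<close> unchanged, so a point off the new exceptional
  line has \<open>v \<noteq> 0\<close> and lies in plane 0 or 1 of \<open>Sigma2\<close>, whereas
  the centres are of the form \<open>Exc\<close>. Thus the chart meets no centre and is defined
  everywhere.\<close>

lemma global_chart_Bl2_uv:
  assumes "\<alpha> 2 \<noteq> 0" "\<alpha> 3 \<noteq> 0" "\<alpha> 2 + \<alpha> 3 \<noteq> 0" "\<alpha> 5 \<noteq> 0" "\<alpha> 6 \<noteq> 0" "\<alpha> 5 + \<alpha> 6 \<noteq> 0"
    and j: "j \<in> {1..7}"
  shows "global_chart (Bl2 \<alpha>) (bl_uv (second_center \<alpha> j))"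
  unfolding Bl2_def
proof (rule global_chart_bl_uv)
  show "inj_on cpoint (second_centers \<alpha>)"
    unfolding second_centers_eq
    by (auto simp: inj_on_def cpoint_second_center cpoint_a_center_eq_iff root_of_eq_iff[OF assms(1-6)])
  have "bl_uv (second_center \<alpha> j) (u, v) \<noteq> Old (cpoint (second_center \<alpha> k))" for u v k
    using bl_uv_a_center_old[of v \<alpha> "place_of j" "root_of \<alpha> j + u * v"]
    by (auto simp: second_center_def bl_uv_simp cpoint_second_center[unfolded second_center_def])
  then show "range (bl_uv (second_center \<alpha> j)) \<inter> Old ` cpoint ` second_centers \<alpha> = {}"
    by (auto simp: second_centers_eq)
qed (use j global_chart_Bl1_uv in \<open>auto simp: second_centers_eq second_center_def global_chart_def\<close>)

section \<open>Strict transforms\<close>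

lemma atlas_pointsI: "(W, \<xi>) \<in> A \<Longrightarrow> z \<in> W \<Longrightarrow> \<xi> z \<in> atlas_points A"
  unfolding atlas_points_def by auto

text \<open>The directions \<open>Some u\<close> are the points \<open>(u, 0)\<close> of the first
  new chart, and \<open>None\<close> is \<open>(0, 0)\<close> in the second. Conversely, the new
  charts reach old points through coordinates that are themselves a chart of
  \<open>A\<close>.\<close>

lemma atlas_points_blowup:
  assumes C: "\<And>c. c \<in> C \<Longrightarrow> (UNIV, fst c) \<in> A"
  shows "atlas_points (blowup A C) =
    Old ` (atlas_points A - cpoint ` C) \<union> {Exc (cpoint c) d | c d. c \<in> C}"
proof (intro Set.equalityI subsetI)
  have pt: "fst c z \<in> atlas_points A" if "c \<in> C" for c z
    using atlas_pointsI[OF C[OF that]] by simp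
  fix x assume "x \<in> atlas_points (blowup A C)"
  then obtain W \<xi> z where "(W, \<xi>) \<in> blowup A C" and z: "z \<in> W" and x: "x = \<xi> z"
    unfolding atlas_points_def by auto
  from this(1) show "x \<in> Old ` (atlas_points A - cpoint ` C) \<union> {Exc (cpoint c) d | c d. c \<in> C}"
  proof (cases rule: blowup_cases)
    case (old W' \<xi>')
    then have "\<xi>' z \<in> atlas_points A" using z atlas_pointsI by fast
    then show ?thesis using old z x by auto
  next
    case (uv c)
    obtain \<psi> a b u v where "c = (\<psi>, (a, b))" "z = (u, v)" by (cases c; cases z) auto
    then have "x = (if v = 0 then Exc (cpoint c) (Some u) else Old (fst c (a + u * v, b + v)))"
      using uv x by (simp add: bl_uv_simp cpoint_def)
    moreover have "x \<notin> Old ` cpoint ` C" using uv z x by simp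
    ultimately have "x = Exc (cpoint c) (Some u) \<or> (\<exists>y. x = Old y \<and> y \<in> atlas_points A - cpoint ` C)"
      using pt[OF uv(1)] by (auto split: if_splits)
    then show ?thesis using uv(1) by blast
  next
    case (st c)
    obtain \<psi> a b u v where c: "c = (\<psi>, (a, b))" "z = (u, v)" by (cases c; cases z) auto
    show ?thesis
    proof (cases "u = 0")
      case True
      then have "x = Exc (cpoint c) (if v = 0 then None else Some (1 / v))"
        using st x by (simp add: c bl_st_simp cpoint_def)
      then show ?thesis using st(1) by blast
    next
      case False
      then have "x = Old (fst c (a + u, b + u * v))" using st x by (simp add: c bl_st_simp)
      moreover have "x \<notin> Old ` cpoint ` C" using st z x by simp
      ultimately show ?thesis using pt[OF st(1)] by auto
    qed
  qed
next
  fix x assume "x \<in> Old ` (atlas_points A - cpoint ` C) \<union> {Exc (cpoint c) d | c d. c \<in> C}"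
  then consider y where "x = Old y" "y \<in> atlas_points A" "y \<notin> cpoint ` C"
    | c u where "c \<in> C" "x = Exc (cpoint c) (Some u)"
    | c where "c \<in> C" "x = Exc (cpoint c) None"
    by (auto; metis option.exhaust)
  then show "x \<in> atlas_points (blowup A C)"
  proof cases
    case (1 y)
    then obtain W \<xi> z where z: "(W, \<xi>) \<in> A" "z \<in> W" "y = \<xi> z"
      unfolding atlas_points_def by auto
    show ?thesis using atlas_pointsI[OF blowup_memI(1)[OF z(1), of C], of z] 1 z by simp
  next
    case (2 c u)
    have "bl_uv c (u, 0) = x" using 2 by (cases c) (auto simp: bl_uv_def cpoint_def)
    then show ?thesis using atlas_pointsI[OF blowup_memI(2)[OF 2(1), of A], of "(u, 0)"] 2 by auto
  next
    case (3 c)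
    have "bl_st c (0, 0) = x" using 3 by (cases c) (auto simp: bl_st_def cpoint_def)
    then show ?thesis using atlas_pointsI[OF blowup_memI(3)[OF 3(1), of A], of "(0, 0)"] 3 by auto
  qed
qed

lemma strict_transform_superset:
  assumes "\<And>c. c \<in> C \<Longrightarrow> (UNIV, fst c) \<in> A" "D \<subseteq> atlas_points A"
  shows "Old ` (D - cpoint ` C) \<subseteq> strict_transform A C D"
  unfolding strict_transform_def
  using assms atlas_points_blowup[of C A]
  by (intro closure_of_subset) (auto simp: topspace_atlas_space)

text \<open>An open set that misses the curve bounds its closure from above; together with a bound
  from below this determines strict transforms without equations.\<close>

lemma strict_transform_disjoint:
  assumes "openin (tp (atlas_space (blowup A C))) G" "G \<inter> Old ` (D - cpoint ` C) = {}"
  shows "strict_transform A C D \<subseteq> atlas_points (blowup A C) - G"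
proof
  fix x assume x: "x \<in> strict_transform A C D"
  then have "x \<notin> G" using assms unfolding strict_transform_def in_closure_of by blast
  then show "x \<in> atlas_points (blowup A C) - G"
    using x unfolding strict_transform_def in_closure_of topspace_atlas_space by blast
qed

text \<open>The curve contains the line \<open>y = b\<close> through the centre. In the coordinates
  \<open>(s, t)\<close> this line is \<open>t = 0\<close>, and its points with
  \<open>s \<noteq> 0\<close> converge to \<open>(0, 0)\<close>.\<close>

lemma strict_transform_direction:
  assumes C: "\<And>c. c \<in> C \<Longrightarrow> (UNIV, fst c) \<in> A" and reg: "regular_atlas (blowup A C)"
    and c: "(\<psi>, (a, b)) \<in> C" and D: "\<And>s. \<psi> (a + s, b) \<in> D"
  shows "Exc (\<psi> (a, b)) None \<in> strict_transform A C D"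
proof -
  let ?B = "blowup A C" and ?f = "bl_st (\<psi>, (a, b))"
  let ?W = "{z. ?f z \<notin> Old ` cpoint ` C}"
  have W: "(?W, ?f) \<in> ?B" using blowup_memI(3)[OF c] .
  then have opW: "open ?W" using reg unfolding regular_atlas_def by blast
  have f0: "?f (0, 0) = Exc (\<psi> (a, b)) None" by (simp add: bl_st_simp)
  have top: "Exc (\<psi> (a, b)) None \<in> topspace (tp (atlas_space ?B))"
    using atlas_pointsI[OF W, of "(0, 0)"] unfolding topspace_atlas_space by (auto simp: bl_st_simp)
  have "\<exists>y. y \<in> Old ` (D - cpoint ` C) \<and> y \<in> T"
    if T: "Exc (\<psi> (a, b)) None \<in> T" "openin (tp (atlas_space ?B)) T" for T
  proof -
    have "openin (top_of_set ?W) {z \<in> ?W. ?f z \<in> T}"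
      using openin_atlas_spaceD[OF T(2) W] .
    then have op: "open {z \<in> ?W. ?f z \<in> T}"
      using opW by (rule openin_open_trans)
    have z: "(0, 0) \<in> {z \<in> ?W. ?f z \<in> T}" using T(1) f0 by auto
    obtain e where e: "e > 0" "ball (0, 0) e \<subseteq> {z \<in> ?W. ?f z \<in> T}"
      by (rule openE[OF op z])
    \<comment> \<open>The point \<open>(s, 0)\<close> will lie in the ball, hence in the chart
      domain, so its image is not one of the other centres on the line.\<close>
    define s :: complex where "s = of_real (e / 2)"
    have "dist (0, 0) (s, 0 :: complex) = norm s"
      by (simp add: dist_prod_def dist_norm)
    moreover have "norm s = e / 2" using e(1) unfolding s_def norm_of_real by simp
    ultimately have "(s, 0 :: complex) \<in> ball (0, 0) e" using e(1) by simp
    then have s: "(s, 0) \<in> ?W" "?f (s, 0) \<in> T" using e(2) by blast+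
    have "s \<noteq> 0" using e(1) by (simp add: s_def)
    then have eq: "?f (s, 0) = Old (\<psi> (a + s, b))" by (simp add: bl_st_simp)
    with s D[of s] show ?thesis by auto
  qed
  then show ?thesis unfolding strict_transform_def in_closure_of using top by blast
qed

lemma D_zero_disjoint: "i \<le> 1 \<Longrightarrow> zw \<alpha> i z \<notin> D_zero \<alpha>"
  unfolding D_zero_def by (cases z) (auto simp: zw_eq_iff le_Suc_eq split: if_splits)

lemma atlas_points_Sigma2: "atlas_points (Sigma2 \<alpha>) = (\<Union>i\<le>3. range (zw \<alpha> i))"
  by (simp add: Sigma2_eq atlas_points_def)

lemma Sigma2_point_cases:
  assumes "x \<in> atlas_points (Sigma2 \<alpha>)"
  obtains i z where "i \<le> 1" "x = zw \<alpha> i z" | "x \<in> D_zero \<alpha>"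
proof -
  obtain i z w where x: "i \<le> 3" "x = zw \<alpha> i (z, w)" using assms by (auto simp: atlas_points_Sigma2)
  have "i = 0 \<or> i = 1 \<or> i = 2 \<or> i = 3" using x(1) by auto
  then show ?thesis
    using x that(1)[of 0] that(1)[of 1] that(2) zw_finite[of w \<alpha> z]
    by (cases "w = 0") (auto simp: D_zero_def)
qed

lemma D_zero_subset: "D_zero \<alpha> \<subseteq> atlas_points (Sigma2 \<alpha>)"
proof -
  have "zw \<alpha> i z \<in> atlas_points (Sigma2 \<alpha>)" if "i \<le> 3" for i z
    using that unfolding atlas_points_Sigma2 by blast
  from this[of 2] this[of 3] show ?thesis unfolding D_zero_def by auto
qed

lemma atlas_points_Bl1: "atlas_points (Bl1 \<alpha>) =
    Old ` (atlas_points (Sigma2 \<alpha>) - cpoint ` range (a_center \<alpha>)) \<union>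
    {Exc (cpoint (a_center \<alpha> \<nu>)) d | \<nu> d. True}"
proof -
  have ctr: "c \<in> range (a_center \<alpha>) \<Longrightarrow> (UNIV, fst c) \<in> Sigma2 \<alpha>" for c
    using fst_a_center(1) by blast
  have "{Exc (cpoint c) d | c d. c \<in> range (a_center \<alpha>)} = {Exc (cpoint (a_center \<alpha> \<nu>)) d | \<nu> d. True}"
    by blast
  then show ?thesis unfolding Bl1_def by (subst atlas_points_blowup) (auto intro: ctr)
qed

lemma openin_range:
  "open_embedding X \<phi> \<Longrightarrow> openin (tp X) (range \<phi>)"
  unfolding open_embedding_def by simp

text \<open>\<open>D_zero\<close> is the line \<open>y = b\<close> in the coordinates of each
  centre, so it leaves every centre in direction \<open>None\<close> and in no other. The other
  directions are seen by the charts \<open>(u, v)\<close>, which together with the affine planes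
  form an open set missing the curve.\<close>

lemma strict_transform_D_zero:
  "strict_transform (Sigma2 \<alpha>) (range (a_center \<alpha>)) (D_zero \<alpha>) =
    Old ` (D_zero \<alpha> - cpoint ` range (a_center \<alpha>)) \<union> range (\<lambda>\<nu>. Exc (cpoint (a_center \<alpha> \<nu>)) None)"
    (is "?T = ?R")
proof
  have ctr: "c \<in> range (a_center \<alpha>) \<Longrightarrow> (UNIV, fst c) \<in> Sigma2 \<alpha>" for c
    using fst_a_center(1) by blast
  have "Exc (cpoint (a_center \<alpha> \<nu>)) None \<in> ?T" for \<nu>
  proof -
    obtain \<psi> a b where c: "a_center \<alpha> \<nu> = (\<psi>, (a, b))" by (cases "a_center \<alpha> \<nu>") auto
    have "\<psi> (a + s, b) \<in> D_zero \<alpha>" for s using c by (cases \<nu>) (auto simp: D_zero_def)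
    then show ?thesis
      using strict_transform_direction[OF ctr regular_Bl1[unfolded Bl1_def], of \<psi> a b] c
      by (metis cpoint_def prod.case rangeI)
  qed
  moreover have "Old ` (D_zero \<alpha> - cpoint ` range (a_center \<alpha>)) \<subseteq> ?T"
    by (rule strict_transform_superset[OF ctr D_zero_subset])
  ultimately show "?R \<subseteq> ?T" by auto
  let ?G = "(\<Union>i\<le>1. range (Old \<circ> zw \<alpha> i)) \<union> (\<Union>\<nu>. range (bl_uv (a_center \<alpha> \<nu>)))"
  have "openin (tp (atlas_space (Bl1 \<alpha>))) ?G"
    using openin_range[OF open_embedding_global_chart[OF regular_Bl1 global_chart_Bl1_old]]
      openin_range[OF open_embedding_global_chart[OF regular_Bl1 global_chart_Bl1_uv]]
    by (intro openin_Un openin_Union) auto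
  moreover have "?G \<inter> Old ` (D_zero \<alpha> - cpoint ` range (a_center \<alpha>)) = {}"
  proof -
    have "bl_uv (a_center \<alpha> \<nu>) z \<noteq> Old y" if "y \<in> D_zero \<alpha>" for \<nu> z y
      using bl_uv_a_center_old[of "snd z" \<alpha> \<nu> "fst z"] bl_uv_a_center_exc[of \<alpha> \<nu> "fst z"]
        D_zero_disjoint that by (cases "snd z = 0"; cases z) auto
    then have "y \<notin> range (bl_uv (a_center \<alpha> \<nu>))"
      if "y \<in> Old ` (D_zero \<alpha> - cpoint ` range (a_center \<alpha>))" for \<nu> y
      using that by (auto; metis)
    moreover have "y \<notin> range (Old \<circ> zw \<alpha> i)"
      if "i \<le> 1" "y \<in> Old ` (D_zero \<alpha> - cpoint ` range (a_center \<alpha>))" for y i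
      using that D_zero_disjoint[of i] by auto
    ultimately show ?thesis by blast
  qed
  ultimately have sub: "?T \<subseteq> atlas_points (Bl1 \<alpha>) - ?G"
    unfolding Bl1_def by (rule strict_transform_disjoint)
  show "?T \<subseteq> ?R"
  proof
    fix x assume "x \<in> ?T"
    then have x: "x \<in> atlas_points (Bl1 \<alpha>)" "x \<notin> ?G" using sub by blast+
    then consider y where "x = Old y" "y \<in> atlas_points (Sigma2 \<alpha>)" "y \<notin> cpoint ` range (a_center \<alpha>)"
      | \<nu> d where "x = Exc (cpoint (a_center \<alpha> \<nu>)) d"
      by (cases x) (auto simp: atlas_points_Bl1)
    then show "x \<in> ?R"
    proof cases
      case 1
      have "y \<in> D_zero \<alpha>"
        using 1(2)
      proof (cases rule: Sigma2_point_cases)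
        case (1 i z)
        then have "x \<in> (\<Union>i\<le>1. range (Old \<circ> zw \<alpha> i))" using \<open>x = Old y\<close> by auto
        then show ?thesis using x(2) by blast
      qed
      then show ?thesis using 1 by blast
    next
      case 2
      have "d = None"
      proof (cases d)
        case (Some u)
        then have "x = bl_uv (a_center \<alpha> \<nu>) (u, 0)" using 2 bl_uv_a_center_exc by metis
        then show ?thesis using x(2) by blast
      qed
      then show ?thesis using 2 by blast
    qed
  qed
qed


section \<open>The affine charts of the space of initial conditions\<close>

definition generic :: "(nat \<Rightarrow> complex) \<Rightarrow> bool" where
  "generic \<alpha> \<longleftrightarrow> \<alpha> 2 \<noteq> 0 \<and> \<alpha> 3 \<noteq> 0 \<and> \<alpha> 2 + \<alpha> 3 \<noteq> 0 \<and> \<alpha> 5 \<noteq> 0 \<and> \<alpha> 6 \<noteq> 0 \<and> \<alpha> 5 + \<alpha> 6 \<noteq> 0"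

text \<open>The sign change matches \<open>r_j\<close>: over \<open>q = 0\<close> the blow-up
  coordinate is \<open>(p * q - a) * p\<close>, and it is its negative that together with
  \<open>1 / p\<close> gives Jacobian determinant 1.\<close>

fun chart :: "(nat \<Rightarrow> complex) \<Rightarrow> plane \<Rightarrow> c2 \<Rightarrow> (nat \<times> c2) set blpt blpt" where
  "chart \<alpha> QP = Old \<circ> (Old \<circ> zw \<alpha> 0)"
| "chart \<alpha> (XY j) = (if j = 0 then Old \<circ> (Old \<circ> zw \<alpha> 1)
     else bl_uv (second_center \<alpha> j) \<circ> (\<lambda>z. (- fst z, snd z)))"

definition affine_part :: "(nat \<Rightarrow> complex) \<Rightarrow> (nat \<times> c2) set blpt blpt set" where
  "affine_part \<alpha> = (\<Union>c\<in>planes. range (chart \<alpha> c))"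

lemma range_chart: "c \<in> planes \<Longrightarrow> chart \<alpha> c ` V \<subseteq> affine_part \<alpha>"
  unfolding affine_part_def by blast

text \<open>The reflection is a holomorphic involution, so each implication applied to the reflected
  set gives its converse.\<close>

lemma open_embedding_reflect:
  fixes \<phi> :: "c2 \<Rightarrow> 'a"
  assumes \<phi>: "open_embedding X \<phi>" shows "open_embedding X (\<phi> \<circ> (\<lambda>z. (- fst z, snd z)))"
proof -
  let ?\<sigma> = "\<lambda>z :: c2. (- fst z, snd z)"
  have inv: "?\<sigma> ` ?\<sigma> ` V = V" for V by (auto simp: image_image)
  have op: "open (?\<sigma> ` V)" if "open V" for V
  proof -
    have "?\<sigma> ` V = ?\<sigma> -` V" by (auto intro!: image_eqI[where x = "?\<sigma> _"])
    moreover have "open (?\<sigma> -` V)" by (intro open_vimage that continuous_intros)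
    ultimately show ?thesis by simp
  qed
  have hol: "holomorphic2_on (g \<circ> ?\<sigma>) V" if "holomorphic2_on g (?\<sigma> ` V)" for g V
    unfolding holomorphic2_on_iff
  proof
    fix z assume "z \<in> V"
    then have "holo_at g (?\<sigma> z)" using that unfolding holomorphic2_on_iff by blast
    moreover have "holo_map_at ?\<sigma> z" unfolding holo_map_at_def by (auto intro!: holo_intros)
    ultimately show "holo_at (g \<circ> ?\<sigma>) z" using holo_at_compose[of g ?\<sigma> z] by (simp add: comp_def)
  qed
  have inj: "inj (\<phi> \<circ> ?\<sigma>)"
    using \<phi> unfolding open_embedding_def by (intro inj_compose) (auto simp: inj_def)
  have rng: "range (\<phi> \<circ> ?\<sigma>) \<subseteq> topspace (tp X)"
    using \<phi> unfolding open_embedding_def by auto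
  have opn: "openin (tp X) ((\<phi> \<circ> ?\<sigma>) ` V) \<longleftrightarrow> open V" for V
    using \<phi> op[of V] op[of "?\<sigma> ` V"] unfolding open_embedding_def image_comp[symmetric] inv by blast
  have "hol X ((\<phi> \<circ> ?\<sigma>) ` V) f \<longleftrightarrow> holomorphic2_on (f \<circ> (\<phi> \<circ> ?\<sigma>)) V" if "open V" for V f
  proof -
    have "hol X ((\<phi> \<circ> ?\<sigma>) ` V) f \<longleftrightarrow> holomorphic2_on (f \<circ> \<phi>) (?\<sigma> ` V)"
      using \<phi> op[OF that] unfolding open_embedding_def image_comp[symmetric] by blast
    also have "\<dots> \<longleftrightarrow> holomorphic2_on (f \<circ> (\<phi> \<circ> ?\<sigma>)) V"
      using hol[of "f \<circ> \<phi>" V] hol[of "f \<circ> \<phi> \<circ> ?\<sigma>" "?\<sigma> ` V"] unfolding inv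
      by (auto simp: comp_def)
    finally show ?thesis .
  qed
  then show ?thesis using inj rng opn unfolding open_embedding_def by blast
qed

lemma planes_cases:
  assumes "c \<in> planes"
  obtains "c = QP" | "c = XY 0" | j where "c = XY j" "j \<in> {1..7}"
proof (cases c)
  case (XY j)
  then have "j \<le> 7" using assms by (auto simp: planes_def)
  then show ?thesis using that(2) that(3)[of j] XY by (cases "j = 0") auto
qed (use that in blast)

lemma open_embedding_chart:
  assumes "generic \<alpha>" "c \<in> planes"
  shows "open_embedding (atlas_space (Bl2 \<alpha>)) (chart \<alpha> c)"
  using assms(2)
proof (cases rule: planes_cases)
  case (3 j)
  then show ?thesis
    using open_embedding_reflect[OF open_embedding_global_chart[OF regular_Bl2 global_chart_Bl2_uv]]
      assms(1) by (simp add: generic_def)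
qed (use open_embedding_global_chart[OF regular_Bl2 global_chart_Bl2_old] in auto)

text \<open>Unwinding the two blow-ups: \<open>u = root - x y\<close> in the first, then
  \<open>z = \<nu> + u y\<close> and \<open>w = y\<close> in \<open>Sigma2\<close>. For
  \<open>y \<noteq> 0\<close> this is the inverse of \<open>r_j\<close>, and \<open>y = 0\<close> is
  the new exceptional line without \<open>None\<close>.\<close>

lemma chart_blowup:
  assumes "j \<in> {1..7}"
  shows "chart \<alpha> (XY j) (x, y) =
    (if y = 0 then Exc (cpoint (second_center \<alpha> j)) (Some (- x))
     else Old (Old (zw \<alpha> (if j = 7 then 1 else 0)
       ((if 4 \<le> j \<and> j \<le> 6 then 1 else 0) + (root_of \<alpha> j - x * y) * y, 1 / y))))"
proof (cases "y = 0")
  case True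
  have "chart \<alpha> (XY j) (x, y) = bl_uv (second_center \<alpha> j) (- x, y)" using assms by simp
  then show ?thesis unfolding second_center_def bl_uv_simp cpoint_def using True by simp
next
  case False
  have "chart \<alpha> (XY j) (x, y) = bl_uv (second_center \<alpha> j) (- x, y)" using assms by simp
  then show ?thesis
    using assms False by (auto simp: second_center_def bl_uv_simp place_of_def zw_finite)
qed

text \<open>Beyond the two affine planes of \<open>Sigma2\<close>, each of the seven other planes
  adds only its line \<open>y = 0\<close>.\<close>

lemma affine_part_iff:
  "x \<in> affine_part \<alpha> \<longleftrightarrow> (\<exists>i\<le>1. \<exists>z. x = Old (Old (zw \<alpha> i z))) \<or>
     (\<exists>j\<in>{1..7}. \<exists>u. x = Exc (cpoint (second_center \<alpha> j)) (Some u))" (is "_ \<longleftrightarrow> ?R")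
proof
  assume "x \<in> affine_part \<alpha>"
  then obtain c z where c: "c \<in> planes" "x = chart \<alpha> c z" unfolding affine_part_def by blast
  from c(1) show ?R
  proof (cases rule: planes_cases)
    case 1
    then have "x = Old (Old (zw \<alpha> 0 z))" using c by simp
    then show ?thesis by blast
  next
    case 2
    then have "x = Old (Old (zw \<alpha> 1 z))" using c by simp
    then show ?thesis by blast
  next
    case (3 j)
    have "x = chart \<alpha> (XY j) (fst z, snd z)" using c 3 by simp
    moreover have "(if j = 7 then 1 else 0) \<le> (1 :: nat)" by simp
    ultimately show ?thesis unfolding chart_blowup[OF 3(2)] using 3(2) by (metis (no_types))
  qed
next
  assume ?R
  then consider z where "x = chart \<alpha> QP z" | z where "x = chart \<alpha> (XY 0) z"
    | j u where "j \<in> {1..7}" "x = Exc (cpoint (second_center \<alpha> j)) (Some u)"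
    by (auto simp: le_Suc_eq)
  then show "x \<in> affine_part \<alpha>"
  proof cases
    case 3
    then have "x = chart \<alpha> (XY j) (- u, 0)" unfolding chart_blowup[OF 3(1)] by simp
    moreover have "XY j \<in> planes" using 3(1) by (simp add: planes_def)
    ultimately show ?thesis unfolding affine_part_def by blast
  qed (auto simp: affine_part_def planes_def)
qed

lemma fst_second_centers: "c \<in> second_centers \<alpha> \<Longrightarrow> (UNIV, fst c) \<in> Bl1 \<alpha>"
  using global_chart_Bl1_uv by (auto simp: second_centers_eq second_center_def global_chart_def)

lemma atlas_points_Bl2: "atlas_points (Bl2 \<alpha>) =
    Old ` (atlas_points (Bl1 \<alpha>) - cpoint ` second_centers \<alpha>) \<union>
    {Exc (cpoint (second_center \<alpha> j)) d | j d. j \<in> {1..7}}"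
proof -
  have "{Exc (cpoint c) d | c d. c \<in> second_centers \<alpha>} = {Exc (cpoint (second_center \<alpha> j)) d | j d. j \<in> {1..7}}"
    unfolding second_centers_eq by blast
  then show ?thesis
    using atlas_points_blowup[of "second_centers \<alpha>" "Bl1 \<alpha>", OF fst_second_centers]
    unfolding Bl2_def by simp
qed

lemma D_one_subset: "D_one \<alpha> \<nu> \<subseteq> atlas_points (Bl1 \<alpha>)"
  unfolding D_one_def exc_curve_def atlas_points_Bl1 by blast

text \<open>The curve leaves the first centres in direction \<open>None\<close>, while the second
  centres are finite directions; it therefore avoids them, and the second blow-up removes none of
  its points.\<close>

lemma D_zero_strict_superset:
  "Old ` strict_transform (Sigma2 \<alpha>) (range (a_center \<alpha>)) (D_zero \<alpha>) \<subseteq> D_zero_strict \<alpha>"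
proof -
  let ?T = "strict_transform (Sigma2 \<alpha>) (range (a_center \<alpha>)) (D_zero \<alpha>)"
  have "?T \<inter> cpoint ` second_centers \<alpha> = {}"
    unfolding strict_transform_D_zero second_centers_eq by (auto simp: cpoint_second_center)
  then have eq: "?T - cpoint ` second_centers \<alpha> = ?T" by blast
  have "?T \<subseteq> atlas_points (Bl1 \<alpha>)"
    unfolding strict_transform_D_zero atlas_points_Bl1 using D_zero_subset by blast
  from strict_transform_superset[of "second_centers \<alpha>" "Bl1 \<alpha>" ?T, OF fst_second_centers this] show ?thesis
    unfolding D_zero_strict_def eq .
qed

lemma D_one_strict_superset:
  "Old ` (D_one \<alpha> \<nu> - cpoint ` second_centers \<alpha>) \<subseteq> D_one_strict \<alpha> \<nu>"
  unfolding D_one_strict_def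
  by (rule strict_transform_superset[OF fst_second_centers D_one_subset])

lemma D_one_strict_direction:
  assumes "j \<in> {1..7}"
  shows "Exc (cpoint (second_center \<alpha> j)) None \<in> D_one_strict \<alpha> (place_of j)"
proof -
  have "second_center \<alpha> j \<in> second_centers \<alpha>" using assms by (simp add: second_centers_eq)
  then show ?thesis
    using strict_transform_direction[where \<psi> = "bl_uv (a_center \<alpha> (place_of j))" and a = "root_of \<alpha> j"
        and b = 0 and D = "D_one \<alpha> (place_of j)", OF fst_second_centers regular_Bl2[unfolded Bl2_def]]
    unfolding D_one_strict_def cpoint_second_center
    by (simp add: second_center_def bl_uv_a_center_exc D_one_def exc_curve_def)
qed

text \<open>This is an intersection point of the two curves. At infinity it makes the second
  contraction swallow the point created by the first; over 0 it puts the contraction point on the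
  removed divisor.\<close>

lemma direction_in_both: "Old (Exc (cpoint (a_center \<alpha> \<nu>)) None) \<in> D_zero_strict \<alpha> \<inter> D_one_strict \<alpha> \<nu>"
proof -
  have "Exc (cpoint (a_center \<alpha> \<nu>)) None \<in> D_one \<alpha> \<nu> - cpoint ` second_centers \<alpha>"
    by (auto simp: D_one_def exc_curve_def second_centers_eq cpoint_second_center)
  then show ?thesis
    using D_zero_strict_superset[of \<alpha>] D_one_strict_superset[of \<alpha> \<nu>]
    unfolding strict_transform_D_zero by blast
qed

lemma openin_affine_part: "generic \<alpha> \<Longrightarrow> openin (tp (atlas_space (Bl2 \<alpha>))) (affine_part \<alpha>)"
  unfolding affine_part_def using openin_range[OF open_embedding_chart] by (intro openin_Union) auto

text \<open>One inclusion holds because the nine planes form an open set that misses the curves,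
  hence also their closures. For the other, each remaining point is old and on
  \<open>D_zero\<close>, old and on a first exceptional curve, or the direction \<open>None\<close>
  at a second centre.\<close>

lemma removed_curves_eq:
  assumes "generic \<alpha>"
  shows "D_zero_strict \<alpha> \<union> (\<Union>\<nu>. D_one_strict \<alpha> \<nu>) = atlas_points (Bl2 \<alpha>) - affine_part \<alpha>"
proof
  let ?T = "strict_transform (Sigma2 \<alpha>) (range (a_center \<alpha>)) (D_zero \<alpha>)"
  have "affine_part \<alpha> \<inter> Old ` (?T - cpoint ` second_centers \<alpha>) = {}"
    unfolding strict_transform_D_zero using D_zero_disjoint by (auto simp: affine_part_iff)
  then have "D_zero_strict \<alpha> \<subseteq> atlas_points (Bl2 \<alpha>) - affine_part \<alpha>"
    unfolding D_zero_strict_def Bl2_def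
    by (intro strict_transform_disjoint openin_affine_part[OF assms, unfolded Bl2_def])
  moreover have "D_one_strict \<alpha> \<nu> \<subseteq> atlas_points (Bl2 \<alpha>) - affine_part \<alpha>" for \<nu>
  proof -
    have "affine_part \<alpha> \<inter> Old ` (D_one \<alpha> \<nu> - cpoint ` second_centers \<alpha>) = {}"
      by (auto simp: affine_part_iff D_one_def exc_curve_def)
    then show ?thesis
      unfolding D_one_strict_def Bl2_def
      by (intro strict_transform_disjoint openin_affine_part[OF assms, unfolded Bl2_def])
  qed
  ultimately show "D_zero_strict \<alpha> \<union> (\<Union>\<nu>. D_one_strict \<alpha> \<nu>) \<subseteq> atlas_points (Bl2 \<alpha>) - affine_part \<alpha>"
    by blast
  show "atlas_points (Bl2 \<alpha>) - affine_part \<alpha> \<subseteq> D_zero_strict \<alpha> \<union> (\<Union>\<nu>. D_one_strict \<alpha> \<nu>)"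
  proof
    fix x assume "x \<in> atlas_points (Bl2 \<alpha>) - affine_part \<alpha>"
    then have x: "x \<in> atlas_points (Bl2 \<alpha>)" and ng: "x \<notin> affine_part \<alpha>" by blast+
    from x consider y where "x = Old (Old y)" "y \<in> atlas_points (Sigma2 \<alpha>)"
        "y \<notin> cpoint ` range (a_center \<alpha>)"
      | \<nu> d where "x = Old (Exc (cpoint (a_center \<alpha> \<nu>)) d)"
        "Exc (cpoint (a_center \<alpha> \<nu>)) d \<notin> cpoint ` second_centers \<alpha>"
      | j d where "j \<in> {1..7}" "x = Exc (cpoint (second_center \<alpha> j)) d"
      unfolding atlas_points_Bl2 atlas_points_Bl1 by blast
    then show "x \<in> D_zero_strict \<alpha> \<union> (\<Union>\<nu>. D_one_strict \<alpha> \<nu>)"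
    proof cases
      case 1
      then have "y \<in> D_zero \<alpha>"
        using ng Sigma2_point_cases[OF 1(2)] by (metis affine_part_iff)
      then show ?thesis
        using 1 D_zero_strict_superset[of \<alpha>] unfolding strict_transform_D_zero by blast
    next
      case 2
      then have "x \<in> Old ` (D_one \<alpha> \<nu> - cpoint ` second_centers \<alpha>)"
        by (auto simp: D_one_def exc_curve_def)
      then show ?thesis using D_one_strict_superset by blast
    next
      case 3
      have "d = None" using 3 ng by (cases d) (auto simp: affine_part_iff)
      then show ?thesis using D_one_strict_direction[OF 3(1)] 3(2) by blast
    qed
  qed
qed

section \<open>The two contractions\<close>

lemma S_tilde_pt_eq:
  "S_tilde_pt \<alpha> x =
     (if x \<in> D_zero_strict \<alpha> \<union> D_one_strict \<alpha> Pinf then None else Some (Some x))"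
  \<comment> \<open>The two contracted curves meet, so the \<open>None\<close> of the first
    contraction lies on the curve contracted by the second and is collapsed again.\<close>
  using direction_in_both[of \<alpha> Pinf]
  by (auto simp: S_tilde_pt_def D_one_inf_image_def contract_pt_def image_iff)

lemma topspace_contract: "topspace (tp (contract X C)) = contract_pt C ` topspace (tp X)"
proof
  have "{x \<in> topspace (tp X). contract_pt C x \<in> contract_pt C ` topspace (tp X)} = topspace (tp X)"
    by blast
  then have "openin (tp (contract X C)) (contract_pt C ` topspace (tp X))"
    unfolding openin_contract by simp
  then show "contract_pt C ` topspace (tp X) \<subseteq> topspace (tp (contract X C))"
    by (rule openin_subset)
  show "topspace (tp (contract X C)) \<subseteq> contract_pt C ` topspace (tp X)"
    using openin_contract openin_topspace by metis
qed

lemma topspace_S_tilde: "topspace (tp (S_tilde \<alpha>)) = S_tilde_pt \<alpha> ` atlas_points (Bl2 \<alpha>)"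
  by (simp add: S_tilde_def topspace_contract topspace_atlas_space S_tilde_pt_def image_comp)

lemma contract_preimage:
  "{x \<in> topspace (tp (atlas_space (Bl2 \<alpha>))). contract_pt (D_zero_strict \<alpha>) x \<in>
     {y \<in> topspace (tp (contract (atlas_space (Bl2 \<alpha>)) (D_zero_strict \<alpha>))).
        contract_pt (D_one_inf_image \<alpha>) y \<in> V}} =
   {x \<in> atlas_points (Bl2 \<alpha>). S_tilde_pt \<alpha> x \<in> V}"
  by (auto simp: topspace_contract topspace_atlas_space S_tilde_pt_def)

lemma openin_S_tilde:
  "openin (tp (S_tilde \<alpha>)) V \<longleftrightarrow> V \<subseteq> S_tilde_pt \<alpha> ` atlas_points (Bl2 \<alpha>) \<and>
     openin (tp (atlas_space (Bl2 \<alpha>))) {x \<in> atlas_points (Bl2 \<alpha>). S_tilde_pt \<alpha> x \<in> V}"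
  unfolding topspace_S_tilde[symmetric] contract_preimage[symmetric]
  unfolding S_tilde_def openin_contract topspace_contract by blast

lemma hol_S_tilde:
  "hol (S_tilde \<alpha>) V f \<longleftrightarrow>
     hol (atlas_space (Bl2 \<alpha>)) {x \<in> atlas_points (Bl2 \<alpha>). S_tilde_pt \<alpha> x \<in> V} (f \<circ> S_tilde_pt \<alpha>)"
  unfolding contract_preimage[symmetric]
  by (simp add: S_tilde_def contract_def S_tilde_pt_def comp_assoc)

context
  fixes \<alpha> :: "nat \<Rightarrow> complex"
  assumes gen: "generic \<alpha>"
begin

lemma affine_part_subset: "affine_part \<alpha> \<subseteq> atlas_points (Bl2 \<alpha>)"
  using openin_subset[OF openin_affine_part[OF gen]] by (simp add: topspace_atlas_space)

lemma S_tilde_pt_affine: "x \<in> affine_part \<alpha> \<Longrightarrow> S_tilde_pt \<alpha> x = Some (Some x)"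
  unfolding S_tilde_pt_eq using removed_curves_eq[OF gen] by auto

lemma S_tilde_pt_eq_iff: "x \<in> affine_part \<alpha> \<Longrightarrow> S_tilde_pt \<alpha> y = S_tilde_pt \<alpha> x \<longleftrightarrow> y = x"
  using S_tilde_pt_affine[of x] S_tilde_pt_eq[of \<alpha> y] by (auto split: if_splits)

text \<open>Subsets of the affine part are saturated: nothing else is sent to their images. Hence
  the quotient topology and the direct image sheaf restrict there to those of the second
  blow-up.\<close>

lemma S_tilde_preimage:
  assumes "V \<subseteq> affine_part \<alpha>"
  shows "{x \<in> atlas_points (Bl2 \<alpha>). S_tilde_pt \<alpha> x \<in> S_tilde_pt \<alpha> ` V} = V"
proof (intro set_eqI iffI)
  fix x assume "x \<in> {x \<in> atlas_points (Bl2 \<alpha>). S_tilde_pt \<alpha> x \<in> S_tilde_pt \<alpha> ` V}"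
  then obtain v where "v \<in> V" "S_tilde_pt \<alpha> x = S_tilde_pt \<alpha> v" by blast
  then show "x \<in> V" using S_tilde_pt_eq_iff[of v x] assms by blast
qed (use assms affine_part_subset in blast)

lemma topspace_init_space: "topspace (tp (init_space \<alpha>)) = S_tilde_pt \<alpha> ` affine_part \<alpha>"
proof -
  have red: "anticanonical_red \<alpha> = S_tilde_pt \<alpha> ` (atlas_points (Bl2 \<alpha>) - affine_part \<alpha>)"
  proof -
    have "S_tilde_pt \<alpha> x \<in> anticanonical_red \<alpha>" if "x \<in> D_zero_strict \<alpha> \<union> D_one_strict \<alpha> \<nu>" for x \<nu>
    proof -
      \<comment> \<open>At this point \<open>D_zero\<close> meets the curve over 0, so the
        contraction point is one of the removed points.\<close>
      let ?y = "Old (Exc (cpoint (a_center \<alpha> P0)) None)"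
      have "S_tilde_pt \<alpha> ?y = None" using direction_in_both[of \<alpha> P0] by (simp add: S_tilde_pt_eq)
      moreover have "S_tilde_pt \<alpha> ?y \<in> anticanonical_red \<alpha>"
        unfolding anticanonical_red_def using direction_in_both[of \<alpha> P0] by blast
      ultimately have "None \<in> anticanonical_red \<alpha>" by simp
      moreover have "S_tilde_pt \<alpha> x = None"
        if "x \<in> D_zero_strict \<alpha> \<union> D_one_strict \<alpha> Pinf"
        using that by (simp add: S_tilde_pt_eq)
      ultimately show ?thesis
        using that unfolding anticanonical_red_def by (cases \<nu>) auto
    qed
    moreover have "anticanonical_red \<alpha> \<subseteq> S_tilde_pt \<alpha> ` (D_zero_strict \<alpha> \<union> (\<Union>\<nu>. D_one_strict \<alpha> \<nu>))"
      unfolding anticanonical_red_def by blast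
    ultimately show ?thesis unfolding removed_curves_eq[OF gen, symmetric] by blast
  qed
  have "topspace (tp (init_space \<alpha>)) = S_tilde_pt \<alpha> ` atlas_points (Bl2 \<alpha>) - anticanonical_red \<alpha>"
    by (auto simp: init_space_def open_subspace_def topspace_S_tilde)
  also have "\<dots> = S_tilde_pt \<alpha> ` affine_part \<alpha>"
  proof (intro Set.equalityI subsetI)
    fix y assume "y \<in> S_tilde_pt \<alpha> ` affine_part \<alpha>"
    then obtain x where x: "x \<in> affine_part \<alpha>" "y = S_tilde_pt \<alpha> x" by blast
    have "y \<notin> S_tilde_pt \<alpha> ` (atlas_points (Bl2 \<alpha>) - affine_part \<alpha>)"
    proof
      assume "y \<in> S_tilde_pt \<alpha> ` (atlas_points (Bl2 \<alpha>) - affine_part \<alpha>)"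
      then obtain x' where x': "x' \<notin> affine_part \<alpha>" "y = S_tilde_pt \<alpha> x'" by blast
      have "S_tilde_pt \<alpha> x' = S_tilde_pt \<alpha> x" by (rule trans[OF x'(2)[symmetric] x(2)])
      then have "x' = x" unfolding S_tilde_pt_eq_iff[OF x(1)] .
      then show False using x(1) x'(1) by blast
    qed
    then show "y \<in> S_tilde_pt \<alpha> ` atlas_points (Bl2 \<alpha>) - anticanonical_red \<alpha>"
      unfolding red using x affine_part_subset by blast
  qed (auto simp: red)
  finally show ?thesis .
qed

lemma openin_init_space:
  assumes "V \<subseteq> affine_part \<alpha>"
  shows "openin (tp (init_space \<alpha>)) (S_tilde_pt \<alpha> ` V) \<longleftrightarrow> openin (tp (atlas_space (Bl2 \<alpha>))) V"
proof -
  have top: "topspace (tp (S_tilde \<alpha>)) - anticanonical_red \<alpha> = S_tilde_pt \<alpha> ` affine_part \<alpha>"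
    using topspace_init_space by (auto simp: init_space_def open_subspace_def)
  have "openin (tp (S_tilde \<alpha>)) (S_tilde_pt \<alpha> ` V) \<longleftrightarrow> openin (tp (atlas_space (Bl2 \<alpha>))) V"
    if "V \<subseteq> affine_part \<alpha>" for V
  proof -
    have "S_tilde_pt \<alpha> ` V \<subseteq> S_tilde_pt \<alpha> ` atlas_points (Bl2 \<alpha>)"
      using that affine_part_subset by (intro image_mono) blast
    then show ?thesis unfolding openin_S_tilde S_tilde_preimage[OF that] by simp
  qed
  note 1 = this[OF assms] and 2 = this[OF subset_refl]
  have "tp (init_space \<alpha>) = subtopology (tp (S_tilde \<alpha>)) (S_tilde_pt \<alpha> ` affine_part \<alpha>)"
    unfolding init_space_def open_subspace_def top by simp
  moreover have "openin (tp (S_tilde \<alpha>)) (S_tilde_pt \<alpha> ` affine_part \<alpha>)" using 2 openin_affine_part[OF gen] by blast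
  ultimately show ?thesis
    using openin_open_subtopology[of "tp (S_tilde \<alpha>)" "S_tilde_pt \<alpha> ` affine_part \<alpha>" "S_tilde_pt \<alpha> ` V"]
      1 assms by auto
qed

lemma hol_init_space:
  assumes "V \<subseteq> affine_part \<alpha>"
  shows "hol (init_space \<alpha>) (S_tilde_pt \<alpha> ` V) f \<longleftrightarrow> hol (atlas_space (Bl2 \<alpha>)) V (f \<circ> S_tilde_pt \<alpha>)"
  using hol_S_tilde[of \<alpha> "S_tilde_pt \<alpha> ` V" f] unfolding S_tilde_preimage[OF assms]
  by (simp add: init_space_def open_subspace_def)

lemma open_embedding_init_space:
  assumes c: "c \<in> planes"
  shows "open_embedding (init_space \<alpha>) (S_tilde_pt \<alpha> \<circ> chart \<alpha> c)"
  unfolding open_embedding_def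
proof (intro conjI allI impI)
  note emb = open_embedding_chart[OF gen c, unfolded open_embedding_def]
  have "inj_on (S_tilde_pt \<alpha>) (range (chart \<alpha> c))"
    by (rule inj_onI) (use S_tilde_pt_eq_iff range_chart[OF c] in blast)
  then show "inj (S_tilde_pt \<alpha> \<circ> chart \<alpha> c)" using emb by (simp add: comp_inj_on)
  show "range (S_tilde_pt \<alpha> \<circ> chart \<alpha> c) \<subseteq> topspace (tp (init_space \<alpha>))"
    unfolding topspace_init_space image_comp[symmetric] by (intro image_mono range_chart[OF c])
  fix V
  show "openin (tp (init_space \<alpha>)) ((S_tilde_pt \<alpha> \<circ> chart \<alpha> c) ` V) = open V"
    unfolding image_comp[symmetric] openin_init_space[OF range_chart[OF c]] using emb by blast
  fix f assume "open V"
  then show "hol (init_space \<alpha>) ((S_tilde_pt \<alpha> \<circ> chart \<alpha> c) ` V) f =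
      holomorphic2_on (f \<circ> (S_tilde_pt \<alpha> \<circ> chart \<alpha> c)) V"
    unfolding image_comp[symmetric] hol_init_space[OF range_chart[OF c]] comp_assoc[symmetric]
    using emb by blast
qed

text \<open>Holomorphy is a pointwise condition, so at each point it can be tested on a plane
  containing it; the passage from that plane to the charts of the atlas is part of
  \<open>open_embedding_chart\<close>.\<close>

lemma hol_init_space_cover:
  assumes "\<And>c. c \<in> planes \<Longrightarrow> holomorphic2_on (f \<circ> (S_tilde_pt \<alpha> \<circ> chart \<alpha> c)) UNIV"
  shows "hol (init_space \<alpha>) (topspace (tp (init_space \<alpha>))) f"
proof -
  let ?g = "f \<circ> S_tilde_pt \<alpha>"
  have "hol (atlas_space (Bl2 \<alpha>)) (affine_part \<alpha>) ?g"
    unfolding hol_atlas_space_iff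
  proof (intro allI impI)
    fix W \<xi> assume W: "(W, \<xi>) \<in> Bl2 \<alpha>"
    then have opW: "open W" using regular_Bl2 unfolding regular_atlas_def by blast
    show "holomorphic2_on (?g \<circ> \<xi>) {z \<in> W. \<xi> z \<in> affine_part \<alpha>}"
      unfolding holomorphic2_on_iff
    proof
      fix z assume z: "z \<in> {z \<in> W. \<xi> z \<in> affine_part \<alpha>}"
      then obtain c where c: "c \<in> planes" "\<xi> z \<in> range (chart \<alpha> c)" unfolding affine_part_def by blast
      have "holomorphic2_on (?g \<circ> chart \<alpha> c) UNIV" using assms[OF c(1)] by (simp add: comp_assoc)
      then have "hol (atlas_space (Bl2 \<alpha>)) (range (chart \<alpha> c)) ?g"
        using open_embedding_chart[OF gen c(1)] unfolding open_embedding_def by blast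
      from hol_atlas_spaceD[OF this W]
      show "holo_at (?g \<circ> \<xi>) z" using z c unfolding holomorphic2_on_iff by blast
    qed
  qed
  then show ?thesis unfolding topspace_init_space using hol_init_space[OF subset_refl] by blast
qed

end

section \<open>The transition maps\<close>

text \<open>One family contains \<open>r_1\<close> to \<open>r_7\<close> and their inverses:
  exchanging \<open>s\<close> and \<open>t\<close> inverts the map, one of them being the value of
  \<open>q\<close> subtracted before, the other the value added after.\<close>

definition shear :: "complex \<Rightarrow> complex \<Rightarrow> complex \<Rightarrow> c2 \<Rightarrow> c2" where
  "shear s t a z = (t - (snd z * (fst z - s) - a) * snd z, 1 / snd z)"

definition base_flip :: "complex \<Rightarrow> c2 \<Rightarrow> c2" where
  "base_flip a z = (1 / fst z, - (fst z * snd z + a) * fst z)"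

definition shift :: "nat \<Rightarrow> complex" where
  "shift j = (if 4 \<le> j \<and> j \<le> 6 then 1 else 0)"

definition base_plane :: "nat \<Rightarrow> plane" where
  "base_plane j = (if j = 7 then XY 0 else QP)"

lemma rmap_0: "rmap \<alpha> 0 = base_flip (\<alpha> 0)"
  by (auto simp: rmap_def base_flip_def)

lemma nat_1_7:
  assumes "j \<in> {1..7 :: nat}"
  shows "j = 1 \<or> j = 2 \<or> j = 3 \<or> j = 4 \<or> j = 5 \<or> j = 6 \<or> j = 7"
  using assms by auto

lemma rmap_shear: "j \<in> {1..7} \<Longrightarrow> rmap \<alpha> j = shear (shift j) 0 (root_of \<alpha> j)"
  by (drule nat_1_7, elim disjE) (auto simp: fun_eq_iff rmap_def shear_def shift_def root_of_def algebra_simps)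

lemma shear_inverse: "snd z \<noteq> 0 \<Longrightarrow> shear t s a (shear s t a z) = z"
  by (cases z) (auto simp: shear_def field_simps)

lemma base_flip_inverse: "fst z \<noteq> 0 \<Longrightarrow> base_flip a (base_flip a z) = z"
  by (cases z) (auto simp: base_flip_def field_simps)

lemma r_rel_iff:
  "(x, y) \<in> r_rel \<alpha> \<longleftrightarrow>
     (\<exists>z. fst z \<noteq> 0 \<and> x = (QP, z) \<and> y = (XY 0, base_flip (\<alpha> 0) z)) \<or>
     (\<exists>j\<in>{1..7}. \<exists>z. snd z \<noteq> 0 \<and> x = (base_plane j, z) \<and> y = (XY j, shear (shift j) 0 (root_of \<alpha> j) z))"
    (is "_ \<longleftrightarrow> ?A \<or> ?B")
proof
  assume "(x, y) \<in> r_rel \<alpha>"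
  then consider j z where "j \<le> 6" "z \<in> r_dom j" "x = (QP, z)" "y = (XY j, rmap \<alpha> j z)"
    | z where "z \<in> r_dom 7" "x = (XY 0, z)" "y = (XY 7, rmap \<alpha> 7 z)"
    unfolding r_rel_def by blast
  then show "?A \<or> ?B"
  proof cases
    case (1 j z)
    show ?thesis
    proof (cases "j = 0")
      case True
      then show ?thesis using 1 by (auto simp: rmap_0 r_dom_def)
    next
      case False
      then have "j \<in> {1..7}" "base_plane j = QP" using 1(1) by (auto simp: base_plane_def)
      moreover have "snd z \<noteq> 0" using 1(2) False by (auto simp: r_dom_def)
      ultimately show ?thesis using 1 rmap_shear[of j \<alpha>] by metis
    qed
  next
    case (2 z)
    have "base_plane 7 = XY 0" "7 \<in> {1..7 :: nat}" by (auto simp: base_plane_def)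
    moreover have "snd z \<noteq> 0" using 2(1) by (auto simp: r_dom_def)
    ultimately show ?thesis using 2 rmap_shear[of 7 \<alpha>] by metis
  qed
next
  assume "?A \<or> ?B"
  then show "(x, y) \<in> r_rel \<alpha>"
  proof
    assume ?A
    then obtain z where z: "fst z \<noteq> 0" "x = (QP, z)" "y = (XY 0, rmap \<alpha> 0 z)" by (auto simp: rmap_0)
    then have "z \<in> r_dom 0" by (auto simp: r_dom_def)
    then show ?thesis unfolding r_rel_def using z by blast
  next
    assume ?B
    then obtain j z where j: "j \<in> {1..7}" and z: "snd z \<noteq> 0" "x = (base_plane j, z)"
      "y = (XY j, rmap \<alpha> j z)" using rmap_shear by metis
    have dom: "z \<in> r_dom j" using j z(1) by (auto simp: r_dom_def)
    show ?thesis
    proof (cases "j = 7")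
      case True
      then have "x = (XY 0, z)" "y = (XY 7, rmap \<alpha> 7 z)" "z \<in> r_dom 7"
        using z dom by (simp_all add: base_plane_def)
      then show ?thesis unfolding r_rel_def by blast
    next
      case False
      then have "j \<le> 6" "x = (QP, z)" using j z by (auto simp: base_plane_def)
      then show ?thesis unfolding r_rel_def using z(3) dom by blast
    qed
  qed
qed

lemma r_relI:
  "fst z \<noteq> 0 \<Longrightarrow> ((QP, z), (XY 0, base_flip (\<alpha> 0) z)) \<in> r_rel \<alpha>"
  "j \<in> {1..7} \<Longrightarrow> snd z \<noteq> 0 \<Longrightarrow>
    ((base_plane j, z), (XY j, shear (shift j) 0 (root_of \<alpha> j) z)) \<in> r_rel \<alpha>"
  unfolding r_rel_iff by blast+

lemma chart_base_flip:
  assumes "fst z \<noteq> 0" shows "chart \<alpha> (XY 0) z = chart \<alpha> QP (base_flip (\<alpha> 0) z)"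
  using assms by (cases z) (simp add: base_flip_def zw_eq_iff)

lemma chart_shear:
  assumes "j \<in> {1..7}" "snd z \<noteq> 0"
  shows "chart \<alpha> (XY j) z = chart \<alpha> (base_plane j) (shear 0 (shift j) (root_of \<alpha> j) z)"
proof -
  obtain x y where z: "z = (x, y)" by (cases z)
  have "shear 0 (shift j) (root_of \<alpha> j) z = (shift j + (root_of \<alpha> j - x * y) * y, 1 / y)"
    by (simp add: shear_def z algebra_simps)
  then show ?thesis using assms unfolding z chart_blowup[OF assms(1)]
    by (auto simp: shift_def base_plane_def)
qed

lemma chart_r_rel: "((c, z), (d, w)) \<in> r_rel \<alpha> \<Longrightarrow> chart \<alpha> c z = chart \<alpha> d w"
  unfolding r_rel_iff
proof (elim disjE exE bexE conjE)
  fix z' assume "fst z' \<noteq> 0" "(c, z) = (QP, z')" "(d, w) = (XY 0, base_flip (\<alpha> 0) z')"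
  then show ?thesis
    using chart_base_flip[of "base_flip (\<alpha> 0) z'" \<alpha>] by (simp add: base_flip_inverse) (simp add: base_flip_def)
next
  fix j z' assume "j \<in> {1..7}" "snd z' \<noteq> 0" "(c, z) = (base_plane j, z')"
    "(d, w) = (XY j, shear (shift j) 0 (root_of \<alpha> j) z')"
  moreover have "snd (shear (shift j) 0 (root_of \<alpha> j) z') \<noteq> 0"
    using \<open>snd z' \<noteq> 0\<close> by (simp add: shear_def)
  ultimately show ?thesis
    using chart_shear[of j "shear (shift j) 0 (root_of \<alpha> j) z'" \<alpha>] by (simp add: shear_inverse del: chart.simps)
qed

lemma ident_base_flip:
  assumes "fst z \<noteq> 0" shows "((XY 0, z), (QP, base_flip (\<alpha> 0) z)) \<in> ident (r_rel \<alpha>)"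
proof -
  have "fst (base_flip (\<alpha> 0) z) \<noteq> 0" using assms by (simp add: base_flip_def)
  then have "((QP, base_flip (\<alpha> 0) z), (XY 0, z)) \<in> r_rel \<alpha>"
    using r_relI(1)[of "base_flip (\<alpha> 0) z" \<alpha>] base_flip_inverse[OF assms] by simp
  then show ?thesis by (rule ident_sym[OF ident_base])
qed

lemma ident_shear:
  assumes "j \<in> {1..7}" "snd z \<noteq> 0"
  shows "((XY j, z), (base_plane j, shear 0 (shift j) (root_of \<alpha> j) z)) \<in> ident (r_rel \<alpha>)"
proof -
  have "snd (shear 0 (shift j) (root_of \<alpha> j) z) \<noteq> 0" using assms by (simp add: shear_def)
  then have "((base_plane j, shear 0 (shift j) (root_of \<alpha> j) z), (XY j, z)) \<in> r_rel \<alpha>"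
    using r_relI(2)[OF assms(1), of "shear 0 (shift j) (root_of \<alpha> j) z" \<alpha>] shear_inverse[OF assms(2)]
    by simp
  then show ?thesis by (rule ident_sym[OF ident_base])
qed

text \<open>A substitute for a normal form: in the planes 1 to 7, points with
  \<open>y \<noteq> 0\<close> move to \<open>QP\<close> or \<open>XY 0\<close>, and those with
  \<open>y = 0\<close> lie on a new exceptional line, where the chart remembers centre and
  direction.\<close>

lemma reduce_plane:
  assumes "c \<in> planes"
  obtains i z' where "i \<le> 1" "((c, z), (if i = 0 then QP else XY 0, z')) \<in> ident (r_rel \<alpha>)"
      "chart \<alpha> c z = Old (Old (zw \<alpha> i z'))"
    | j where "c = XY j" "j \<in> {1..7}" "snd z = 0"
      "chart \<alpha> c z = Exc (cpoint (second_center \<alpha> j)) (Some (- fst z))"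
  using assms
proof (cases rule: planes_cases)
  case 1
  then show ?thesis using that(1)[of 0 z] by (simp add: ident_refl)
next
  case 2
  then show ?thesis using that(1)[of 1 z] by (simp add: ident_refl)
next
  case (3 j)
  show ?thesis
  proof (cases "snd z = 0")
    case True
    have "chart \<alpha> (XY j) (fst z, snd z) = Exc (cpoint (second_center \<alpha> j)) (Some (- fst z))"
      unfolding chart_blowup[OF 3(2)] using True by simp
    then show ?thesis using that(2)[of j] 3 True by simp
  next
    case False
    let ?i = "if j = 7 then 1 else 0 :: nat"
    have b: "base_plane j = (if ?i = 0 then QP else XY 0)" by (simp add: base_plane_def)
    show ?thesis
      using that(1)[of ?i "shear 0 (shift j) (root_of \<alpha> j) z"] ident_shear[OF 3(2) False, of \<alpha>]
        chart_shear[OF 3(2) False, of \<alpha>] unfolding b 3(1) by (simp split: if_splits)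
  qed
qed

text \<open>Points are compared after moving them to the planes \<open>QP\<close> and
  \<open>XY 0\<close>, whose overlap is the base flip. Points on the new exceptional lines coincide
  only within one plane, because the centres are distinct.\<close>

lemma chart_eq_iff:
  assumes gen: "generic \<alpha>" and c: "c \<in> planes" and d: "d \<in> planes"
  shows "chart \<alpha> c z = chart \<alpha> d w \<longleftrightarrow> ((c, z), (d, w)) \<in> ident (r_rel \<alpha>)"
proof
  assume "((c, z), (d, w)) \<in> ident (r_rel \<alpha>)"
  then have "chart \<alpha> c z = chart \<alpha> (fst (d, w)) (snd (d, w))"
  proof (rule ident_induct)
    fix x y assume "(x, y) \<in> r_rel \<alpha>"
    then have "chart \<alpha> (fst x) (snd x) = chart \<alpha> (fst y) (snd y)"
      using chart_r_rel[of "fst x" "snd x" "fst y" "snd y" \<alpha>] by simp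
    then show "chart \<alpha> c z = chart \<alpha> (fst x) (snd x) \<Longrightarrow> chart \<alpha> c z = chart \<alpha> (fst y) (snd y)"
      "chart \<alpha> c z = chart \<alpha> (fst y) (snd y) \<Longrightarrow> chart \<alpha> c z = chart \<alpha> (fst x) (snd x)"
      by simp_all
  qed simp
  then show "chart \<alpha> c z = chart \<alpha> d w" by simp
next
  assume eq: "chart \<alpha> c z = chart \<alpha> d w"
  have affine: "((if i = 0 then QP else XY 0, z), (if k = 0 then QP else XY 0, w)) \<in> ident (r_rel \<alpha>)"
    if ik: "i \<le> 1" "k \<le> 1" and zw: "zw \<alpha> i z = zw \<alpha> k w" for i k z w
  proof -
    have flip: "((QP, z), (XY 0, w)) \<in> ident (r_rel \<alpha>)" if "zw \<alpha> 0 z = zw \<alpha> 1 w" for z w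
    proof -
      have "fst w \<noteq> 0 \<and> z = base_flip (\<alpha> 0) w"
        using that by (cases z; cases w) (auto simp: zw_eq_iff base_flip_def split: if_splits)
      then show ?thesis using ident_sym[OF ident_base_flip[of w \<alpha>]] by simp
    qed
    have "i = 0 \<or> i = 1" "k = 0 \<or> k = 1" using ik by auto
    then show ?thesis
      using zw injD[OF inj_zw, of \<alpha> i z w] flip[of z w] ident_sym[OF flip[of w z]]
      by (elim disjE) (auto intro: ident_refl)
  qed
  show "((c, z), (d, w)) \<in> ident (r_rel \<alpha>)"
  proof (cases rule: reduce_plane[OF c, of z \<alpha>])
    case (1 i z')
    show ?thesis
    proof (cases rule: reduce_plane[OF d, of w \<alpha>])
      case (1 k w')
      then have "zw \<alpha> i z' = zw \<alpha> k w'" using eq \<open>chart \<alpha> c z = Old (Old (zw \<alpha> i z'))\<close> by simp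
      then show ?thesis
        using affine[OF \<open>i \<le> 1\<close> 1(1)] ident_trans ident_sym[OF 1(2)]
          \<open>((c, z), (if i = 0 then QP else XY 0, z')) \<in> ident (r_rel \<alpha>)\<close> by meson
    next
      case 2
      then show ?thesis using 1(3) eq by simp
    qed
  next
    case (2 j)
    show ?thesis
    proof (cases rule: reduce_plane[OF d, of w \<alpha>])
      case 1
      then show ?thesis using 2(4) eq by simp
    next
      case (2 k)
      have "cpoint (second_center \<alpha> j) = cpoint (second_center \<alpha> k)" "fst z = fst w"
        using 2(4) \<open>chart \<alpha> c z = Exc (cpoint (second_center \<alpha> j)) _\<close> eq by simp_all
      then have "place_of j = place_of k \<and> root_of \<alpha> j = root_of \<alpha> k"
        by (simp add: cpoint_second_center cpoint_a_center_eq_iff)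
      then have "j = k"
        using root_of_eq_iff[OF _ _ _ _ _ _ \<open>j \<in> {1..7}\<close> 2(2), of \<alpha>] gen by (simp add: generic_def)
      moreover have "z = w" using \<open>fst z = fst w\<close> \<open>snd z = 0\<close> 2(3) by (simp add: prod_eq_iff)
      ultimately show ?thesis using \<open>c = XY j\<close> 2(1) by (simp add: ident_refl)
    qed
  qed
qed


section \<open>The Hamiltonian in the affine charts\<close>

text \<open>\<open>g\<close> and \<open>f3\<close> stand for
  \<open>\<gamma>2 - \<beta>2 - \<delta>\<close> and
  \<open>2 * \<kappa> * \<epsilon> + f2 + \<beta>3 + \<gamma>3\<close>. The coefficients are free
  variables, so that each expansion can assume just the relations that it uses.\<close>

definition ham :: "complex \<Rightarrow> complex \<Rightarrow> complex \<Rightarrow> complex \<Rightarrow> complex \<Rightarrow> complex \<Rightarrow> complex \<Rightarrow> complex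
    \<Rightarrow> complex \<Rightarrow> complex \<Rightarrow> complex \<Rightarrow> complex \<Rightarrow> complex" where
  "ham \<kappa> \<epsilon> \<delta> \<beta>1 \<beta>2 \<beta>3 g f2 f3 b q p =
     q^3 * (q - 1)^3 * p^4 + q^2 * (q - 1)^2 * (2 * \<kappa> * q + \<beta>1) * p^3
     + q * (q - 1) * (\<delta> * q^2 + g * q + \<beta>2) * p^2
     + (2 * \<kappa> * \<epsilon> * q^3 + f2 * q^2 - f3 * q + \<beta>3) * p + \<epsilon>^2 * q^2 + \<epsilon> * b * q"

text \<open>With \<open>e = q p\<close>, the Hamiltonian is a polynomial in \<open>e\<close> and \<open>q\<close> plus
  \<open>- (e - a) (e - o1) (e - o2) p\<close>, and \<open>e - a = - x y\<close> cancels the pole \<open>p = 1 / y\<close>. At \<open>q = 1\<close> the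
  same happens with \<open>e = (q - 1) p\<close>.\<close>

lemma ham_at_0:
  assumes e: "e = a - x * y" and q: "q = y * e" and p: "y * p = 1"
  shows "ham \<kappa> \<epsilon> \<delta> (a + o1 + o2) (a * o1 + a * o2 + o1 * o2) (a * o1 * o2) g f2 f3 b q p =
    x * (e - o1) * (e - o2)
    + e^4 * (q^2 - 3 * q + 3) + e^3 * (2 * \<kappa> * (q - 1)^2 + (a + o1 + o2) * (q - 2))
    + e^2 * (\<delta> * q^2 + (g - \<delta>) * q + (a * o1 + a * o2 + o1 * o2) - g)
    + e * (2 * \<kappa> * \<epsilon> * q^2 + f2 * q - f3) + \<epsilon>^2 * q^2 + \<epsilon> * b * q"
proof -
  have e': "e = q * p" using q p by (simp add: mult.commute mult.left_commute)
  have x: "x = - (e - a) * p" using e p by (simp add: mult.assoc)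
  show ?thesis unfolding x e' ham_def by (simp add: algebra_simps power_numeral_reduce)
qed

lemma ham_at_1:
  assumes e: "e = a - x * y" and r: "q = 1 + y * e" and p: "y * p = 1"
    and sum: "2 * \<kappa> + \<beta>1 + (a + o1 + o2) = 0" and g: "\<delta> + g + \<beta>2 = a * o1 + a * o2 + o1 * o2"
    and f3: "f3 = 2 * \<kappa> * \<epsilon> + f2 + \<beta>3 + a * o1 * o2"
  shows "ham \<kappa> \<epsilon> \<delta> \<beta>1 \<beta>2 \<beta>3 g f2 f3 b q p =
    - x * (e - o1) * (e - o2)
    + e^4 * (q^2 + q + 1) + e^3 * (2 * \<kappa> * q^2 + (2 * \<kappa> + \<beta>1) * (q + 1))
    + e^2 * (\<delta> * (q^2 + q + 1) + g * (q + 1) + \<beta>2)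
    + e * (2 * \<kappa> * \<epsilon> * (q^2 + q + 1) + f2 * (q + 1) - f3) + \<epsilon>^2 * q^2 + \<epsilon> * b * q"
proof -
  have e': "e = (q - 1) * p" using r p by (simp add: mult.commute mult.left_commute)
  have x: "x = - (e - a) * p" using e p by (simp add: mult.assoc)
  \<comment> \<open>At \<open>q = 1\<close> the factor of \<open>p\<close> is \<open>e^3 + (2 *
    \<kappa> + \<beta>1) * e^2 + (\<delta> + g + \<beta>2) * e + (2 * \<kappa> * \<epsilon> + f2 -
    f3 + \<beta>3)\<close>; the three relations say that its roots are \<open>a\<close>,
    \<open>o1\<close> and \<open>o2\<close>.\<close>
  have \<beta>1: "\<beta>1 = - 2 * \<kappa> - (a + o1 + o2)" using sum by (simp add: algebra_simps eq_neg_iff_add_eq_0)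
  have g': "g = a * o1 + a * o2 + o1 * o2 - \<delta> - \<beta>2" using g by (simp add: algebra_simps)
  show ?thesis unfolding x e' ham_def \<beta>1 g' f3 by (simp add: algebra_simps power_numeral_reduce)
qed

text \<open>In terms of \<open>e = q p\<close>, \<open>x = 1 / q\<close> and \<open>u = q (e\<^sup>2 + \<kappa> e + \<epsilon>)\<close> the Hamiltonian is a polynomial; the
  coefficients of \<open>q\<^sup>2\<close> and \<open>q\<close> are divisible by \<open>(e\<^sup>2 + \<kappa> e + \<epsilon>)\<^sup>2\<close> and \<open>e\<^sup>2 + \<kappa> e + \<epsilon>\<close>.\<close>

definition ham_infinity :: "complex \<Rightarrow> complex \<Rightarrow> complex \<Rightarrow> complex \<Rightarrow> complex \<Rightarrow> complex \<Rightarrow> complex \<Rightarrow> complex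
    \<Rightarrow> complex \<Rightarrow> complex \<Rightarrow> complex" where
  "ham_infinity \<kappa> \<beta>1 \<beta>2 \<beta>3 g f3 b x e u =
     u^2 + u * (- 3 * e^2 + (\<beta>1 - \<kappa>) * e + b)
     + 3 * e^4 + (2 * \<kappa> - 2 * \<beta>1) * e^3 + (\<beta>2 - g) * e^2 - f3 * e
     + x * (- (e^4) + \<beta>1 * e^3 - \<beta>2 * e^2 + \<beta>3 * e)"

text \<open>By the choice of \<open>\<kappa>\<close> and \<open>\<epsilon>\<close>,
  \<open>e^2 + \<kappa> * e + \<epsilon>\<close> factors as \<open>(e + a) * (e + a + c)\<close>,
  which is \<open>x * y * (x * y - c)\<close> in the new coordinates. Multiplying by
  \<open>q = 1 / x\<close> removes the factor \<open>x\<close>, so \<open>u\<close> is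
  polynomial.\<close>

lemma ham_at_infinity:
  assumes x: "x * q = 1" and p: "p = e * x" and e: "e = - (x * y + a)" and u: "u = y * (x * y - c)"
    and \<kappa>: "\<kappa> = 2 * a + c" and \<epsilon>: "\<epsilon> = a * (a + c)" and \<delta>: "\<delta> = \<kappa>^2 + 2 * \<epsilon>"
    and g: "g = h - \<delta>" and f2: "f2 = \<kappa> * h - \<kappa>^3 - 2 * \<kappa> * \<epsilon> - \<kappa>^2 * \<beta>1 + \<epsilon> * \<beta>1"
    and b: "b = h - \<kappa>^2 - \<epsilon> - \<kappa> * \<beta>1"
  shows "ham \<kappa> \<epsilon> \<delta> \<beta>1 \<beta>2 \<beta>3 g f2 f3 b q p = ham_infinity \<kappa> \<beta>1 \<beta>2 \<beta>3 g f3 b x e u"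
proof -
  have qp: "e = q * p" using x p by (simp add: mult.commute mult.left_commute)
  have u': "u = q * (e^2 + \<kappa> * e + \<epsilon>)"
  proof -
    have "e^2 + \<kappa> * e + \<epsilon> = x * y * (x * y - c)"
      unfolding e \<kappa> \<epsilon> by (simp add: algebra_simps power2_eq_square)
    then show ?thesis using u x by (simp add: mult.assoc[symmetric] mult.commute[of q])
  qed
  have p4: "q^3 * p^4 = x * e^4" "q^2 * p^3 = x * e^3" "q * p^2 = x * e^2"
    unfolding p using x by algebra+
  have "ham \<kappa> \<epsilon> \<delta> \<beta>1 \<beta>2 \<beta>3 g f2 f3 b q p =
     (q - 1)^3 * (q^3 * p^4) + (q - 1)^2 * (2 * \<kappa> * q + \<beta>1) * (q^2 * p^3)
     + (q - 1) * (\<delta> * q^2 + g * q + \<beta>2) * (q * p^2)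
     + (2 * \<kappa> * \<epsilon> * q^3 + f2 * q^2 - f3 * q + \<beta>3) * p + \<epsilon>^2 * q^2 + \<epsilon> * b * q"
    unfolding ham_def by (simp add: algebra_simps)
  \<comment> \<open>The choice of \<open>\<delta>\<close> makes the coefficient of
    \<open>q^2\<close> the square of \<open>e^2 + \<kappa> * e + \<epsilon>\<close>;
    \<open>g\<close>, \<open>f2\<close> and \<open>b\<close> make that of \<open>q\<close> its
    product with \<open>- 3 * e^2 + (\<beta>1 - \<kappa>) * e + b\<close>.\<close>
  also have "\<dots> = ham_infinity \<kappa> \<beta>1 \<beta>2 \<beta>3 g f3 b x e u"
    unfolding p4 p ham_infinity_def u' g f2 b \<delta> using x by algebra
  finally show ?thesis .
qed

lemma hamiltonian_parameters:
  obtains \<kappa> \<epsilon> \<delta> \<beta>1 \<beta>2 \<beta>3 g f2 f3 b \<gamma>2 \<gamma>3 where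
    "\<forall>q p. hamiltonian \<alpha> (q, p) = ham \<kappa> \<epsilon> \<delta> \<beta>1 \<beta>2 \<beta>3 g f2 f3 b q p"
    "\<kappa> = 2 * \<alpha> 0 + \<alpha> 7" "\<epsilon> = \<alpha> 0 * (\<alpha> 0 + \<alpha> 7)" "\<delta> = \<kappa>^2 + 2 * \<epsilon>"
    "\<beta>1 = root_of \<alpha> 1 + root_of \<alpha> 2 + root_of \<alpha> 3"
    "\<beta>2 = root_of \<alpha> 1 * root_of \<alpha> 2 + root_of \<alpha> 1 * root_of \<alpha> 3 + root_of \<alpha> 2 * root_of \<alpha> 3"
    "\<beta>3 = root_of \<alpha> 1 * root_of \<alpha> 2 * root_of \<alpha> 3"
    "\<gamma>2 = root_of \<alpha> 4 * root_of \<alpha> 5 + root_of \<alpha> 4 * root_of \<alpha> 6 + root_of \<alpha> 5 * root_of \<alpha> 6"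
    "\<gamma>3 = root_of \<alpha> 4 * root_of \<alpha> 5 * root_of \<alpha> 6"
    "g = (\<gamma>2 - \<beta>2) - \<delta>" "f3 = 2 * \<kappa> * \<epsilon> + f2 + \<beta>3 + \<gamma>3"
    "f2 = \<kappa> * (\<gamma>2 - \<beta>2) - \<kappa>^3 - 2 * \<kappa> * \<epsilon> - \<kappa>^2 * \<beta>1 + \<epsilon> * \<beta>1"
    "b = (\<gamma>2 - \<beta>2) - \<kappa>^2 - \<epsilon> - \<kappa> * \<beta>1"
proof -
  show ?thesis
    by (rule that[OF _ refl refl refl refl refl refl refl refl refl refl refl refl])
      (simp add: hamiltonian_def ham_def Let_def elem1_def elem2_def elem3_def root_of_def)
qed

text \<open>The extension is written as a function of \<open>e\<close> and \<open>q\<close> applied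
  to their expressions in \<open>(x, y)\<close>, so that it matches the expansion and is visibly
  polynomial.\<close>

lemma ham_extends_at_0:
  assumes "\<beta>1 = a + o1 + o2" "\<beta>2 = a * o1 + a * o2 + o1 * o2" "\<beta>3 = a * o1 * o2"
  shows "\<exists>G. (\<forall>z. holo_at G z) \<and> (\<forall>z. snd z \<noteq> 0 \<longrightarrow>
    ham \<kappa> \<epsilon> \<delta> \<beta>1 \<beta>2 \<beta>3 g f2 f3 b (fst (shear 0 0 a z)) (snd (shear 0 0 a z)) = G z)"
proof (intro exI conjI allI impI)
  fix z :: c2 assume z: "snd z \<noteq> 0"
  show "ham \<kappa> \<epsilon> \<delta> \<beta>1 \<beta>2 \<beta>3 g f2 f3 b (fst (shear 0 0 a z)) (snd (shear 0 0 a z)) =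
    (\<lambda>z. (\<lambda>e q. fst z * (e - o1) * (e - o2)
      + e^4 * (q^2 - 3 * q + 3) + e^3 * (2 * \<kappa> * (q - 1)^2 + (a + o1 + o2) * (q - 2))
      + e^2 * (\<delta> * q^2 + (g - \<delta>) * q + (a * o1 + a * o2 + o1 * o2) - g)
      + e * (2 * \<kappa> * \<epsilon> * q^2 + f2 * q - f3) + \<epsilon>^2 * q^2 + \<epsilon> * b * q)
      (a - fst z * snd z) (snd z * (a - fst z * snd z))) z"
  proof -
    have q: "fst (shear 0 0 a z) = snd z * (a - fst z * snd z)"
      and p: "snd z * snd (shear 0 0 a z) = 1"
      using z by (simp_all add: shear_def algebra_simps)
    show ?thesis unfolding assms q by (rule ham_at_0[OF refl refl p])
  qed
qed (intro holo_intros)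

lemma ham_extends_at_1:
  assumes sum: "2 * \<kappa> + \<beta>1 + (a + o1 + o2) = 0" and g: "\<delta> + g + \<beta>2 = a * o1 + a * o2 + o1 * o2"
    and f3: "f3 = 2 * \<kappa> * \<epsilon> + f2 + \<beta>3 + a * o1 * o2"
  shows "\<exists>G. (\<forall>z. holo_at G z) \<and> (\<forall>z. snd z \<noteq> 0 \<longrightarrow>
    ham \<kappa> \<epsilon> \<delta> \<beta>1 \<beta>2 \<beta>3 g f2 f3 b (fst (shear 0 1 a z)) (snd (shear 0 1 a z)) = G z)"
proof (intro exI conjI allI impI)
  fix z :: c2 assume z: "snd z \<noteq> 0"
  show "ham \<kappa> \<epsilon> \<delta> \<beta>1 \<beta>2 \<beta>3 g f2 f3 b (fst (shear 0 1 a z)) (snd (shear 0 1 a z)) =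
    (\<lambda>z. (\<lambda>e q. - fst z * (e - o1) * (e - o2)
      + e^4 * (q^2 + q + 1) + e^3 * (2 * \<kappa> * q^2 + (2 * \<kappa> + \<beta>1) * (q + 1))
      + e^2 * (\<delta> * (q^2 + q + 1) + g * (q + 1) + \<beta>2)
      + e * (2 * \<kappa> * \<epsilon> * (q^2 + q + 1) + f2 * (q + 1) - f3) + \<epsilon>^2 * q^2 + \<epsilon> * b * q)
      (a - fst z * snd z) (1 + snd z * (a - fst z * snd z))) z"
  proof -
    have q: "fst (shear 0 1 a z) = 1 + snd z * (a - fst z * snd z)"
      and p: "snd z * snd (shear 0 1 a z) = 1"
      using z by (simp_all add: shear_def algebra_simps)
    show ?thesis unfolding q by (rule ham_at_1[OF refl refl p assms])
  qed
qed (intro holo_intros)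

text \<open>Composing with the inverse of \<open>r_j\<close> gives the right values only where it
  has no pole; elsewhere division by zero would yield a default value. Hence \<open>K\<close> is
  built from polynomial extensions.\<close>

lemma chart_hamiltonians:
  assumes sum: "4 * \<alpha> 0 + 3 * \<alpha> 1 + 2 * \<alpha> 2 + \<alpha> 3 + 3 * \<alpha> 4 + 2 * \<alpha> 5 + \<alpha> 6 + 2 * \<alpha> 7 = 0"
  obtains K where "K QP = hamiltonian \<alpha>" "\<And>c z. c \<in> planes \<Longrightarrow> holo_at (K c) z"
    "\<And>z. fst z \<noteq> 0 \<Longrightarrow> K QP (base_flip (\<alpha> 0) z) = K (XY 0) z"
    "\<And>j z. j \<in> {1..7} \<Longrightarrow> snd z \<noteq> 0 \<Longrightarrow>
       K (base_plane j) (shear 0 (shift j) (root_of \<alpha> j) z) = K (XY j) z"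
proof -
  obtain \<kappa> \<epsilon> \<delta> \<beta>1 \<beta>2 \<beta>3 g f2 f3 b \<gamma>2 \<gamma>3 where
    I: "\<forall>q p. hamiltonian \<alpha> (q, p) = ham \<kappa> \<epsilon> \<delta> \<beta>1 \<beta>2 \<beta>3 g f2 f3 b q p" and
    \<kappa>: "\<kappa> = 2 * \<alpha> 0 + \<alpha> 7" and \<epsilon>: "\<epsilon> = \<alpha> 0 * (\<alpha> 0 + \<alpha> 7)" and \<delta>: "\<delta> = \<kappa>^2 + 2 * \<epsilon>" and
    \<beta>: "\<beta>1 = root_of \<alpha> 1 + root_of \<alpha> 2 + root_of \<alpha> 3"
    "\<beta>2 = root_of \<alpha> 1 * root_of \<alpha> 2 + root_of \<alpha> 1 * root_of \<alpha> 3 + root_of \<alpha> 2 * root_of \<alpha> 3"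
    "\<beta>3 = root_of \<alpha> 1 * root_of \<alpha> 2 * root_of \<alpha> 3" and
    \<gamma>: "\<gamma>2 = root_of \<alpha> 4 * root_of \<alpha> 5 + root_of \<alpha> 4 * root_of \<alpha> 6 + root_of \<alpha> 5 * root_of \<alpha> 6"
    "\<gamma>3 = root_of \<alpha> 4 * root_of \<alpha> 5 * root_of \<alpha> 6" and
    g: "g = (\<gamma>2 - \<beta>2) - \<delta>" and f3: "f3 = 2 * \<kappa> * \<epsilon> + f2 + \<beta>3 + \<gamma>3" and
    f2: "f2 = \<kappa> * (\<gamma>2 - \<beta>2) - \<kappa>^3 - 2 * \<kappa> * \<epsilon> - \<kappa>^2 * \<beta>1 + \<epsilon> * \<beta>1" and
    b: "b = (\<gamma>2 - \<beta>2) - \<kappa>^2 - \<epsilon> - \<kappa> * \<beta>1"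
    by (rule hamiltonian_parameters[of \<alpha>])
  have I': "hamiltonian \<alpha> z = ham \<kappa> \<epsilon> \<delta> \<beta>1 \<beta>2 \<beta>3 g f2 f3 b (fst z) (snd z)" for z
    using I[rule_format, of "fst z" "snd z"] by simp
  define K0 where "K0 z = ham_infinity \<kappa> \<beta>1 \<beta>2 \<beta>3 g f3 b (fst z) (- (fst z * snd z + \<alpha> 0))
      (snd z * (fst z * snd z - \<alpha> 7))" for z
  have K0: "hamiltonian \<alpha> (base_flip (\<alpha> 0) z) = K0 z" if "fst z \<noteq> 0" for z
    unfolding I' K0_def
    by (rule ham_at_infinity[OF _ _ refl refl \<kappa> \<epsilon> \<delta> g f2 b])
      (use that in \<open>simp_all add: base_flip_def\<close>)
  have holo0: "holo_at K0 z" for z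
    unfolding K0_def ham_infinity_def by (intro holo_intros)
  have holoI: "holo_at (hamiltonian \<alpha>) z" for z
    unfolding I' ham_def by (intro holo_intros)
  \<comment> \<open>Twice \<open>\<kappa>\<close> plus the sums of the roots over 0 and over 1: this
    is the linear relation between the parameters.\<close>
  have S: "2 * \<kappa> + \<beta>1 + (root_of \<alpha> 4 + root_of \<alpha> 5 + root_of \<alpha> 6) = 0"
    using sum by (simp add: \<kappa> \<beta> root_of_def algebra_simps)
  have "\<exists>G. (\<forall>z. holo_at G z) \<and>
      (\<forall>z. snd z \<noteq> 0 \<longrightarrow> hamiltonian \<alpha> (shear 0 (shift j) (root_of \<alpha> j) z) = G z)"
    if "j \<in> {1..7}" "j \<noteq> 7" for j
  proof -
    \<comment> \<open>Elementary symmetric functions ignore the order of the roots, so any of the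
      three can be the blown-up one, with \<open>k\<close> and \<open>l\<close> the other
      two.\<close>
    have 1: "\<exists>G. (\<forall>z. holo_at G z) \<and> (\<forall>z. snd z \<noteq> 0 \<longrightarrow> hamiltonian \<alpha> (shear 0 0 (root_of \<alpha> j) z) = G z)"
      if "(j, k, l) = (1, 2, 3) \<or> (j, k, l) = (2, 1, 3) \<or> (j, k, l) = (3, 1, 2)" for j k l :: nat
      unfolding I' by (rule ham_extends_at_0[of _ _ "root_of \<alpha> k" "root_of \<alpha> l"])
        (use that in \<open>auto simp: \<beta> algebra_simps\<close>)
    have 2: "\<exists>G. (\<forall>z. holo_at G z) \<and> (\<forall>z. snd z \<noteq> 0 \<longrightarrow> hamiltonian \<alpha> (shear 0 1 (root_of \<alpha> j) z) = G z)"
      if "(j, k, l) = (4, 5, 6) \<or> (j, k, l) = (5, 4, 6) \<or> (j, k, l) = (6, 4, 5)" for j k l :: nat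
      unfolding I' by (rule ham_extends_at_1[of _ _ _ "root_of \<alpha> k" "root_of \<alpha> l"])
        (use that S in \<open>auto simp: g f3 \<gamma> algebra_simps\<close>)
    have "j = 1 \<or> j = 2 \<or> j = 3 \<or> j = 4 \<or> j = 5 \<or> j = 6" using nat_1_7[OF that(1)] that(2) by blast
    moreover have "shift j = (if j \<le> 3 then 0 else 1)" using that by (auto simp: shift_def)
    ultimately show ?thesis
      using 1[of j 2 3] 1[of j 1 3] 1[of j 1 2] 2[of j 5 6] 2[of j 4 6] 2[of j 4 5]
      by (elim disjE) simp_all
  qed
  \<comment> \<open>At the seventh centre \<open>x_0 * y_0 - \<alpha> 7\<close> equals
    \<open>- x * y\<close> and \<open>y_0\<close> is \<open>1 / y\<close>, so the pole cancels and
    \<open>u\<close> becomes \<open>- x\<close>.\<close>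
  moreover have "\<exists>G. (\<forall>z. holo_at G z) \<and> (\<forall>z. snd z \<noteq> 0 \<longrightarrow> K0 (shear 0 0 (\<alpha> 7) z) = G z)"
  proof (intro exI conjI allI impI)
    fix z :: c2 assume z: "snd z \<noteq> 0"
    have "fst (shear 0 0 (\<alpha> 7) z) * snd (shear 0 0 (\<alpha> 7) z) = \<alpha> 7 - fst z * snd z"
      "fst (shear 0 0 (\<alpha> 7) z) = snd z * (\<alpha> 7 - fst z * snd z)" "snd (shear 0 0 (\<alpha> 7) z) = 1 / snd z"
      using z by (simp_all add: shear_def algebra_simps)
    then show "K0 (shear 0 0 (\<alpha> 7) z) =
        (\<lambda>z. ham_infinity \<kappa> \<beta>1 \<beta>2 \<beta>3 g f3 b (snd z * (\<alpha> 7 - fst z * snd z))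
          (- (\<alpha> 7 - fst z * snd z + \<alpha> 0)) (- fst z)) z"
      using z by (simp add: K0_def)
  qed (unfold ham_infinity_def, intro holo_intros)
  ultimately have "\<forall>j\<in>{1..7}. \<exists>G. (\<forall>z. holo_at G z) \<and>
      (\<forall>z. snd z \<noteq> 0 \<longrightarrow> (if j = 7 then K0 else hamiltonian \<alpha>) (shear 0 (shift j) (root_of \<alpha> j) z) = G z)"
    by (auto simp: shift_def root_of_def)
  then obtain G where G: "\<And>j z. j \<in> {1..7} \<Longrightarrow> holo_at (G j) z"
    "\<And>j z. j \<in> {1..7} \<Longrightarrow> snd z \<noteq> 0 \<Longrightarrow>
       (if j = 7 then K0 else hamiltonian \<alpha>) (shear 0 (shift j) (root_of \<alpha> j) z) = G j z"
    unfolding bchoice_iff by blast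
  define K where "K c = (case c of QP \<Rightarrow> hamiltonian \<alpha> | XY j \<Rightarrow> if j = 0 then K0 else G j)" for c
  have "K (base_plane j) (shear 0 (shift j) (root_of \<alpha> j) z) = K (XY j) z"
    if "j \<in> {1..7}" "snd z \<noteq> 0" for j z
    using G(2)[OF that] that(1) by (simp add: K_def base_plane_def split: if_splits)
  moreover have "holo_at (K c) z" if "c \<in> planes" for c z
    using that by (cases rule: planes_cases) (use holoI holo0 G(1) in \<open>auto simp: K_def\<close>)
  ultimately show ?thesis
    using that[of K] K0 by (simp add: K_def)
qed


section \<open>Symplectic transformations and the Hamiltonian system\<close>

definition symplectic_at :: "(c2 \<Rightarrow> c2) \<Rightarrow> c2 \<Rightarrow> bool" where
  "symplectic_at F z \<longleftrightarrow> (\<exists>a b c d.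
     (F has_derivative (\<lambda>v. (a * fst v + b * snd v, c * fst v + d * snd v))) (at z) \<and>
     a * d - b * c = 1)"

lemma symplectic_on_iff: "symplectic_on D F \<longleftrightarrow> (\<forall>z\<in>D. symplectic_at F z)"
  by (simp add: symplectic_on_def symplectic_at_def case_prod_unfold)

lemma symplectic_shear:
  assumes "snd z \<noteq> 0" shows "symplectic_at (shear s t a) z"
  unfolding symplectic_at_def
proof (intro exI conjI)
  have "((\<lambda>z. (t - (snd z * (fst z - s) - a) * snd z, 1 / snd z)) has_derivative
    (\<lambda>v. ((- ((snd z)^2)) * fst v + (a - 2 * snd z * (fst z - s)) * snd v, 0 * fst v + (- 1 / (snd z)^2) * snd v))) (at z)"
    using assms
    by (auto intro!: derivative_eq_intros simp: algebra_simps power2_eq_square divide_simps)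
  then show "(shear s t a has_derivative
    (\<lambda>v. ((- ((snd z)^2)) * fst v + (a - 2 * snd z * (fst z - s)) * snd v, 0 * fst v + (- 1 / (snd z)^2) * snd v))) (at z)"
    unfolding shear_def[abs_def] .
  show "(- ((snd z)^2)) * (- 1 / (snd z)^2) - (a - 2 * snd z * (fst z - s)) * 0 = 1" using assms by simp
qed

lemma symplectic_base_flip:
  assumes "fst z \<noteq> 0" shows "symplectic_at (base_flip a) z"
  unfolding symplectic_at_def
proof (intro exI conjI)
  have "((\<lambda>z. (1 / fst z, - (fst z * snd z + a) * fst z)) has_derivative
    (\<lambda>v. ((- 1 / (fst z)^2) * fst v + 0 * snd v, (- 2 * fst z * snd z - a) * fst v + (- ((fst z)^2)) * snd v))) (at z)"
    using assms
    by (auto intro!: derivative_eq_intros simp: algebra_simps power2_eq_square divide_simps)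
  then show "(base_flip a has_derivative
    (\<lambda>v. ((- 1 / (fst z)^2) * fst v + 0 * snd v, (- 2 * fst z * snd z - a) * fst v + (- ((fst z)^2)) * snd v))) (at z)"
    unfolding base_flip_def[abs_def] .
  show "(- 1 / (fst z)^2) * (- ((fst z)^2)) - 0 * (- 2 * fst z * snd z - a) = 1" using assms by simp
qed

section \<open>Transport of Hamilton's equations\<close>

lemma deriv_partial:
  assumes "(H has_derivative (\<lambda>v. a * fst v + b * snd v)) (at z)"
  shows "deriv (\<lambda>x. H (x, snd z)) (fst z) = a" "deriv (\<lambda>y. H (fst z, y)) (snd z) = b"
proof -
  have "((\<lambda>x. (x, snd z)) has_derivative (\<lambda>h. (h, 0))) (at (fst z))"
    "((\<lambda>y. (fst z, y)) has_derivative (\<lambda>h. (0, h))) (at (snd z))"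
    by (auto intro!: derivative_eq_intros)
  note pair = this
  have H: "(H has_derivative (\<lambda>v. a * fst v + b * snd v)) (at (fst z, snd z))"
    using assms by simp
  have "((\<lambda>x. H (x, snd z)) has_derivative (\<lambda>h. a * h)) (at (fst z))"
    "((\<lambda>y. H (fst z, y)) has_derivative (\<lambda>h. b * h)) (at (snd z))"
    using has_derivative_compose[OF pair(1) H] has_derivative_compose[OF pair(2) H] by simp_all
  then show "deriv (\<lambda>x. H (x, snd z)) (fst z) = a" "deriv (\<lambda>y. H (fst z, y)) (snd z) = b"
    by (intro DERIV_imp_deriv, simp add: has_field_derivative_def)+
qed

definition solves_at :: "(c2 \<Rightarrow> complex) \<Rightarrow> complex \<Rightarrow> (complex \<Rightarrow> c2) \<Rightarrow> bool" where
  "solves_at H t \<gamma> \<longleftrightarrow>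
     ((\<lambda>s. fst (\<gamma> s)) has_field_derivative deriv (\<lambda>y. H (fst (\<gamma> t), y)) (snd (\<gamma> t))) (at t) \<and>
     ((\<lambda>s. snd (\<gamma> s)) has_field_derivative - deriv (\<lambda>x. H (x, snd (\<gamma> t))) (fst (\<gamma> t))) (at t)"

lemma solves_on_iff: "solves_on H T \<gamma> \<longleftrightarrow> (\<forall>t\<in>T. solves_at H t \<gamma>)"
  by (simp add: solves_on_def solves_at_def)

lemma solves_at_isCont:
  assumes "solves_at H t \<gamma>" shows "isCont \<gamma> t"
proof -
  have "isCont (\<lambda>s. (fst (\<gamma> s), snd (\<gamma> s))) t"
    using assms unfolding solves_at_def by (intro isCont_Pair DERIV_isCont) blast+
  then show ?thesis by simp
qed

lemma solves_at_eventually: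
  assumes "solves_at H t \<gamma>" "open U" "\<gamma> t \<in> U" shows "\<forall>\<^sub>F s in nhds t. \<gamma> s \<in> U"
  using solves_at_isCont[OF assms(1)] assms(2,3)
  unfolding isCont_def tendsto_at_iff_tendsto_nhds by (auto dest: topological_tendstoD)

text \<open>By the chain rule the differential of \<open>F\<close> carries the Hamiltonian vector
  field of \<open>K \<circ> F\<close> to the determinant times that of \<open>K\<close>, and the
  determinant is 1. Only germs matter: \<open>H\<close> is \<open>K \<circ> F\<close> near
  \<open>\<gamma> t\<close>, and \<open>\<eta>\<close> is \<open>F \<circ> \<gamma>\<close> near
  \<open>t\<close>.\<close>

lemma solves_at_transport:
  assumes sol: "solves_at H t \<gamma>" and F: "symplectic_at F (\<gamma> t)" and K: "holo_at K (F (\<gamma> t))"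
    and U: "open U" "\<gamma> t \<in> U" "\<And>w. w \<in> U \<Longrightarrow> H w = K (F w)"
    and \<eta>: "\<forall>\<^sub>F s in nhds t. \<eta> s = F (\<gamma> s)"
  shows "solves_at K t \<eta>"
proof -
  obtain a b c d where
    F': "(F has_derivative (\<lambda>v. (a * fst v + b * snd v, c * fst v + d * snd v))) (at (\<gamma> t))"
    and det: "a * d - b * c = 1" using F unfolding symplectic_at_def by blast
  obtain A B where K': "(K has_derivative (\<lambda>v. A * fst v + B * snd v)) (at (F (\<gamma> t)))"
    using K unfolding holo_at_def by blast
  have "((\<lambda>w. K (F w)) has_derivative (\<lambda>v. (A * a + B * c) * fst v + (A * b + B * d) * snd v)) (at (\<gamma> t))"
    using has_derivative_compose[OF F' K'] by (simp add: algebra_simps)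
  then have H': "(H has_derivative (\<lambda>v. (A * a + B * c) * fst v + (A * b + B * d) * snd v)) (at (\<gamma> t))"
    by (rule has_derivative_transform_within_open[OF _ U(1,2)]) (simp add: U(3))
  have "((\<lambda>s. fst (\<gamma> s)) has_derivative (\<lambda>h. (A * b + B * d) * h)) (at t)"
    "((\<lambda>s. snd (\<gamma> s)) has_derivative (\<lambda>h. - (A * a + B * c) * h)) (at t)"
    using sol unfolding solves_at_def deriv_partial[OF H'] has_field_derivative_def by blast+
  from has_derivative_Pair[OF this]
  have \<gamma>': "(\<gamma> has_derivative (\<lambda>h. ((A * b + B * d) * h, - (A * a + B * c) * h))) (at t)" by simp
  have "((\<lambda>s. F (\<gamma> s)) has_derivative (\<lambda>h. (B * h, - A * h))) (at t)"
  proof -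
    have "a * ((A * b + B * d) * h) + b * (- (A * a + B * c) * h) = B * h * (a * d - b * c)"
      "c * ((A * b + B * d) * h) + d * (- (A * a + B * c) * h) = - A * h * (a * d - b * c)" for h
      by (simp_all add: algebra_simps)
    then show ?thesis using has_derivative_compose[OF \<gamma>' F'] by (simp add: det)
  qed
  then have \<eta>': "(\<eta> has_derivative (\<lambda>h. (B * h, - A * h))) (at t)"
  proof (rule has_derivative_transform_eventually)
    show "\<forall>\<^sub>F s in at t. F (\<gamma> s) = \<eta> s"
      using \<eta> unfolding eventually_at_filter by eventually_elim simp
    show "F (\<gamma> t) = \<eta> t" using eventually_nhds_x_imp_x[OF \<eta>] ..
  qed simp
  have "\<eta> t = F (\<gamma> t)" using eventually_nhds_x_imp_x[OF \<eta>] .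
  then have K'': "(K has_derivative (\<lambda>v. A * fst v + B * snd v)) (at (\<eta> t))" using K' by simp
  show ?thesis
    using has_derivative_fst[OF \<eta>'] has_derivative_snd[OF \<eta>']
    unfolding solves_at_def deriv_partial[OF K''] has_field_derivative_def
    by (simp only: fst_conv snd_conv simp_thms)
qed

text \<open>A link of a chain in \<open>ident (r_rel \<alpha>)\<close>, strengthened from a pair of
  points to a map on a neighbourhood that respects the charts, the Hamiltonians and the area
  form.\<close>

definition step :: "(nat \<Rightarrow> complex) \<Rightarrow> (plane \<Rightarrow> c2 \<Rightarrow> complex) \<Rightarrow> plane \<times> c2 \<Rightarrow> plane \<times> c2 \<Rightarrow> bool" where
  "step \<alpha> K = (\<lambda>(c, z) (d, w). d \<in> planes \<and> (\<exists>F U. open U \<and> z \<in> U \<and> w = F z \<and>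
     (\<forall>u\<in>U. chart \<alpha> c u = chart \<alpha> d (F u) \<and> K c u = K d (F u) \<and> symplectic_at F u)))"

lemma stepI:
  assumes "d \<in> planes" "open U" "z \<in> U" "w = F z"
    "\<And>u. u \<in> U \<Longrightarrow> chart \<alpha> c u = chart \<alpha> d (F u)" "\<And>u. u \<in> U \<Longrightarrow> K c u = K d (F u)"
    "\<And>u. u \<in> U \<Longrightarrow> symplectic_at F u"
  shows "step \<alpha> K (c, z) (d, w)"
  using assms unfolding step_def by blast

locale hamiltonian_charts =
  fixes \<alpha> :: "nat \<Rightarrow> complex" and K :: "plane \<Rightarrow> c2 \<Rightarrow> complex"
  assumes gen: "generic \<alpha>"
    and holo: "\<And>c z. c \<in> planes \<Longrightarrow> holo_at (K c) z"
    and flip: "\<And>z. fst z \<noteq> 0 \<Longrightarrow> K QP (base_flip (\<alpha> 0) z) = K (XY 0) z"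
    and shear: "\<And>j z. j \<in> {1..7} \<Longrightarrow> snd z \<noteq> 0 \<Longrightarrow>
      K (base_plane j) (shear 0 (shift j) (root_of \<alpha> j) z) = K (XY j) z"
begin

lemma step_r_rel:
  assumes "(x, y) \<in> r_rel \<alpha>" shows "step \<alpha> K x y \<and> step \<alpha> K y x"
  using assms unfolding r_rel_iff
proof (elim disjE exE bexE conjE)
  fix z assume z: "fst z \<noteq> 0" and x: "x = (QP, z)" and y: "y = (XY 0, base_flip (\<alpha> 0) z)"
  have nz: "fst (base_flip (\<alpha> 0) u) \<noteq> 0" if "fst u \<noteq> 0" for u
    using that by (simp add: base_flip_def)
  have "step \<alpha> K x y" unfolding x y
  proof (rule stepI[where F = "base_flip (\<alpha> 0)"])
    fix u :: c2 assume "u \<in> {u. fst u \<noteq> 0}"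
    then have u: "fst u \<noteq> 0" by simp
    show "chart \<alpha> QP u = chart \<alpha> (XY 0) (base_flip (\<alpha> 0) u)"
      unfolding chart_base_flip[OF nz[OF u]] base_flip_inverse[OF u] ..
    show "K QP u = K (XY 0) (base_flip (\<alpha> 0) u)"
      using flip[OF nz[OF u]] unfolding base_flip_inverse[OF u] by (simp only:)
  qed (use z open_coord_neq(1) symplectic_base_flip in \<open>auto simp: planes_def\<close>)
  moreover have "step \<alpha> K y x" unfolding x y
    by (rule stepI[where F = "base_flip (\<alpha> 0)" and U = "{u. fst u \<noteq> 0}"])
      (use z nz open_coord_neq(1) symplectic_base_flip flip chart_base_flip base_flip_inverse
        in \<open>auto simp: planes_def simp del: chart.simps\<close>)
  ultimately show ?thesis ..
next
  fix j z assume j: "j \<in> {1..7}" and z: "snd z \<noteq> 0" and x: "x = (base_plane j, z)"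
    and y: "y = (XY j, shear (shift j) 0 (root_of \<alpha> j) z)"
  have mem: "base_plane j \<in> planes" "XY j \<in> planes" using j by (auto simp: base_plane_def planes_def)
  have nz: "snd (shear s t a u) \<noteq> 0" if "snd u \<noteq> 0" for s t a u
    using that by (simp add: shear_def)
  have "step \<alpha> K x y" unfolding x y
  proof (rule stepI[where F = "shear (shift j) 0 (root_of \<alpha> j)"])
    fix u :: c2 assume "u \<in> {u. snd u \<noteq> 0}"
    then have u: "snd u \<noteq> 0" by simp
    show "chart \<alpha> (base_plane j) u = chart \<alpha> (XY j) (shear (shift j) 0 (root_of \<alpha> j) u)"
      unfolding chart_shear[OF j nz[OF u]] shear_inverse[OF u] ..
    show "K (base_plane j) u = K (XY j) (shear (shift j) 0 (root_of \<alpha> j) u)"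
      using shear[OF j nz[OF u, of "shift j" 0 "root_of \<alpha> j"]] unfolding shear_inverse[OF u] .
  qed (use z mem open_coord_neq(2) symplectic_shear in auto)
  moreover have "step \<alpha> K y x" unfolding x y
    by (rule stepI[where F = "shear 0 (shift j) (root_of \<alpha> j)" and U = "{u. snd u \<noteq> 0}"])
      (use z mem nz open_coord_neq(2) symplectic_shear shear[OF j] chart_shear[OF j] shear_inverse
        in \<open>auto simp del: chart.simps\<close>)
  ultimately show ?thesis ..
qed

lemma ident_step_induct:
  assumes "((c, z), (d, w)) \<in> ident (r_rel \<alpha>)" "P c z"
    "\<And>c z d w. step \<alpha> K (c, z) (d, w) \<Longrightarrow> P c z \<Longrightarrow> P d w"
  shows "P d w"
proof -
  have "P (fst (d, w)) (snd (d, w))"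
  proof (rule ident_induct[OF assms(1), where P = "\<lambda>x. P (fst x) (snd x)"])
    fix x y assume "(x, y) \<in> r_rel \<alpha>"
    from step_r_rel[OF this] show "P (fst x) (snd x) \<Longrightarrow> P (fst y) (snd y)"
      "P (fst y) (snd y) \<Longrightarrow> P (fst x) (snd x)"
      using assms(3)[of "fst x" "snd x" "fst y" "snd y"] assms(3)[of "fst y" "snd y" "fst x" "snd x"]
      by auto
  qed (use assms(2) in simp)
  then show ?thesis by simp
qed

text \<open>Compatibility is assumed for single maps \<open>r_j\<close> and spreads along the chain
  that joins two representatives.\<close>

lemma hamiltonian_agree:
  assumes "c \<in> planes" "d \<in> planes" "chart \<alpha> c z = chart \<alpha> d w"
  shows "K c z = K d w"
proof -
  have "((c, z), (d, w)) \<in> ident (r_rel \<alpha>)" using assms chart_eq_iff[OF gen] by blast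
  then show ?thesis
    by (rule ident_step_induct[where P = "\<lambda>d w. K c z = K d w"]) (auto simp: step_def)
qed

text \<open>Needed so that a solution through a point of the overlap stays in the overlap for nearby
  times.\<close>

lemma open_chart_overlap:
  assumes c: "c \<in> planes" and d: "d \<in> planes"
  shows "open {z. chart \<alpha> c z \<in> range (chart \<alpha> d)}"
proof -
  have "chart \<alpha> c ` {z. chart \<alpha> c z \<in> range (chart \<alpha> d)} = range (chart \<alpha> c) \<inter> range (chart \<alpha> d)"
    by auto
  moreover have "openin (tp (atlas_space (Bl2 \<alpha>))) (range (chart \<alpha> c) \<inter> range (chart \<alpha> d))"
    using openin_range[OF open_embedding_chart[OF gen]] c d by (intro openin_Int) blast+
  ultimately show ?thesis
    using open_embedding_chart[OF gen c] unfolding open_embedding_def by metis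
qed

lemma inj_chart: "c \<in> planes \<Longrightarrow> inj (chart \<alpha> c)"
  using open_embedding_chart[OF gen] unfolding open_embedding_def by blast

lemma solves_at_step:
  assumes st: "step \<alpha> K (c, z) (d, w)" and c: "c \<in> planes" and sol: "solves_at (K c) t \<gamma>"
    and z: "\<gamma> t = z" and w: "\<eta> t = w"
    and ev: "\<forall>\<^sub>F s in nhds t. chart \<alpha> c (\<gamma> s) = chart \<alpha> d (\<eta> s)"
  shows "solves_at (K d) t \<eta>"
proof -
  obtain F U where d: "d \<in> planes" and U: "open U" "z \<in> U" "w = F z"
    and F: "\<And>u. u \<in> U \<Longrightarrow> chart \<alpha> c u = chart \<alpha> d (F u)" "\<And>u. u \<in> U \<Longrightarrow> K c u = K d (F u)"
      "\<And>u. u \<in> U \<Longrightarrow> symplectic_at F u"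
    using st unfolding step_def by auto
  have "\<forall>\<^sub>F s in nhds t. \<gamma> s \<in> U"
    using solves_at_eventually[OF sol] U(1,2) z by blast
  with ev have \<eta>: "\<forall>\<^sub>F s in nhds t. \<eta> s = F (\<gamma> s)"
  proof eventually_elim
    case (elim s)
    then have "chart \<alpha> d (\<eta> s) = chart \<alpha> d (F (\<gamma> s))" using F(1) by metis
    then show ?case using inj_chart[OF d] by (simp add: inj_eq)
  qed
  show ?thesis
    by (rule solves_at_transport[OF sol _ _ U(1) _ _ \<eta>]) (use z U F holo[OF d] in auto)
qed

text \<open>The chain joins the points at time \<open>t\<close> only and may pass through planes in
  which no curve is given. The induction therefore claims the result for every curve in the current
  plane that traces the same points near \<open>t\<close>.\<close>

lemma solves_at_chart:
  assumes c: "c \<in> planes" and d: "d \<in> planes" and sol: "solves_at (K c) t \<gamma>"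
    and ev: "\<forall>\<^sub>F s in nhds t. chart \<alpha> c (\<gamma> s) = chart \<alpha> d (\<eta> s)"
  shows "solves_at (K d) t \<eta>"
proof -
  define P where "P d w \<longleftrightarrow> d \<in> planes \<and> chart \<alpha> c (\<gamma> t) = chart \<alpha> d w \<and>
    (\<forall>\<eta>. \<eta> t = w \<longrightarrow> (\<forall>\<^sub>F s in nhds t. chart \<alpha> c (\<gamma> s) = chart \<alpha> d (\<eta> s)) \<longrightarrow>
      solves_at (K d) t \<eta>)" for d w
  have eq: "chart \<alpha> c (\<gamma> t) = chart \<alpha> d (\<eta> t)" using eventually_nhds_x_imp_x[OF ev] .
  then have "((c, \<gamma> t), (d, \<eta> t)) \<in> ident (r_rel \<alpha>)" using chart_eq_iff[OF gen c d] by blast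
  then have "P d (\<eta> t)"
  proof (rule ident_step_induct)
    have id: "symplectic_at (\<lambda>z. z) u" for u
      unfolding symplectic_at_def
      by (rule exI[of _ 1], rule exI[of _ 0], rule exI[of _ 0], rule exI[of _ 1]) simp
    have "step \<alpha> K (c, \<gamma> t) (c, \<gamma> t)"
      by (rule stepI[where U = UNIV and F = "\<lambda>z. z"]) (use c id in auto)
    then show "P c (\<gamma> t)" unfolding P_def using solves_at_step[OF _ c sol refl] c by blast
  next
    fix d w e v assume st: "step \<alpha> K (d, w) (e, v)" and P: "P d w"
    have d: "d \<in> planes" and dw: "chart \<alpha> c (\<gamma> t) = chart \<alpha> d w" using P unfolding P_def by blast+
    have e: "e \<in> planes" and ev: "chart \<alpha> d w = chart \<alpha> e v" using st unfolding step_def by auto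
    \<comment> \<open>The curve in the intermediate plane: \<open>inv\<close> is meaningful near
      \<open>t\<close> because the overlap of the planes is open.\<close>
    define \<eta> where "\<eta> s = inv (chart \<alpha> d) (chart \<alpha> c (\<gamma> s))" for s
    have \<eta>t: "\<eta> t = w" unfolding \<eta>_def dw by (simp add: inj_chart[OF d])
    have "\<forall>\<^sub>F s in nhds t. \<gamma> s \<in> {z. chart \<alpha> c z \<in> range (chart \<alpha> d)}"
      by (rule solves_at_eventually[OF sol open_chart_overlap[OF c d]]) (simp add: dw del: chart.simps)
    then have near: "\<forall>\<^sub>F s in nhds t. chart \<alpha> c (\<gamma> s) = chart \<alpha> d (\<eta> s)"
      by eventually_elim (simp add: \<eta>_def f_inv_into_f)
    then have sol': "solves_at (K d) t \<eta>" using P \<eta>t unfolding P_def by blast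
    have "solves_at (K e) t \<zeta>"
      if "\<zeta> t = v" "\<forall>\<^sub>F s in nhds t. chart \<alpha> c (\<gamma> s) = chart \<alpha> e (\<zeta> s)" for \<zeta>
    proof (rule solves_at_step[where \<gamma> = \<eta> and \<eta> = \<zeta>, OF st d sol' \<eta>t that(1)])
      show "\<forall>\<^sub>F s in nhds t. chart \<alpha> d (\<eta> s) = chart \<alpha> e (\<zeta> s)"
        using near that(2) by eventually_elim simp
    qed
    then show "P e v" unfolding P_def using e dw ev by simp
  qed
  then show ?thesis using ev unfolding P_def by blast
qed

end

section \<open>Birationality\<close>

definition poly_fun :: "(c2 \<Rightarrow> complex) \<Rightarrow> bool" where
  "poly_fun f \<longleftrightarrow> (\<exists>P. f = poly2 P)"

lemma poly_fun_intros:
  "poly_fun (\<lambda>z. c)" "poly_fun fst" "poly_fun snd"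
  "poly_fun f \<Longrightarrow> poly_fun g \<Longrightarrow> poly_fun (\<lambda>z. f z + g z)"
  "poly_fun f \<Longrightarrow> poly_fun g \<Longrightarrow> poly_fun (\<lambda>z. f z - g z)"
  "poly_fun f \<Longrightarrow> poly_fun g \<Longrightarrow> poly_fun (\<lambda>z. f z * g z)"
  "poly_fun f \<Longrightarrow> poly_fun (\<lambda>z. - f z)"
proof -
  show "poly_fun (\<lambda>z. c)"
    unfolding poly_fun_def by (rule exI[of _ "[:[:c:]:]"]) (auto simp: poly2_def)
  show "poly_fun fst"
    unfolding poly_fun_def by (rule exI[of _ "[:[:0, 1:]:]"]) (auto simp: poly2_def)
  show "poly_fun snd"
    unfolding poly_fun_def by (rule exI[of _ "[:0, 1:]"]) (auto simp: poly2_def)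
  show "poly_fun (\<lambda>z. f z + g z)" "poly_fun (\<lambda>z. f z - g z)" "poly_fun (\<lambda>z. f z * g z)"
    if fg: "poly_fun f" "poly_fun g"
  proof -
    obtain P Q where "f = poly2 P" "g = poly2 Q" using fg unfolding poly_fun_def by blast
    then have "(\<lambda>z. f z + g z) = poly2 (P + Q)" "(\<lambda>z. f z - g z) = poly2 (P - Q)"
      "(\<lambda>z. f z * g z) = poly2 (P * Q)" by (auto simp: poly2_def)
    then show "poly_fun (\<lambda>z. f z + g z)" "poly_fun (\<lambda>z. f z - g z)" "poly_fun (\<lambda>z. f z * g z)"
      unfolding poly_fun_def by blast+
  qed
  show "poly_fun (\<lambda>z. - f z)" if f: "poly_fun f"
  proof -
    obtain P where "f = poly2 P" using f unfolding poly_fun_def by blast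
    then have "(\<lambda>z. - f z) = poly2 (- P)" by (auto simp: poly2_def)
    then show ?thesis unfolding poly_fun_def by blast
  qed
qed

lemma rational_fun_poly: "poly_fun f \<Longrightarrow> rational_fun f"
proof -
  have one: "poly2 1 z = 1" for z by (cases z) (simp add: poly2_def)
  assume "poly_fun f"
  then obtain P where "f = poly2 P" unfolding poly_fun_def by blast
  then show ?thesis
    unfolding rational_fun_def by (intro exI[of _ P] exI[of _ 1]) (simp add: one)
qed

lemma poly2_coordinates: "poly2 [:[:0, 1:]:] = fst" "poly2 [:0, 1:] = snd"
  by (auto simp: poly2_def)

lemma rational_fun_inverse: "rational_fun (\<lambda>z. 1 / fst z)" "rational_fun (\<lambda>z. 1 / snd z)"
proof -
  have one: "poly2 1 z = 1" for z by (cases z) (simp add: poly2_def)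
  show "rational_fun (\<lambda>z. 1 / fst z)"
    unfolding rational_fun_def
    by (rule exI[of _ 1], rule exI[of _ "[:[:0, 1:]:]"]) (simp add: one poly2_coordinates)
  show "rational_fun (\<lambda>z. 1 / snd z)"
    unfolding rational_fun_def
    by (rule exI[of _ 1], rule exI[of _ "[:0, 1:]"]) (simp add: one poly2_coordinates)
qed

text \<open>The maps \<open>r_j\<close> and their inverses divide only by a coordinate, so the
  inversion identities hold off a coordinate line.\<close>

lemma generically_coordinate:
  "(\<And>z. fst z \<noteq> 0 \<Longrightarrow> Q z) \<Longrightarrow> generically Q" "(\<And>z. snd z \<noteq> 0 \<Longrightarrow> Q z) \<Longrightarrow> generically Q"
  unfolding generically_def
  by (rule exI[of _ "[:[:0, 1:]:]"], simp add: poly2_coordinates)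
    (rule exI[of _ "[:0, 1:]"], simp add: poly2_coordinates)

lemma rational_map_shear: "rational_map (shear s t a)"
  unfolding rational_map_def comp_def shear_def fst_conv snd_conv
  by (intro conjI rational_fun_inverse rational_fun_poly poly_fun_intros)

lemma rational_map_base_flip: "rational_map (base_flip a)"
  unfolding rational_map_def comp_def base_flip_def fst_conv snd_conv
  by (intro conjI rational_fun_inverse rational_fun_poly poly_fun_intros)

lemma birational_rmap: "j \<le> 7 \<Longrightarrow> birational (rmap \<alpha> j)"
proof (cases "j = 0")
  case True
  show ?thesis unfolding True rmap_0 birational_def
    by (intro conjI exI[of _ "base_flip (\<alpha> 0)"] rational_map_base_flip generically_coordinate(1)
        base_flip_inverse)
next
  case False
  assume "j \<le> 7"
  with False have j: "j \<in> {1..7}" by simp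
  show ?thesis unfolding rmap_shear[OF j] birational_def
    by (intro conjI exI[of _ "shear 0 (shift j) (root_of \<alpha> j)"] rational_map_shear
        generically_coordinate(2) shear_inverse)
qed

lemma symplectic_rmap: "j \<le> 7 \<Longrightarrow> symplectic_on (r_dom j) (rmap \<alpha> j)"
proof (cases "j = 0")
  case True
  then show ?thesis
    unfolding symplectic_on_iff using symplectic_base_flip by (auto simp: rmap_0 r_dom_def)
next
  case False
  assume "j \<le> 7"
  with False have j: "j \<in> {1..7}" by simp
  show ?thesis unfolding rmap_shear[OF j] symplectic_on_iff
    using symplectic_shear False by (auto simp: r_dom_def)
qed

theorem theorem9p2:
  fixes \<alpha> :: "nat \<Rightarrow> complex"
  assumes "4 * \<alpha> 0 + 3 * \<alpha> 1 + 2 * \<alpha> 2 + \<alpha> 3 + 3 * \<alpha> 4 + 2 * \<alpha> 5 + \<alpha> 6 + 2 * \<alpha> 7 = 0"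
    and "\<alpha> 2 \<noteq> 0" and "\<alpha> 3 \<noteq> 0" and "\<alpha> 2 + \<alpha> 3 \<noteq> 0"
    and "\<alpha> 5 \<noteq> 0" and "\<alpha> 6 \<noteq> 0" and "\<alpha> 5 + \<alpha> 6 \<noteq> 0"
  shows "(\<forall>j\<le>7. birational (rmap \<alpha> j) \<and> symplectic_on (r_dom j) (rmap \<alpha> j)) \<and>
    (\<exists>\<phi> :: plane \<Rightarrow> c2 \<Rightarrow> _.
      \<phi> QP = qp_point \<alpha> \<and>
      (\<forall>c\<in>planes. open_embedding (init_space \<alpha>) (\<phi> c)) \<and>
      topspace (tp (init_space \<alpha>)) = (\<Union>c\<in>planes. range (\<phi> c)) \<and>
      (\<forall>c\<in>planes. \<forall>d\<in>planes. \<forall>z w.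
         \<phi> c z = \<phi> d w \<longleftrightarrow> ((c, z), (d, w)) \<in> ident (r_rel \<alpha>)) \<and>
      (\<exists>H. hol (init_space \<alpha>) (topspace (tp (init_space \<alpha>))) H \<and>
         H \<circ> \<phi> QP = hamiltonian \<alpha> \<and>
         (\<forall>c\<in>planes. \<forall>d\<in>planes. \<forall>T \<gamma> \<eta>.
            open T \<and> (\<forall>t\<in>T. \<phi> c (\<gamma> t) = \<phi> d (\<eta> t)) \<longrightarrow>
            (solves_on (H \<circ> \<phi> c) T \<gamma> \<longleftrightarrow> solves_on (H \<circ> \<phi> d) T \<eta>))))"
proof -
  have gen: "generic \<alpha>" using assms(2-7) by (simp add: generic_def)
  obtain K where K: "K QP = hamiltonian \<alpha>" "\<And>c z. c \<in> planes \<Longrightarrow> holo_at (K c) z"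
    "\<And>z. fst z \<noteq> 0 \<Longrightarrow> K QP (base_flip (\<alpha> 0) z) = K (XY 0) z"
    "\<And>j z. j \<in> {1..7} \<Longrightarrow> snd z \<noteq> 0 \<Longrightarrow>
       K (base_plane j) (shear 0 (shift j) (root_of \<alpha> j) z) = K (XY j) z"
    using chart_hamiltonians[OF assms(1)] by blast
  interpret hamiltonian_charts \<alpha> K
    by unfold_locales (fact gen, fact K(2), fact K(3), fact K(4))
  define \<phi> where "\<phi> c = S_tilde_pt \<alpha> \<circ> chart \<alpha> c" for c
  have QP: "QP \<in> planes" by (simp add: planes_def)
  have \<phi>_eq: "\<phi> c z = \<phi> d w \<longleftrightarrow> chart \<alpha> c z = chart \<alpha> d w" if "c \<in> planes" "d \<in> planes" for c d z w
    using S_tilde_pt_eq_iff[OF gen, of "chart \<alpha> d w" "chart \<alpha> c z"] range_chart[OF that(2), of \<alpha> UNIV]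
    unfolding \<phi>_def comp_def by blast
  \<comment> \<open>\<open>SOME\<close> lets the functions \<open>K c\<close> descend to the
    surface; \<open>hamiltonian_agree\<close> makes the value independent of the representing plane
    and point.\<close>
  define H where "H x = (SOME h. \<exists>c\<in>planes. \<exists>z. x = \<phi> c z \<and> h = K c z)" for x
  have H: "H \<circ> \<phi> c = K c" if c: "c \<in> planes" for c
  proof
    fix z
    show "(H \<circ> \<phi> c) z = K c z"
      unfolding H_def comp_def
    proof (rule some_equality)
      fix h assume "\<exists>d\<in>planes. \<exists>w. \<phi> c z = \<phi> d w \<and> h = K d w"
      then obtain d w where "d \<in> planes" "\<phi> c z = \<phi> d w" "h = K d w" by blast
      then show "h = K c z" using \<phi>_eq[OF c] hamiltonian_agree[OF c] by metis
    qed (use c in blast)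
  qed
  have hol: "hol (init_space \<alpha>) (topspace (tp (init_space \<alpha>))) H"
    by (rule hol_init_space_cover[OF gen])
      (use H K(2) in \<open>simp add: \<phi>_def[symmetric] holomorphic2_on_iff\<close>)
  have solves: "solves_on (H \<circ> \<phi> d) T \<eta>"
    if c: "c \<in> planes" and d: "d \<in> planes" and T: "open T" "\<And>t. t \<in> T \<Longrightarrow> \<phi> c (\<gamma> t) = \<phi> d (\<eta> t)"
      and sol: "solves_on (H \<circ> \<phi> c) T \<gamma>" for c d T \<gamma> \<eta>
    unfolding H[OF d] solves_on_iff
  proof
    \<comment> \<open>Solving is a condition at each time, and openness of \<open>T\<close> turns
      agreement on \<open>T\<close> into agreement of germs.\<close>
    fix t assume t: "t \<in> T"
    have "\<forall>\<^sub>F s in nhds t. s \<in> T" using T(1) t by (rule eventually_nhds_in_open)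
    then have ev: "\<forall>\<^sub>F s in nhds t. chart \<alpha> c (\<gamma> s) = chart \<alpha> d (\<eta> s)"
      by eventually_elim (use T(2) \<phi>_eq[OF c d] in blast)
    have "solves_at (K c) t \<gamma>" using sol t unfolding H[OF c] solves_on_iff by blast
    then show "solves_at (K d) t \<eta>" using solves_at_chart[OF c d _ ev] by blast
  qed
  have top: "topspace (tp (init_space \<alpha>)) = (\<Union>c\<in>planes. range (\<phi> c))"
    unfolding topspace_init_space[OF gen] affine_part_def \<phi>_def by (simp add: image_UN image_comp)
  have \<phi>_QP: "\<phi> QP = qp_point \<alpha>"
    by (auto simp: \<phi>_def qp_point_def)
  show ?thesis
  proof (intro conjI allI impI exI[of _ \<phi>] exI[of _ H] ballI)
    fix c d assume cd: "c \<in> planes" "d \<in> planes"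
    show "\<phi> c z = \<phi> d w \<longleftrightarrow> ((c, z), (d, w)) \<in> ident (r_rel \<alpha>)" for z w
      unfolding \<phi>_eq[OF cd] by (rule chart_eq_iff[OF gen cd])
    fix T :: "complex set" and \<gamma> \<eta> :: "complex \<Rightarrow> c2"
    assume "open T \<and> (\<forall>t\<in>T. \<phi> c (\<gamma> t) = \<phi> d (\<eta> t))"
    then show "solves_on (H \<circ> \<phi> c) T \<gamma> \<longleftrightarrow> solves_on (H \<circ> \<phi> d) T \<eta>"
      using solves[OF cd, of T \<gamma> \<eta>] solves[OF cd(2,1), of T \<eta> \<gamma>] by auto
  next
    show "open_embedding (init_space \<alpha>) (\<phi> c)" if "c \<in> planes" for c
      unfolding \<phi>_def by (rule open_embedding_init_space[OF gen that])
  qed (use birational_rmap symplectic_rmap \<phi>_QP top hol H[OF QP] K(1) in auto)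
qed

end
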